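(* Let $d\in\mathbb{N}^*$, $\mathbb{T}^d=\mathbb{R}^d/2\pi\mathbb{Z}^d$, let $q\in\mathbb{N}$ with $q\ge 2d+1$, and let $Q=(Q_1,\dots,Q_q,\mu_1,\mu_2):\mathbb{T}^d\to\mathbb{R}^{q+2}$ be bounded and measurable. Let $s\in\mathbb{N}^*$ with $s>d/2$, $\kappa\in\mathbb{R}$ and $p\in\mathbb{N}$. Assume that $Q_1,\dots,Q_q\in C^\infty(\mathbb{T}^d,\mathbb{R})$ and that $$\{1,\ \cos\langle k,x\rangle,\ \sin\langle k,x\rangle\}_{k\in\mathcal{K}}\subset \mathrm{span}_{\mathbb{R}}\{Q_1,\dots,Q_q\},$$ where $\mathcal{K}=\{(1,0,\dots,0),(0,1,0,\dots,0),\dots,(0,\dots,0,1,0),(1,\dots,1)\}\subset\mathbb{Z}^d$ consists of the first $d-1$ vectors of the canonical basis together with $(1,\dots,1)$. Consider the equation $$\partial_t\psi(t,x)=\big(\Delta-\kappa\psi(t,x)^p+\langle u(t),Q(x)\rangle\big)\psi(t,x),\qquad \psi(0,\cdot)=\psi_0, \qquad x\in\mathbb{T}^d,\ t>0,$$ and denote by $\psi(t;\psi_0,u)$ its solution. Then: (i) Let $\psi_0,\psi_1\in H^s(\mathbb{T}^d,\mathbb{R})$ be such that $\mathrm{sign}(\psi_0)=\mathrm{sign}(\psi_1)$. For any $\epsilon>0$ and $T>0$ there exist $\tau\in[0,T]$ and $(u_1,\dots,u_q)\in L^2((0,\tau),\mathbb{R}^q)$ such that, with $u=(u_1,\dots,u_q,0,0)$,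 $$\|\psi(\tau;\psi_0,u)-\psi_1\|_{L^2}<\epsilon.$$ (ii) Let $\psi_0,\psi_1\in H^s(\mathbb{T}^d,\mathbb{R})$ be such that $\psi_0,\psi_1>0$ (or $\psi_0,\psi_1<0$). For any $\epsilon>0$ and $T>0$ there exists $(u_1,\dots,u_q)\in L^2((0,T),\mathbb{R}^q)$ such that, with $u=(u_1,\dots,u_q,0,0)$, $$\|\psi(T;\psi_0,u)-\psi_1\|_{H^s}<\epsilon.$$
   Context: $\mathbb{N}=\{0,1,2,\dots\}$, $\mathbb{N}^*=\mathbb{N}\setminus\{0\}$. "Solution" means mild solution: $\psi\in C^0([0,T],H^s(\mathbb{T}^d,\mathbb{R}))$ satisfying $\psi(t)=e^{t\Delta}\psi_0+\int_0^t e^{(t-r)\Delta}\big(\langle u(r),Q\rangle\psi(r)-\kappa\psi(r)^{p+1}\big)dr$; when it exists on $[0,T]$ it is unique. The existence of the solution $\psi(\cdot;\psi_0,u)$ on $[0,\tau]$ in (i), respectively on $[0,T]$ in (ii), is part of the assertions. Since $s>d/2$, elements of $H^s$ are identified with their continuous representatives; $\mathrm{sign}(\psi_0)=\mathrm{sign}(\psi_1)$ is meant pointwise on $\mathbb{T}^d$ with $\mathrm{sign}$ taking values in $\{-1,0,1\}$ and $\mathrm{sign}(0)=0$, and $\psi_j>0$ means $\psi_j(x)>0$ for all $x\in\mathbb{T}^d$. *)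

theory Defs
  imports "HOL-Analysis.Analysis"
begin

section \<open>Functions on the torus\<close>

text \<open>A function on the torus \<open>\<real>\<^sup>d / 2\<pi>\<int>\<^sup>d\<close>, with \<open>d = CARD('d)\<close>, is a function
  on \<open>\<real>\<^sup>d\<close> that is \<open>2\<pi>\<close>-periodic in every coordinate.\<close>

definition torus_periodic :: "(real^'d::finite \<Rightarrow> 'b) \<Rightarrow> bool" where
  "torus_periodic f \<longleftrightarrow> (\<forall>x i. f (x + axis i (2 * pi)) = f x)"

definition torus_cell :: "(real^'d::finite) set" where
  "torus_cell = cbox 0 (\<chi> i. 2 * pi)"

definition L2_torus_norm :: "(real^'d::finite \<Rightarrow> real) \<Rightarrow> real" where
  "L2_torus_norm f = sqrt (LINT x:torus_cell|lborel. (f x)\<^sup>2)"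

fun C_k :: "nat \<Rightarrow> (real^'d::finite \<Rightarrow> real) \<Rightarrow> bool" where
  "C_k 0 f \<longleftrightarrow> continuous_on UNIV f"
| "C_k (Suc n) f \<longleftrightarrow>
     (\<exists>g :: real^'d \<Rightarrow> real^'d. (\<forall>x. (f has_derivative (\<lambda>h. g x \<bullet> h)) (at x)) \<and>
        (\<forall>i. C_k n (\<lambda>x. g x $ i)))"

definition C_infinity :: "(real^'d::finite \<Rightarrow> real) \<Rightarrow> bool" where
  "C_infinity f \<longleftrightarrow> (\<forall>n. C_k n f)"

definition span_of_family :: "('q::finite \<Rightarrow> 'x \<Rightarrow> real) \<Rightarrow> ('x \<Rightarrow> real) set" where
  "span_of_family F = {f. \<exists>c. f = (\<lambda>x. \<Sum>j\<in>UNIV. c j * F j x)}"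


section \<open>Fourier coefficients, Sobolev spaces and the heat semigroup\<close>

definition freq_dot :: "int^'d::finite \<Rightarrow> real^'d \<Rightarrow> real" where
  "freq_dot k x = (\<Sum>i\<in>UNIV. of_int (k $ i) * x $ i)"

definition freq_norm_sq :: "int^'d::finite \<Rightarrow> real" where
  "freq_norm_sq k = (\<Sum>i\<in>UNIV. (of_int (k $ i))\<^sup>2)"

definition fourier_coeff :: "(real^'d::finite \<Rightarrow> real) \<Rightarrow> int^'d \<Rightarrow> complex" where
  "fourier_coeff f k =
     (LINT x:torus_cell|lborel. complex_of_real (f x) * cis (- freq_dot k x))
       / of_real ((2 * pi) ^ CARD('d))"

definition Hs_norm :: "nat \<Rightarrow> (real^'d::finite \<Rightarrow> real) \<Rightarrow> real" where
  "Hs_norm s f = sqrt (\<Sum>\<^sub>\<infinity>k. (1 + freq_norm_sq k) ^ s * (cmod (fourier_coeff f k))\<^sup>2)"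

text \<open>The real Sobolev space \<open>H\<^sup>s\<close> of the torus for \<open>s > d/2\<close>, where every class has exactly
  one continuous representative; the elements are these representatives.\<close>

definition Hs :: "nat \<Rightarrow> (real^'d::finite \<Rightarrow> real) set" where
  "Hs s = {f. torus_periodic f \<and> continuous_on UNIV f \<and>
     (\<lambda>k. (1 + freq_norm_sq k) ^ s * (cmod (fourier_coeff f k))\<^sup>2) summable_on UNIV}"

text \<open>The operator \<open>e\<^bsup>t\<Delta>\<^esup>\<close>. The sum is real for real \<open>f\<close>, and it converges absolutely for
  \<open>t \<ge> 0\<close> and \<open>f \<in> H\<^sup>s\<close> with \<open>s > d/2\<close>.\<close>

definition heat :: "real \<Rightarrow> (real^'d::finite \<Rightarrow> real) \<Rightarrow> real^'d \<Rightarrow> real" where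
  "heat t f x =
     Re (\<Sum>\<^sub>\<infinity>k. of_real (exp (- t * freq_norm_sq k)) * fourier_coeff f k * cis (freq_dot k x))"


section \<open>Bochner integral of curves with values in the Sobolev space\<close>

text \<open>Since \<open>H\<^sup>s\<close> is not a type, the usual definition is repeated here: the integral over
  \<open>(0,t)\<close> is the limit of the integrals of simple functions that approximate the integrand
  in the \<open>L\<^sup>1\<close> sense. As in \<^const>\<open>has_bochner_integral\<close>, the distance to the simple
  functions has to be measurable for the upper integral to make sense.\<close>

definition Hs_simple :: "nat \<Rightarrow> real \<Rightarrow> (real \<Rightarrow> real^'d::finite \<Rightarrow> real) \<Rightarrow> bool" where
  "Hs_simple s t S \<longleftrightarrow> finite (S ` {0<..<t}) \<and> S ` {0<..<t} \<subseteq> Hs s \<and>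
     (\<forall>f. {r \<in> {0<..<t}. S r = f} \<in> sets lborel)"

definition simple_Hs_integral ::
    "real \<Rightarrow> (real \<Rightarrow> real^'d::finite \<Rightarrow> real) \<Rightarrow> real^'d \<Rightarrow> real" where
  "simple_Hs_integral t S =
     (\<lambda>x. \<Sum>f\<in>S ` {0<..<t}. measure lborel {r \<in> {0<..<t}. S r = f} * f x)"

definition has_Hs_integral ::
    "nat \<Rightarrow> real \<Rightarrow> (real \<Rightarrow> real^'d::finite \<Rightarrow> real) \<Rightarrow> (real^'d \<Rightarrow> real) \<Rightarrow> bool" where
  "has_Hs_integral s t F g \<longleftrightarrow>
     (\<forall>r\<in>{0<..<t}. F r \<in> Hs s) \<and> g \<in> Hs s \<and>
     (\<exists>S :: nat \<Rightarrow> real \<Rightarrow> real^'d \<Rightarrow> real.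
        (\<forall>n. Hs_simple s t (S n)) \<and>
        (\<forall>n. set_borel_measurable lborel {0<..<t} (\<lambda>r. Hs_norm s (F r - S n r))) \<and>
        (\<lambda>n. \<integral>\<^sup>+r\<in>{0<..<t}. ennreal (Hs_norm s (F r - S n r)) \<partial>lborel) \<longlonglongrightarrow> 0 \<and>
        (\<lambda>n. Hs_norm s (simple_Hs_integral t (S n) - g)) \<longlonglongrightarrow> 0)"


section \<open>The controlled heat equation\<close>

text \<open>The space \<open>\<real>\<^bsup>q+2\<^esup>\<close> is \<^typ>\<open>(real^'q) \<times> real \<times> real\<close> with \<open>q = CARD('q)\<close>, and \<open>\<bullet>\<close> on it
  is the Euclidean inner product.\<close>

definition mild_solution ::
    "nat \<Rightarrow> real \<Rightarrow> nat \<Rightarrow> (real^'d::finite \<Rightarrow> (real^'q::finite) \<times> real \<times> real) \<Rightarrow>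
     (real^'d \<Rightarrow> real) \<Rightarrow> (real \<Rightarrow> (real^'q) \<times> real \<times> real) \<Rightarrow> real \<Rightarrow>
     (real \<Rightarrow> real^'d \<Rightarrow> real) \<Rightarrow> bool" where
  "mild_solution s \<kappa> p Q \<psi>0 u T \<psi> \<longleftrightarrow>
     (\<forall>t\<in>{0..T}. \<psi> t \<in> Hs s) \<and>
     (\<forall>t\<in>{0..T}. ((\<lambda>r. Hs_norm s (\<psi> r - \<psi> t)) \<longlongrightarrow> 0) (at t within {0..T})) \<and>
     (\<forall>t\<in>{0..T}. \<exists>g.
        has_Hs_integral s t
          (\<lambda>r. heat (t - r) (\<lambda>x. (u r \<bullet> Q x) * \<psi> r x - \<kappa> * \<psi> r x ^ (p + 1))) g \<and>
        (\<forall>x. \<psi> t x = heat t \<psi>0 x + g x))"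

definition L2_control :: "real \<Rightarrow> (real \<Rightarrow> real^'q::finite) \<Rightarrow> bool" where
  "L2_control T v \<longleftrightarrow> set_borel_measurable lborel {0<..<T} v \<and>
     set_integrable lborel {0<..<T} (\<lambda>t. (norm (v t))\<^sup>2)"

text \<open>The first \<open>d - 1\<close> vectors of the canonical basis and \<open>(1,\<dots>,1)\<close>; the coordinates are
  numbered by the linear order of the index type.\<close>

definition control_freqs :: "(int^'d::{finite,linorder}) set" where
  "control_freqs = {axis i 1 | i. i \<noteq> Max UNIV} \<union> {\<chi> i. 1}"

end

theory Submission
  imports Defs
begin

text \<open>A large control \<open>\<phi> / \<delta>\<close> acting during the short time \<open>\<delta>\<close> approximately multiplies the state by
  \<open>exp \<phi>\<close>. Call \<open>\<phi>\<close> attainable if this multiplication can be approximated in arbitrarily short time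
  from every state. The attainable functions form a closed set that is stable under addition and contains
  the span of the controls. Conjugating a free evolution of length \<open>\<epsilon>\<^sup>2\<close> by \<open>exp (\<phi> / \<epsilon>)\<close> gives, as
  \<open>\<epsilon> \<rightarrow> 0\<close>, the multiplication by \<open>exp \<bar>\<nabla>\<phi>\<bar>\<^sup>2\<close>. For trigonometric polynomials this turns frequencies
  \<open>k, l\<close> with \<open>k \<bullet> l \<noteq> 0\<close> into \<open>k + l\<close>, so that starting from the given ones all frequencies, and hence all
  functions in \<open>H\<^sup>s\<close>, are attainable. A positive state is steered to a constant and from there to the
  target by multiplications, and the remaining time is spent at the constant, where a constant control
  balances the nonlinearity. Multipliers \<open>exp \<phi>\<close> between states with equal signs and zeros approximate
  the target only in \<open>L\<^sup>2\<close>.\<close>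

section \<open>Hermitian square-summable sequences\<close>

text \<open>The norm of the multiplication by \<open>E ((1 / \<epsilon>) *\<^sub>R \<phi>)\<close>
  may explode as \<epsilon> tends to 0, so the gradient move cannot be estimated factor by factor:
  the conjugated semigroup has to be bounded as a single operator. To this end the heat semigroup is
  written as a limit of averages of translations. Conjugating a translation leaves only a difference
  quotient of \<phi> in the exponent, and the exponential moments of a finite random walk are
  explicit powers of cosh. The same explosion threatens the nonlinear term, which picks up the
  factor exp (p \<phi> / \<epsilon>); this is met by lowering \<phi> by a constant, which is
  possible because constants are among the controls. Trajectories are fixed points in a tube around
  an approximate path, so existence and closeness come together. Functions are replaced by weighted
  Fourier coefficients: these form a Banach space type, on which closures, integrals and contraction
  arguments are at hand, and the Hermitian symmetry expresses that the functions are real.\<close>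

typedef (overloaded) 'k hl2 =
  "{c :: 'k::ab_group_add \<Rightarrow> complex. (\<lambda>k. (cmod (c k))\<^sup>2) summable_on UNIV \<and> (\<forall>k. c (- k) = cnj (c k))}"
  morphisms coef Abs_hl2
  by (rule exI[of _ "\<lambda>_. 0"]) auto

setup_lifting type_definition_hl2

lemma coef_summable: "(\<lambda>k. (cmod (coef c k))\<^sup>2) summable_on UNIV"
  using coef[of c] by simp

lemma coef_uminus: "coef c (- k) = cnj (coef c k)"
  using coef[of c] by simp

lemma hl2_eqI: "(\<And>k. coef a k = coef b k) \<Longrightarrow> a = b"
  using coef_inject by blast

text \<open>Reduces square-summability to finite sections, where Minkowski's inequality for
  \<open>L2_set\<close> applies.\<close>

lemma square_summable_iff_L2_set_bounded:
  fixes f :: "'k \<Rightarrow> real"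
  shows "(\<lambda>k. (f k)\<^sup>2) summable_on UNIV \<longleftrightarrow> (\<exists>B. \<forall>F. finite F \<longrightarrow> L2_set f F \<le> B)"
proof
  assume *: "(\<lambda>k. (f k)\<^sup>2) summable_on UNIV"
  have "L2_set f F \<le> sqrt (\<Sum>\<^sub>\<infinity>k. (f k)\<^sup>2)" if "finite F" for F
    unfolding L2_set_def using finite_sum_le_infsum[OF * that] by simp
  then show "\<exists>B. \<forall>F. finite F \<longrightarrow> L2_set f F \<le> B" by blast
next
  assume "\<exists>B. \<forall>F. finite F \<longrightarrow> L2_set f F \<le> B"
  then obtain B where B: "\<And>F. finite F \<Longrightarrow> L2_set f F \<le> B" by blast
  show "(\<lambda>k. (f k)\<^sup>2) summable_on UNIV"
  proof (rule nonneg_bdd_above_summable_on)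
    show "bdd_above (sum (\<lambda>k. (f k)\<^sup>2) ` {F. F \<subseteq> UNIV \<and> finite F})"
      by (rule bdd_aboveI2[of _ _ "B\<^sup>2"]) (use B in \<open>auto simp: L2_set_def real_sqrt_le_iff' sqrt_le_D\<close>)
  qed auto
qed

lemma L2_set_sum_le:
  assumes "finite G"
  shows "L2_set (\<lambda>k. \<Sum>l\<in>G. g l k) F \<le> (\<Sum>l\<in>G. L2_set (g l) F)"
  using assms
proof (induction G rule: finite_induct)
  case empty
  then show ?case by (simp add: L2_set_0')
next
  case (insert x G)
  have "L2_set (\<lambda>k. \<Sum>l\<in>insert x G. g l k) F = L2_set (\<lambda>k. g x k + (\<Sum>l\<in>G. g l k)) F"
    using insert by simp
  also have "\<dots> \<le> L2_set (g x) F + L2_set (\<lambda>k. \<Sum>l\<in>G. g l k) F"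
    by (rule L2_set_triangle_ineq)
  finally show ?case using insert by simp
qed

lemma L2_set_cmod_add:
  "L2_set (\<lambda>k. cmod (f k + g k)) F \<le> L2_set (\<lambda>k. cmod (f k)) F + L2_set (\<lambda>k. cmod (g k)) F"
  by (rule order_trans[OF _ L2_set_triangle_ineq]) (auto intro!: L2_set_mono norm_triangle_ineq)

instantiation hl2 :: (ab_group_add) real_normed_vector
begin

lift_definition zero_hl2 :: "'a hl2" is "\<lambda>_. 0" by simp

lift_definition uminus_hl2 :: "'a hl2 \<Rightarrow> 'a hl2" is "\<lambda>a k. - a k" by simp

lift_definition plus_hl2 :: "'a hl2 \<Rightarrow> 'a hl2 \<Rightarrow> 'a hl2" is "\<lambda>a b k. a k + b k"
proof -
  fix f g :: "'a \<Rightarrow> complex"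
  assume *: "(\<lambda>k. (cmod (f k))\<^sup>2) summable_on UNIV \<and> (\<forall>k. f (- k) = cnj (f k))"
    "(\<lambda>k. (cmod (g k))\<^sup>2) summable_on UNIV \<and> (\<forall>k. g (- k) = cnj (g k))"
  then obtain A B where A: "\<And>F. finite F \<Longrightarrow> L2_set (\<lambda>k. cmod (f k)) F \<le> A"
    and B: "\<And>F. finite F \<Longrightarrow> L2_set (\<lambda>k. cmod (g k)) F \<le> B"
    unfolding square_summable_iff_L2_set_bounded by metis
  have "L2_set (\<lambda>k. cmod (f k + g k)) F \<le> A + B" if "finite F" for F
    using L2_set_cmod_add[of f g F] A[OF that] B[OF that] by linarith
  then show "(\<lambda>k. (cmod (f k + g k))\<^sup>2) summable_on UNIV \<and> (\<forall>k. f (- k) + g (- k) = cnj (f k + g k))"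
    unfolding square_summable_iff_L2_set_bounded using * by auto
qed

lift_definition minus_hl2 :: "'a hl2 \<Rightarrow> 'a hl2 \<Rightarrow> 'a hl2" is "\<lambda>a b k. a k - b k"
proof -
  fix f g :: "'a \<Rightarrow> complex"
  assume *: "(\<lambda>k. (cmod (f k))\<^sup>2) summable_on UNIV \<and> (\<forall>k. f (- k) = cnj (f k))"
    "(\<lambda>k. (cmod (g k))\<^sup>2) summable_on UNIV \<and> (\<forall>k. g (- k) = cnj (g k))"
  then obtain A B where A: "\<And>F. finite F \<Longrightarrow> L2_set (\<lambda>k. cmod (f k)) F \<le> A"
    and B: "\<And>F. finite F \<Longrightarrow> L2_set (\<lambda>k. cmod (g k)) F \<le> B"
    unfolding square_summable_iff_L2_set_bounded by metis
  have "L2_set (\<lambda>k. cmod (f k - g k)) F \<le> A + B" if "finite F" for F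
    using L2_set_cmod_add[of f "\<lambda>k. - g k" F] A[OF that] B[OF that] by simp
  then show "(\<lambda>k. (cmod (f k - g k))\<^sup>2) summable_on UNIV \<and> (\<forall>k. f (- k) - g (- k) = cnj (f k - g k))"
    unfolding square_summable_iff_L2_set_bounded using * by auto
qed

lift_definition scaleR_hl2 :: "real \<Rightarrow> 'a hl2 \<Rightarrow> 'a hl2" is "\<lambda>r a k. of_real r * a k"
  by (auto simp: norm_mult power_mult_distrib intro!: summable_on_cmult_right)

definition norm_hl2 :: "'a hl2 \<Rightarrow> real" where
  "norm_hl2 a = sqrt (\<Sum>\<^sub>\<infinity>k. (cmod (coef a k))\<^sup>2)"

definition sgn_hl2 :: "'a hl2 \<Rightarrow> 'a hl2" where "sgn_hl2 a = scaleR (inverse (norm a)) a"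
definition dist_hl2 :: "'a hl2 \<Rightarrow> 'a hl2 \<Rightarrow> real" where "dist_hl2 a b = norm (a - b)"
definition uniformity_hl2 :: "('a hl2 \<times> 'a hl2) filter" where
  "uniformity_hl2 = (INF e\<in>{0 <..}. principal {(x, y). dist x y < e})"
definition open_hl2 :: "'a hl2 set \<Rightarrow> bool" where
  "open_hl2 U \<longleftrightarrow> (\<forall>x\<in>U. eventually (\<lambda>(x', y). x' = x \<longrightarrow> y \<in> U) uniformity)"

lemma L2_set_coef_le_norm: "finite F \<Longrightarrow> L2_set (\<lambda>k. cmod (coef a k)) F \<le> norm a"
  unfolding L2_set_def norm_hl2_def using finite_sum_le_infsum[OF coef_summable] by simp

lemma norm_hl2_le:
  assumes "\<And>F. finite F \<Longrightarrow> L2_set (\<lambda>k. cmod (coef a k)) F \<le> B"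
  shows "norm a \<le> B"
proof -
  have B: "B \<ge> 0" using assms[of "{}"] by simp
  have "(\<Sum>\<^sub>\<infinity>k. (cmod (coef a k))\<^sup>2) \<le> B\<^sup>2"
    by (rule infsum_le_finite_sums[OF coef_summable])
      (use assms in \<open>auto simp: L2_set_def sqrt_le_D\<close>)
  then show ?thesis unfolding norm_hl2_def using B by (simp add: real_le_lsqrt)
qed

instance
proof
  fix x y :: "'a hl2" and r t :: real
  show "x + y + z = x + (y + z)" for z by transfer (auto simp: algebra_simps)
  show "x + y = y + x" by transfer (auto simp: algebra_simps)
  show "0 + x = x" by transfer auto
  show "- x + x = 0" by transfer auto
  show "x - y = x + - y" by transfer auto
  show "r *\<^sub>R (x + y) = r *\<^sub>R x + r *\<^sub>R y" by transfer (auto simp: algebra_simps)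
  show "(r + t) *\<^sub>R x = r *\<^sub>R x + t *\<^sub>R x" by transfer (auto simp: algebra_simps)
  show "r *\<^sub>R t *\<^sub>R x = (r * t) *\<^sub>R x" by transfer (auto simp: algebra_simps)
  show "1 *\<^sub>R x = x" by transfer auto
  show "dist x y = norm (x - y)" by (rule dist_hl2_def)
  show "sgn x = scaleR (inverse (norm x)) x" by (rule sgn_hl2_def)
  show "uniformity = (INF e\<in>{0 <..}. principal {(x::'a hl2, y). dist x y < e})"
    by (rule uniformity_hl2_def)
  show "open U \<longleftrightarrow> (\<forall>x\<in>U. \<forall>\<^sub>F (x', y) in uniformity. x' = x \<longrightarrow> y \<in> U)" for U :: "'a hl2 set"
    by (rule open_hl2_def)
  show "norm x = 0 \<longleftrightarrow> x = 0"
  proof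
    assume "norm x = 0"
    then have "cmod (coef x k) \<le> 0" for k
      using L2_set_coef_le_norm[of "{k}" x] by simp
    then show "x = 0" by (intro hl2_eqI) (simp add: zero_hl2.rep_eq)
  qed (simp add: norm_hl2_def zero_hl2.rep_eq)
  show "norm (x + y) \<le> norm x + norm y"
  proof (rule norm_hl2_le)
    fix F :: "'a set" assume "finite F"
    then show "L2_set (\<lambda>k. cmod (coef (x + y) k)) F \<le> norm x + norm y"
      using L2_set_cmod_add[of "coef x" "coef y" F] L2_set_coef_le_norm[of F x] L2_set_coef_le_norm[of F y]
      by (simp add: plus_hl2.rep_eq)
  qed
  show "norm (r *\<^sub>R x) = \<bar>r\<bar> * norm x"
    unfolding norm_hl2_def scaleR_hl2.rep_eq
    by (simp add: norm_mult power_mult_distrib infsum_cmult_right' real_sqrt_mult)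
qed

end

lemma coef_simps [simp]:
  "coef 0 k = 0" "coef (a + b) k = coef a k + coef b k" "coef (a - b) k = coef a k - coef b k"
  "coef (- a) k = - coef a k" "coef (r *\<^sub>R a) k = of_real r * coef a k"
  by (simp_all add: zero_hl2.rep_eq plus_hl2.rep_eq minus_hl2.rep_eq uminus_hl2.rep_eq scaleR_hl2.rep_eq)

lemma coef_sum [simp]: "coef (sum f A) k = (\<Sum>i\<in>A. coef (f i) k)"
  by (induction A rule: infinite_finite_induct) auto

lemma cmod_coef_le: "cmod (coef a k) \<le> norm a"
  using L2_set_coef_le_norm[of "{k}" a] by simp

lemma bounded_linear_coef: "bounded_linear (\<lambda>a. coef a k)"
  by (rule bounded_linear_intro[of _ 1]) (auto simp: cmod_coef_le scaleR_conv_of_real)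

text \<open>The way in which elements are built: a bound on all finite sections yields membership
  and the norm estimate at once.\<close>

lemma ex_hl2:
  assumes "\<And>F. finite F \<Longrightarrow> L2_set (\<lambda>k. cmod (c k)) F \<le> B" and "\<And>k. c (- k) = cnj (c k)"
  obtains a where "\<And>k. coef a k = c k" and "norm a \<le> B"
proof -
  have "(\<lambda>k. (cmod (c k))\<^sup>2) summable_on UNIV"
    unfolding square_summable_iff_L2_set_bounded using assms(1) by blast
  then have *: "coef (Abs_hl2 c) k = c k" for k
    using assms(2) by (subst Abs_hl2_inverse) auto
  show ?thesis
    by (rule that[OF *], rule norm_hl2_le) (use * assms(1) in simp)
qed

text \<open>Coefficients are continuous, so they converge one by one. Bounds on finite sections
  survive this limit; this gives first the membership of the limit sequence and then convergence in
  norm.\<close>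

instance hl2 :: (ab_group_add) banach
proof
  fix X :: "nat \<Rightarrow> 'a hl2" assume X: "Cauchy X"
  have "Cauchy (\<lambda>n. coef (X n) k)" for k
    using bounded_linear.Cauchy[OF bounded_linear_coef X] .
  then have "\<exists>c. (\<lambda>n. coef (X n) k) \<longlonglongrightarrow> c" for k
    by (simp add: Cauchy_convergent_iff convergent_def)
  then obtain c where c: "\<And>k. (\<lambda>n. coef (X n) k) \<longlonglongrightarrow> c k" by metis
  have lim: "(\<lambda>n. L2_set (\<lambda>k. cmod (coef (X n - a) k)) F) \<longlonglongrightarrow> L2_set (\<lambda>k. cmod (c k - coef a k)) F" for F a
    unfolding L2_set_def coef_simps by (intro tendsto_intros c)
  have herm: "c (- k) = cnj (c k)" for k
    using tendsto_cnj[OF c[of k]] LIMSEQ_unique[OF c[of "- k"]] by (simp add: coef_uminus)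
  obtain B where "\<And>n. norm (X n) \<le> B"
    using Cauchy_Bseq[OF X] by (meson Bseq_def)
  then have "L2_set (\<lambda>k. cmod (coef (X n - 0) k)) F \<le> B" if "finite F" for n F
    using L2_set_coef_le_norm[OF that, of "X n"] order_trans by force
  then have "L2_set (\<lambda>k. cmod (c k)) F \<le> B" if "finite F" for F
    using LIMSEQ_le_const2[OF lim[of 0 F]] that by fastforce
  then obtain a where a: "\<And>k. coef a k = c k" using ex_hl2[of c B] herm by metis
  have "X \<longlonglongrightarrow> a"
  proof (rule LIMSEQ_I)
    fix e :: real assume "e > 0"
    then obtain N where N: "\<And>m n. m \<ge> N \<Longrightarrow> n \<ge> N \<Longrightarrow> norm (X m - X n) < e / 2"
      using CauchyD[OF X, of "e/2"] by auto
    have "norm (X n - a) \<le> e / 2" if "n \<ge> N" for n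
    proof (rule norm_hl2_le)
      fix F :: "'a set" assume F: "finite F"
      have "L2_set (\<lambda>k. cmod (c k - coef (X n) k)) F \<le> e / 2"
        by (rule LIMSEQ_le_const2[OF lim[of "X n" F]])
          (use N that L2_set_coef_le_norm[OF F] in \<open>meson less_imp_le order_trans\<close>)
      then show "L2_set (\<lambda>k. cmod (coef (X n - a) k)) F \<le> e / 2"
        by (simp add: a norm_minus_commute)
    qed
    then show "\<exists>N. \<forall>n\<ge>N. norm (X n - a) < e" using \<open>e > 0\<close> by (intro exI[of _ N]) force
  qed
  then show "convergent X" by (auto simp: convergent_def)
qed

section \<open>Characters of the torus\<close>

lemma cis_sum: "finite A \<Longrightarrow> cis (\<Sum>i\<in>A. f i) = (\<Prod>i\<in>A. cis (f i))"
  by (induction A rule: finite_induct) (simp_all flip: cis_mult)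

text \<open>Fubini in coordinates: \<open>lborel\<close> is the image of a product measure indexed
  by the standard basis.\<close>

lemma integral_lborel_vec_prod:
  fixes g :: "'d::finite \<Rightarrow> real \<Rightarrow> complex"
  assumes g: "\<And>i. integrable lborel (g i)"
  shows "(LINT x|lborel. (\<Prod>i\<in>UNIV. g i (x $ i))) = (\<Prod>i\<in>UNIV. LINT t|lborel. g i t)"
proof -
  interpret product_sigma_finite "\<lambda>_::real^'d. lborel :: real measure" by standard
  have B: "(Basis :: (real^'d) set) = (\<lambda>i. axis i 1) ` UNIV"
    by (auto simp: Basis_vec_def)
  have inj: "inj (\<lambda>i::'d. axis i (1::real))" by (auto simp: inj_def axis_eq_axis)
  \<comment> \<open>The product measure is indexed by basis vectors instead of coordinate indices,
    so the factors are relabelled.\<close>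
  define h where "h b = g (the_inv (\<lambda>i::'d. axis i (1::real)) b)" for b
  have h: "h (axis i 1) = g i" for i by (simp add: h_def the_inv_f_f[OF inj])
  have comp: "(\<Sum>b\<in>Basis. f b *\<^sub>R b) $ i = f (axis i 1)" for f :: "real^'d \<Rightarrow> real" and i
  proof -
    have "(\<Sum>b\<in>Basis. f b *\<^sub>R b) $ i = (\<Sum>b\<in>Basis. f b *\<^sub>R b) \<bullet> axis i 1"
      by (simp add: inner_axis)
    also have "\<dots> = f (axis i 1)"
      by (subst inner_sum_left_Basis) (auto simp: B)
    finally show ?thesis .
  qed
  have meas [measurable]: "g i \<in> borel_measurable borel" for i using borel_measurable_integrable[OF g[of i]] by simp
  have "(LINT x|lborel. (\<Prod>i\<in>UNIV. g i (x $ i))) =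
    (LINT f|(\<Pi>\<^sub>M b\<in>(Basis::(real^'d) set). lborel). (\<Prod>i\<in>UNIV. g i ((\<Sum>b\<in>Basis. f b *\<^sub>R b) $ i)))"
    unfolding lborel_eq[where 'a="real^'d"]
    by (rule integral_distr) measurable
  also have "\<dots> = (LINT f|(\<Pi>\<^sub>M b\<in>(Basis::(real^'d) set). lborel). (\<Prod>b\<in>Basis. h b (f b)))"
    unfolding comp by (simp add: B prod.reindex[OF inj] h)
  also have "\<dots> = (\<Prod>b\<in>Basis. LINT t|lborel. h b t)"
    by (rule product_integral_prod) (auto simp: B h g)
  also have "\<dots> = (\<Prod>i\<in>UNIV. LINT t|lborel. g i t)"
    unfolding B by (subst prod.reindex[OF inj]) (simp add: h o_def)
  finally show ?thesis .
qed

lemma integral_cis_period: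
  "(LINT t|lborel. indicator {0..2*pi} t *\<^sub>R cis (of_int n * t)) = (if n = 0 then of_real (2*pi) else 0)"
proof (cases "n = 0")
  case True
  then show ?thesis by (simp add: scaleR_conv_of_real)
next
  case False
  have "(LINT t|lborel. indicator {0..2*pi} t *\<^sub>R cis (of_int n * t)) =
     cis (of_int n * (2*pi)) / (\<i> * of_int n) - cis (of_int n * 0) / (\<i> * of_int n)"
  proof (rule integral_FTC_Icc)
    show "((\<lambda>t. cis (of_int n * t) / (\<i> * of_int n)) has_vector_derivative cis (of_int n * t)) (at t within {0..2*pi})" for t
    proof -
      have "((\<lambda>z. exp (\<i> * of_int n * z) / (\<i> * of_int n)) has_field_derivative exp (\<i> * of_int n * of_real t)) (at (of_real t))"
        using False by (auto intro!: derivative_eq_intros)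
      from has_vector_derivative_real_field[OF this] show ?thesis
        by (simp add: cis_conv_exp mult_ac)
    qed
  qed (auto intro!: continuous_intros)
  also have "cis (of_int n * (2*pi)) = 1"
    using cis_multiple_2pi[of "of_int n"] by (simp add: mult_ac)
  finally show ?thesis using False by simp
qed

lemma integrable_cis_period: "integrable lborel (\<lambda>t. indicator {0..2*pi} t *\<^sub>R cis (of_int n * t))"
  by (rule borel_integrable_compact) (intro compact_Icc continuous_intros)+

lemma indicator_torus_cell:
  "indicator torus_cell (x::real^'d::finite) = (\<Prod>i\<in>UNIV. indicator {0..2*pi} (x $ i) :: real)"
proof -
  have "x \<in> torus_cell \<longleftrightarrow> (\<forall>i. x $ i \<in> {0..2*pi})"
    by (simp add: torus_cell_def mem_box_cart)
  then show ?thesis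
    by (cases "x \<in> torus_cell") (simp, metis (mono_tags, lifting) UNIV_I finite indicator_simps(2) prod_zero)
qed

lemma integral_character:
  "(LINT x:torus_cell|lborel. cis (freq_dot k x)) = (if k = 0 then of_real ((2*pi)^CARD('d::finite)) else 0)"
  for k :: "int^'d"
proof -
  have "(LINT x:torus_cell|lborel. cis (freq_dot k x)) =
    (LINT x|lborel. (\<Prod>i\<in>UNIV. indicator {0..2*pi} (x$i) *\<^sub>R cis (of_int (k$i) * x$i)))"
    unfolding set_lebesgue_integral_def indicator_torus_cell freq_dot_def
    by (simp add: cis_sum scaleR_conv_of_real prod.distrib)
  also have "\<dots> = (\<Prod>i\<in>UNIV. if k$i = 0 then of_real (2*pi) else 0)"
    by (subst integral_lborel_vec_prod) (simp_all add: integral_cis_period integrable_cis_period)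
  also have "\<dots> = (if k = 0 then of_real ((2*pi)^CARD('d)) else 0)"
  proof (cases "k = 0")
    case False
    then obtain i where "k $ i \<noteq> 0" by (auto simp: vec_eq_iff)
    then show ?thesis using False by (auto simp: prod_zero_iff)
  qed simp
  finally show ?thesis .
qed

lemma freq_dot_simps [simp]:
  "freq_dot 0 x = 0" "freq_dot (- k) x = - freq_dot k x"
  "freq_dot (j + k) x = freq_dot j x + freq_dot k x" "freq_dot (j - k) x = freq_dot j x - freq_dot k x"
  "freq_dot k (x + y) = freq_dot k x + freq_dot k y"
  by (simp_all add: freq_dot_def sum_negf sum.distrib sum_subtractf algebra_simps)

lemma freq_dot_axis [simp]: "freq_dot k (axis i h) = of_int (k $ i) * h"
  by (simp add: freq_dot_def axis_def if_distrib[of "\<lambda>x. _ * x"] cong: if_cong)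

lemma continuous_on_freq_dot [continuous_intros]: "continuous_on S (freq_dot k)"
  unfolding freq_dot_def by (intro continuous_intros)

lemma set_integrable_torus:
  fixes f :: "real^'d::finite \<Rightarrow> 'b::{banach,second_countable_topology}"
  assumes "continuous_on UNIV f"
  shows "set_integrable lborel torus_cell f"
  unfolding torus_cell_def
  by (rule borel_integrable_compact[folded set_integrable_def]) (auto intro: continuous_on_subset[OF assms])

lemma measure_torus_cell: "measure lborel (torus_cell :: (real^'d::finite) set) = (2*pi)^CARD('d)"
  "emeasure lborel (torus_cell :: (real^'d::finite) set) < \<infinity>"
proof -
  have "(0::real^'d) \<bullet> b \<le> (\<chi> i. 2*pi) \<bullet> b" if "b \<in> Basis" for b
    using that by (auto simp: Basis_vec_def inner_axis)
  then show "measure lborel (torus_cell :: (real^'d::finite) set) = (2*pi)^CARD('d)"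
    unfolding torus_cell_def by (subst content_cbox_cart) (auto simp: interval_eq_empty_cart not_less)
  show "emeasure lborel (torus_cell :: (real^'d::finite) set) < \<infinity>"
    unfolding torus_cell_def by (rule emeasure_compact_finite[OF compact_cbox])
qed

lemma fourier_coeff_linear:
  assumes "continuous_on UNIV f" "continuous_on UNIV g"
  shows "fourier_coeff (\<lambda>x. a * f x + b * g x) k = a * fourier_coeff f k + b * fourier_coeff g k"
proof -
  have i: "set_integrable lborel torus_cell (\<lambda>x. of_real (h x) * cis (- freq_dot k x))"
    if "continuous_on UNIV h" for h
    by (intro set_integrable_torus continuous_intros that)
  have "(LINT x:torus_cell|lborel. of_real (a * f x + b * g x) * cis (- freq_dot k x)) =
    (LINT x:torus_cell|lborel. a * (of_real (f x) * cis (- freq_dot k x)) + b * (of_real (g x) * cis (- freq_dot k x)))"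
    by (simp add: algebra_simps)
  also have "\<dots> = a * (LINT x:torus_cell|lborel. of_real (f x) * cis (- freq_dot k x)) +
        b * (LINT x:torus_cell|lborel. of_real (g x) * cis (- freq_dot k x))"
    using i[OF assms(1)] i[OF assms(2)] by (subst set_integral_add) auto
  finally show ?thesis unfolding fourier_coeff_def by (simp add: field_simps)
qed

lemma cmod_fourier_coeff_le:
  fixes f :: "real^'d::finite \<Rightarrow> real"
  assumes "continuous_on UNIV f" "\<And>x. \<bar>f x\<bar> \<le> B"
  shows "cmod (fourier_coeff f k) \<le> B"
proof -
  have i: "set_integrable lborel torus_cell (\<lambda>x. of_real (f x) * cis (- freq_dot k x))"
    by (intro set_integrable_torus continuous_intros assms)
  have "cmod (LINT x:torus_cell|lborel. of_real (f x) * cis (- freq_dot k x)) \<le>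
     (LINT x:torus_cell|lborel. norm (of_real (f x) * cis (- freq_dot k x)))"
    by (rule set_integral_norm_bound[OF i])
  also have "\<dots> \<le> (LINT (x::real^'d):torus_cell|lborel. B)"
    by (rule set_integral_mono)
      (use assms in \<open>auto simp: norm_mult intro!: set_integrable_torus continuous_intros\<close>)
  also have "\<dots> = (2*pi)^CARD('d) * B"
    unfolding set_lebesgue_integral_def
    using measure_torus_cell[where 'd='d] by simp
  finally show ?thesis unfolding fourier_coeff_def
    by (simp add: norm_divide norm_power norm_mult divide_le_eq field_simps)
qed

text \<open>Two added conditionals instead of a case distinction keep the formula true for k = 0,
  where both fire and give the real part of z.\<close>

lemma fourier_coeff_character:
  "fourier_coeff (\<lambda>x. Re (z * cis (freq_dot k x))) j = (if j = k then z / 2 else 0) + (if j = - k then cnj z / 2 else 0)"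
  for k :: "int^'d::finite"
proof -
  have i: "set_integrable lborel torus_cell (\<lambda>x. c * cis (freq_dot l x))" for c and l :: "int^'d"
    by (intro set_integrable_torus continuous_intros)
  have "of_real (Re (z * cis (freq_dot k x))) * cis (- freq_dot j x) =
     z / 2 * cis (freq_dot (k - j) x) + cnj z / 2 * cis (freq_dot (- k - j) x)" for x
  proof -
    have "of_real (Re (z * cis (freq_dot k x))) = (z * cis (freq_dot k x) + cnj z * cis (- freq_dot k x)) / 2"
      by (simp add: complex_eq_iff)
    then show ?thesis
      by (simp add: add_divide_distrib distrib_right cis_mult mult.assoc)
  qed
  then have "(LINT x:torus_cell|lborel. of_real (Re (z * cis (freq_dot k x))) * cis (- freq_dot j x)) =
    z / 2 * (LINT x:torus_cell|lborel. cis (freq_dot (k - j) x)) + cnj z / 2 * (LINT x:torus_cell|lborel. cis (freq_dot (- k - j) x))"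
    by (simp only: set_integral_add(2)[OF i i] set_integral_mult_right)
  moreover have "k - j = 0 \<longleftrightarrow> j = k" "- k - j = 0 \<longleftrightarrow> j = - k" by (auto simp: algebra_simps)
  ultimately show ?thesis
    unfolding fourier_coeff_def integral_character by (simp add: add_divide_distrib)
qed

section \<open>Sobolev weights\<close>

lemma freq_norm_sq_nonneg: "0 \<le> freq_norm_sq k"
  by (simp add: freq_norm_sq_def sum_nonneg)

lemma freq_norm_sq_uminus [simp]: "freq_norm_sq (- k) = freq_norm_sq k"
  by (simp add: freq_norm_sq_def)

lemma freq_norm_sq_add_le: "freq_norm_sq (j + k) \<le> 2 * freq_norm_sq j + 2 * freq_norm_sq k"
  unfolding freq_norm_sq_def sum_distrib_left sum.distrib[symmetric]
proof (rule sum_mono)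
  fix i
  show "(real_of_int ((j + k) $ i))\<^sup>2 \<le> 2 * (real_of_int (j $ i))\<^sup>2 + 2 * (real_of_int (k $ i))\<^sup>2"
    using sum_squares_ge_zero[of "real_of_int (j$i) - real_of_int (k$i)" 0]
    by (simp add: power2_eq_square algebra_simps)
qed

lemma summable_on_int_powr:
  fixes r :: real assumes "r < - 1/2"
  shows "(\<lambda>n::int. (1 + (of_int n)\<^sup>2) powr r) summable_on UNIV"
proof -
  define g :: "int \<Rightarrow> real" where "g n = (1 + (of_int n)\<^sup>2) powr r" for n
  have "summable (\<lambda>n::nat. g (int n))"
  proof (rule summable_comparison_test')
    show "summable (\<lambda>n. of_nat n powr (2 * r) :: real)" using assms by (simp add: summable_real_powr_iff)
    show "norm (g (int n)) \<le> of_nat n powr (2 * r)" if "n \<ge> 1" for n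
    proof -
      have "of_nat n powr (2 * r) = ((real n)\<^sup>2) powr r"
        using that by (simp add: powr_powr[symmetric])
      then show ?thesis using that assms by (auto simp: g_def intro!: powr_mono2')
    qed
  qed
  then have 1: "(\<lambda>n::nat. g (int n)) summable_on UNIV"
    by (subst summable_on_UNIV_nonneg_real_iff) (auto simp: g_def)
  have a: "g summable_on range int"
    using 1 by (subst summable_on_reindex) (auto simp: o_def)
  have "g summable_on range (\<lambda>n. - int n)"
    using 1 by (subst summable_on_reindex) (auto simp: o_def g_def inj_def)
  moreover have "range int \<union> range (\<lambda>n. - int n) = UNIV"
  proof -
    have "x \<in> range int \<union> range (\<lambda>n. - int n)" for x
      by (cases x rule: int_cases2) auto
    then show ?thesis by blast
  qed
  ultimately show ?thesis using summable_on_union[OF a] unfolding g_def by metis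
qed

text \<open>Each factor 1 + k_i^2 is at most 1 + |k|^2, so the weight is dominated by a product of
  one-dimensional weights with exponent - s / d. That exponent is below - 1/2 exactly when s >
  d/2.\<close>

lemma summable_on_freq_norm:
  assumes s: "real s > real CARD('d::finite) / 2"
  shows "(\<lambda>k::int^'d. inverse ((1 + freq_norm_sq k)^s)) summable_on UNIV"
proof -
  define r where "r = - real s / real CARD('d)"
  define g :: "int \<Rightarrow> real" where "g n = (1 + (of_int n)\<^sup>2) powr r" for n
  have r: "r < - 1/2" "r \<le> 0" using s by (auto simp: r_def field_simps)
  have g0: "g n \<ge> 0" for n by (simp add: g_def)
  have gs: "g summable_on UNIV" unfolding g_def by (rule summable_on_int_powr[OF r(1)])
  have le: "inverse ((1 + freq_norm_sq k)^s) \<le> (\<Prod>i\<in>UNIV. g (k $ i))" for k :: "int^'d"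
  proof -
    have "inverse ((1 + freq_norm_sq k)^s) = (1 + freq_norm_sq k) powr (- real s)"
      using freq_norm_sq_nonneg[of k] by (simp add: powr_minus powr_realpow)
    also have "\<dots> = ((1 + freq_norm_sq k) powr r) ^ CARD('d)"
      using freq_norm_sq_nonneg[of k] by (simp add: powr_realpow[symmetric] powr_powr r_def powr_gt_zero)
    also have "\<dots> = (\<Prod>i\<in>(UNIV::'d set). (1 + freq_norm_sq k) powr r)" by simp
    also have "\<dots> \<le> (\<Prod>i\<in>UNIV. g (k $ i))"
    proof (rule prod_mono, safe)
      fix i
      have "(of_int (k $ i))\<^sup>2 \<le> freq_norm_sq k"
        unfolding freq_norm_sq_def by (rule member_le_sum) auto
      then show "(1 + freq_norm_sq k) powr r \<le> g (k $ i)"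
        unfolding g_def using r by (intro powr_mono2') (auto intro: add_pos_nonneg)
    qed simp
    finally show ?thesis .
  qed
  show ?thesis
  proof (rule nonneg_bdd_above_summable_on)
    show "bdd_above (sum (\<lambda>k::int^'d. inverse ((1 + freq_norm_sq k)^s)) ` {F. F \<subseteq> UNIV \<and> finite F})"
    proof (rule bdd_aboveI2)
      fix F :: "(int^'d) set" assume "F \<in> {F. F \<subseteq> UNIV \<and> finite F}"
      then have F: "finite F" by simp
      define A where "A = (\<Union>k\<in>F. range (\<lambda>i. k $ i))"
      have A: "finite A" using F by (auto simp: A_def)
      have inj: "inj_on (\<lambda>k i. k $ i) F" by (auto simp: inj_on_def vec_eq_iff fun_eq_iff)
      have "(\<Sum>k\<in>F. inverse ((1 + freq_norm_sq k)^s)) \<le> (\<Sum>k\<in>F. \<Prod>i\<in>UNIV. g (k $ i))"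
        by (intro sum_mono le)
      also have "\<dots> = (\<Sum>h\<in>(\<lambda>k i. k $ i) ` F. \<Prod>i\<in>UNIV. g (h i))"
        by (subst sum.reindex[OF inj]) simp
      also have "\<dots> \<le> (\<Sum>h\<in>PiE (UNIV::'d set) (\<lambda>_. A). \<Prod>i\<in>UNIV. g (h i))"
      proof (rule sum_mono2)
        show "finite (PiE (UNIV::'d set) (\<lambda>_. A))" by (rule finite_PiE) (use A in auto)
        show "(\<lambda>k i. k $ i) ` F \<subseteq> PiE UNIV (\<lambda>_. A)" by (auto simp: A_def)
      qed (auto intro!: prod_nonneg g0)
      also have "\<dots> = (\<Prod>i\<in>(UNIV::'d set). \<Sum>n\<in>A. g n)"
        by (rule prod_sum_PiE[symmetric]) (use A in auto)
      also have "\<dots> \<le> (\<Prod>i\<in>(UNIV::'d set). \<Sum>\<^sub>\<infinity>n. g n)"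
        by (rule prod_mono) (use A g0 finite_sum_le_infsum[OF gs A] in \<open>auto intro: sum_nonneg\<close>)
      finally show "(\<Sum>k\<in>F. inverse ((1 + freq_norm_sq k)^s)) \<le> (\<Prod>i\<in>(UNIV::'d set). \<Sum>\<^sub>\<infinity>n. g n)" .
    qed
  qed (use freq_norm_sq_nonneg in \<open>auto intro!: add_nonneg_nonneg zero_le_power\<close>)
qed

section \<open>The Sobolev space as a sequence space\<close>

locale sobolev =
  fixes s :: nat and W :: "int^'d::finite \<Rightarrow> real"
  assumes s: "real s > real CARD('d) / 2"
    and W_def: "W = (\<lambda>k. sqrt ((1 + freq_norm_sq k) ^ s))"
begin

lemma W_ge_1: "1 \<le> W k"
  using freq_norm_sq_nonneg[of k] by (simp add: W_def one_le_power)

lemma W_pos: "0 < W k" and W_nz: "W k \<noteq> 0"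
  using W_ge_1[of k] by auto

lemma W_uminus [simp]: "W (- k) = W k"
  by (simp add: W_def)

lemma W_sq: "(W k)\<^sup>2 = (1 + freq_norm_sq k) ^ s"
  using freq_norm_sq_nonneg[of k] by (simp add: W_def)

text \<open>This quasi-subadditivity is what makes the Sobolev space an algebra. The factor comes
  from 1 + |j + k|^2 \<le> 4 (1 + max), whose s-th power has the root 2 ^ s times the root of the
  larger weight.\<close>

lemma W_add_le: "W (j + k) \<le> 2 ^ s * (W j + W k)"
proof -
  define m where "m = max (freq_norm_sq j) (freq_norm_sq k)"
  have m: "m \<ge> 0" using freq_norm_sq_nonneg[of j] by (simp add: m_def)
  have "1 + freq_norm_sq (j + k) \<le> 4 * (1 + m)"
    using freq_norm_sq_add_le[of j k] m unfolding m_def by auto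
  then have "W (j + k) \<le> sqrt ((4 * (1 + m)) ^ s)"
    unfolding W_def using freq_norm_sq_nonneg[of "j+k"] by (auto intro!: power_mono)
  also have "\<dots> = 2 ^ s * sqrt ((1 + m) ^ s)"
    unfolding real_sqrt_power real_sqrt_mult power_mult_distrib real_sqrt_four ..
  also have "sqrt ((1 + m) ^ s) \<le> W j + W k"
    unfolding m_def max_def using W_pos[of j] W_pos[of k] by (auto simp: W_def)
  finally show ?thesis by simp
qed

text \<open>The constant of the Sobolev embedding into bounded functions: by Cauchy-Schwarz, it
  bounds the absolute sum of the Fourier coefficients by the Sobolev norm.\<close>

definition Z :: real where "Z = sqrt (\<Sum>\<^sub>\<infinity>k. inverse ((W k)\<^sup>2))"

lemma summable_inverse_W: "(\<lambda>k. inverse ((W k)\<^sup>2)) summable_on UNIV"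
  unfolding W_sq by (rule summable_on_freq_norm[OF s])

lemma L2_set_inverse_W: "finite F \<Longrightarrow> L2_set (\<lambda>k. inverse (W k)) F \<le> Z"
  unfolding L2_set_def Z_def using finite_sum_le_infsum[OF summable_inverse_W]
  by (simp add: power_inverse)

lemma Z_nonneg: "0 \<le> Z"
  using L2_set_inverse_W[of "{}"] by simp

text \<open>An element \<open>a\<close> of the sequence space stands for the function \<open>ev a\<close> in \<open>H\<^sup>s\<close> whose Fourier coefficients
  are \<open>fc a\<close>; the weight makes \<open>ev\<close> an isometry.\<close>

definition fc :: "(int^'d) hl2 \<Rightarrow> int^'d \<Rightarrow> complex" where "fc a k = coef a k / of_real (W k)"

lemma fc_simps [simp]: "fc 0 k = 0" "fc (a + b) k = fc a k + fc b k" "fc (a - b) k = fc a k - fc b k"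
  "fc (- a) k = - fc a k" "fc (r *\<^sub>R a) k = of_real r * fc a k" "fc a (- k) = cnj (fc a k)"
  by (simp_all add: fc_def add_divide_distrib diff_divide_distrib coef_uminus)

lemma coef_fc: "coef a k = of_real (W k) * fc a k"
  using W_nz by (simp add: fc_def)

lemma fc_eqI: "(\<And>k. fc a k = fc b k) \<Longrightarrow> a = b"
  by (rule hl2_eqI) (simp add: coef_fc)

lemma sum_fc_le: "finite F \<Longrightarrow> (\<Sum>k\<in>F. cmod (fc a k)) \<le> Z * norm a"
proof -
  assume F: "finite F"
  have "(\<Sum>k\<in>F. cmod (fc a k)) = (\<Sum>k\<in>F. \<bar>cmod (coef a k)\<bar> * \<bar>inverse (W k)\<bar>)"
    using W_pos by (intro sum.cong) (auto simp: fc_def norm_mult norm_inverse divide_inverse abs_of_pos)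
  also have "\<dots> \<le> L2_set (\<lambda>k. cmod (coef a k)) F * L2_set (\<lambda>k. inverse (W k)) F"
    by (rule L2_set_mult_ineq)
  also have "\<dots> \<le> norm a * Z"
    by (intro mult_mono L2_set_coef_le_norm L2_set_inverse_W F) auto
  finally show ?thesis by (simp add: mult.commute)
qed

lemma abs_summable_fc: "(\<lambda>k. norm (fc a k)) summable_on UNIV"
  by (rule nonneg_bdd_above_summable_on) (auto intro!: bdd_aboveI2 sum_fc_le)

lemma infsum_fc_le: "(\<Sum>\<^sub>\<infinity>k. cmod (fc a k)) \<le> Z * norm a"
  by (rule infsum_le_finite_sums[OF abs_summable_fc]) (auto intro: sum_fc_le)

lemma summable_fc_cis: "(\<lambda>k. norm (fc a k * cis (freq_dot k x))) summable_on UNIV"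
  using abs_summable_fc[of a] by (simp add: norm_mult)

definition evc :: "(int^'d) hl2 \<Rightarrow> real^'d \<Rightarrow> complex" where
  "evc a x = (\<Sum>\<^sub>\<infinity>k. fc a k * cis (freq_dot k x))"

definition ev :: "(int^'d) hl2 \<Rightarrow> real^'d \<Rightarrow> real" where
  "ev a x = Re (evc a x)"

lemma cnj_evc: "cnj (evc a x) = evc a x"
proof -
  have "cnj (evc a x) = (\<Sum>\<^sub>\<infinity>k. cnj (fc a k * cis (freq_dot k x)))" unfolding evc_def by (rule infsum_cnj[symmetric])
  also have "\<dots> = (\<Sum>\<^sub>\<infinity>k. fc a (- k) * cis (freq_dot (- k) x))" by (simp add: cis_cnj)
  also have "\<dots> = evc a x"
    unfolding evc_def by (rule infsum_reindex_bij_witness[of _ uminus uminus]) auto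
  finally show ?thesis .
qed

lemma evc_eq: "evc a x = of_real (ev a x)"
  using cnj_evc[of a x] by (simp add: ev_def complex_eq_iff)

lemma evc_summable: "(\<lambda>k. fc a k * cis (freq_dot k x)) summable_on UNIV"
  using abs_summable_summable[OF summable_fc_cis[of a x]] .

lemma cmod_evc_le: "cmod (evc a x) \<le> Z * norm a"
proof -
  have "cmod (evc a x) \<le> (\<Sum>\<^sub>\<infinity>k. cmod (fc a k * cis (freq_dot k x)))"
    unfolding evc_def by (rule norm_infsum_bound[OF summable_fc_cis])
  also have "\<dots> \<le> Z * norm a" using infsum_fc_le by (simp add: norm_mult)
  finally show ?thesis .
qed

lemma abs_ev_le: "\<bar>ev a x\<bar> \<le> Z * norm a"
  using cmod_evc_le[of a x] by (simp add: evc_eq)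

lemma ev_add [simp]: "ev (a + b) x = ev a x + ev b x"
  unfolding ev_def evc_def using infsum_add[OF evc_summable[of a x] evc_summable[of b x]]
  by (simp add: algebra_simps)

lemma ev_scaleR [simp]: "ev (r *\<^sub>R a) x = r * ev a x"
  unfolding ev_def evc_def by (simp add: mult.assoc infsum_cmult_right')

lemma ev_add_fun: "ev (a + b) = (\<lambda>x. ev a x + ev b x)"
  and ev_scaleR_fun: "ev (r *\<^sub>R a) = (\<lambda>x. r * ev a x)"
  by (auto simp: fun_eq_iff)

lemma bounded_linear_ev: "bounded_linear (\<lambda>a. ev a x)"
  by (rule bounded_linear_intro[of _ Z]) (use abs_ev_le in \<open>auto simp: mult.commute\<close>)

lemma ev_simps [simp]: "ev 0 x = 0" "ev (a - b) x = ev a x - ev b x" "ev (- a) x = - ev a x"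
  "ev (sum f A) x = (\<Sum>i\<in>A. ev (f i) x)"
proof -
  note l = bounded_linear.linear[OF bounded_linear_ev[of x]]
  show "ev 0 x = 0" "ev (a - b) x = ev a x - ev b x" "ev (- a) x = - ev a x"
    "ev (sum f A) x = (\<Sum>i\<in>A. ev (f i) x)"
    using linear_0[OF l] linear_diff[OF l] linear_neg[OF l] linear_sum[OF l] by auto
qed

lemma ev_zero_fun: "ev 0 = (\<lambda>x. 0)"
  by (simp add: fun_eq_iff)

text \<open>The real trigonometric monomial Re (z exp (i k.x)). A complex z covers cosine and sine
  at once, so that all arguments by density need only one kind of generator.\<close>

definition blk :: "complex \<Rightarrow> int^'d \<Rightarrow> (int^'d) hl2" where
  "blk z k = (SOME a. \<forall>j. fc a j = (if j = k then z / 2 else 0) + (if j = - k then cnj z / 2 else 0))"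

lemma fc_blk: "fc (blk z k) j = (if j = k then z / 2 else 0) + (if j = - k then cnj z / 2 else 0)"
proof -
  define c where "c j = of_real (W j) * ((if j = k then z / 2 else 0) + (if j = - k then cnj z / 2 else 0))" for j
  have c0: "c j = 0" if "j \<notin> {k, - k}" for j using that by (auto simp: c_def)
  have "L2_set (\<lambda>k. cmod (c k)) F \<le> (\<Sum>j\<in>{k, -k}. cmod (c j))" if F: "finite F" for F
  proof -
    have "L2_set (\<lambda>k. cmod (c k)) F \<le> (\<Sum>j\<in>F. cmod (c j))"
      by (rule L2_set_le_sum) auto
    also have "\<dots> = (\<Sum>j\<in>F \<inter> {k, -k}. cmod (c j))"
      by (rule sum.mono_neutral_right) (use F c0 in auto)
    also have "\<dots> \<le> (\<Sum>j\<in>{k, -k}. cmod (c j))"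
      by (rule sum_mono2) auto
    finally show ?thesis .
  qed
  moreover have "c (- j) = cnj (c j)" for j by (auto simp: c_def)
  ultimately obtain a where "\<And>j. coef a j = c j" using ex_hl2[of c] by metis
  then have "\<exists>a. \<forall>j. fc a j = (if j = k then z / 2 else 0) + (if j = - k then cnj z / 2 else 0)"
    using W_nz by (intro exI[of _ a]) (simp add: fc_def c_def)
  then show ?thesis unfolding blk_def by (rule someI2_ex) simp
qed

lemma ev_blk: "ev (blk z k) x = Re (z * cis (freq_dot k x))"
proof -
  have "evc (blk z k) x = (\<Sum>\<^sub>\<infinity>j\<in>{k, -k}. fc (blk z k) j * cis (freq_dot j x))"
    unfolding evc_def by (rule infsum_cong_neutral) (auto simp: fc_blk)
  also have "\<dots> = (\<Sum>j\<in>{k, -k}. fc (blk z k) j * cis (freq_dot j x))" by simp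
  finally have "ev (blk z k) x = Re (\<Sum>j\<in>{k, -k}. fc (blk z k) j * cis (freq_dot j x))"
    by (simp add: ev_def)
  also have "\<dots> = Re (z * cis (freq_dot k x))"
  proof (cases "k = 0")
    case False
    then obtain i where "k $ i \<noteq> 0" by (auto simp: vec_eq_iff)
    then have "(- k) $ i \<noteq> k $ i" by simp
    then have "- k \<noteq> k" "k \<noteq> - k" by metis+
    then show ?thesis by (simp add: fc_blk field_simps)
  qed (simp add: fc_blk)
  finally show ?thesis .
qed

lemma blk_dense: "closure (span (range (\<lambda>(z, k). blk z k))) = UNIV"
proof -
  have "a \<in> closure (span (range (\<lambda>(z, k). blk z k)))" for a
  proof (subst closure_approachable, intro allI impI)
    fix e :: real assume e: "e > 0"
    define q where "q k = (cmod (coef a k))\<^sup>2" for k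
    have q: "q summable_on UNIV" unfolding q_def by (rule coef_summable)
    obtain F0 where F0: "finite F0" "norm (sum q F0 - infsum q UNIV) \<le> e\<^sup>2/4"
      using infsum_finite_approximation[OF q, of "e\<^sup>2/4"] e by (auto simp: dist_norm)
    \<comment> \<open>Symmetrised, because a truncation to \<open>F\<close> must stay
      Hermitian.\<close>
    define F where "F = F0 \<union> uminus ` F0"
    have F: "finite F" "- k \<in> F \<longleftrightarrow> k \<in> F" for k using F0 by (force simp: F_def)+
    have tail: "sum q G \<le> e\<^sup>2/4" if "finite G" "G \<inter> F = {}" for G
    proof -
      have "sum q F0 + sum q G = sum q (F0 \<union> G)"
        using that F0 by (subst sum.union_disjoint) (auto simp: F_def)
      also have "\<dots> \<le> infsum q UNIV" by (rule finite_sum_le_infsum[OF q]) (use that F0 in \<open>auto simp: q_def\<close>)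
      finally show ?thesis using F0(2) unfolding real_norm_def by linarith
    qed
    \<comment> \<open>Each frequency j receives one half of its coefficient from k = j and the other
      half from k = - j.\<close>
    define b where "b = (\<Sum>k\<in>F. blk (fc a k) k)"
    have fcb: "fc b j = (if j \<in> F then fc a j else 0)" for j
    proof -
      have "fc b j = (\<Sum>k\<in>F. fc (blk (fc a k) k) j)"
        unfolding b_def fc_def by (simp add: sum_divide_distrib)
      also have "\<dots> = (\<Sum>k\<in>F. (if k = j then fc a k / 2 else 0)) + (\<Sum>k\<in>F. (if k = - j then cnj (fc a k) / 2 else 0))"
        unfolding fc_blk sum.distrib by (intro arg_cong2[where f="(+)"] sum.cong) auto
      also have "\<dots> = (if j \<in> F then fc a j else 0)"
        using F by (simp add: field_simps)
      finally show ?thesis .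
    qed
    have "norm (b - a) \<le> e/2"
    proof (rule norm_hl2_le)
      fix G :: "(int^'d) set" assume G: "finite G"
      have "(\<Sum>k\<in>G. (cmod (coef (b - a) k))\<^sup>2) = (\<Sum>k\<in>G - F. q k)"
        by (rule sum.mono_neutral_cong_right) (use G in \<open>auto simp: coef_fc fcb q_def norm_mult norm_minus_commute\<close>)
      also have "\<dots> \<le> e\<^sup>2/4" using tail[of "G - F"] G by auto
      finally have "L2_set (\<lambda>k. cmod (coef (b - a) k)) G \<le> sqrt (e\<^sup>2/4)"
        unfolding L2_set_def by simp
      then show "L2_set (\<lambda>k. cmod (coef (b - a) k)) G \<le> e/2"
        using e by (simp add: real_sqrt_divide)
    qed
    moreover have "b \<in> span (range (\<lambda>(z, k). blk z k))"
      unfolding b_def by (intro span_sum span_base) auto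
    ultimately show "\<exists>y\<in>span (range (\<lambda>(z, k). blk z k)). dist y a < e"
      using e by (intro bexI[of _ b]) (auto simp: dist_norm)
  qed
  then show ?thesis by blast
qed

text \<open>Identities and estimates that are linear and continuous in an element only have to be
  checked on the blocks.\<close>

lemma blk_induct [consumes 0, case_names blk zero add scaleR closed]:
  assumes blk: "\<And>z k. P (blk z k)" and zero: "P 0" and add: "\<And>a b. P a \<Longrightarrow> P b \<Longrightarrow> P (a + b)"
    and scaleR: "\<And>r a. P a \<Longrightarrow> P (r *\<^sub>R a)" and closed: "closed {a. P a}"
  shows "P a"
proof -
  have "subspace {a. P a}" by (rule subspaceI) (use zero add scaleR in auto)
  then have "span (range (\<lambda>(z, k). blk z k)) \<subseteq> {a. P a}"
    by (intro span_minimal) (use blk in auto)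
  then have "closure (span (range (\<lambda>(z, k). blk z k))) \<subseteq> {a. P a}"
    by (rule closure_minimal[OF _ closed])
  then show ?thesis unfolding blk_dense by blast
qed

lemma uniform_limit_ev:
  assumes "X \<longlonglongrightarrow> l"
  shows "uniform_limit S (\<lambda>n. ev (X n)) (ev l) sequentially"
proof (rule uniform_limitI)
  fix e :: real assume "e > 0"
  have "(\<lambda>n. Z * norm (X n - l)) \<longlonglongrightarrow> Z * norm (l - l)"
    by (intro tendsto_intros assms)
  then have "\<forall>\<^sub>F n in sequentially. Z * norm (X n - l) < e"
    using \<open>e > 0\<close> by (intro order_tendstoD) auto
  then show "\<forall>\<^sub>F n in sequentially. \<forall>x\<in>S. dist (ev (X n) x) (ev l x) < e"
  proof eventually_elim
    case (elim n)
    then show ?case using abs_ev_le[of "X n - l"] by (force simp: dist_real_def intro: le_less_trans)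
  qed
qed

lemma continuous_ev: "continuous_on S (ev a)"
proof (induction a rule: blk_induct)
  case (blk z k)
  show ?case unfolding ev_blk[abs_def] by (intro continuous_intros)
next
  case closed
  have "continuous_on S (ev l)" if X: "\<And>n. continuous_on S (ev (X n))" "X \<longlonglongrightarrow> l" for X l
    by (rule uniform_limit_theorem[OF _ uniform_limit_ev[OF X(2)]]) (use X in auto)
  then show ?case unfolding closed_sequential_limits by auto
next
  case zero
  show ?case unfolding ev_zero_fun by (rule continuous_on_const)
next
  case (add a b)
  then show ?case unfolding ev_add_fun by (intro continuous_intros)
next
  case (scaleR r a)
  then show ?case unfolding ev_scaleR_fun by (intro continuous_intros)
qed

lemma bounded_linear_fourier_ev: "bounded_linear (\<lambda>a. fourier_coeff (ev a) k)"
proof (rule bounded_linear_intro[of _ Z])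
  fix a b r
  show "fourier_coeff (ev (a + b)) k = fourier_coeff (ev a) k + fourier_coeff (ev b) k"
    using fourier_coeff_linear[of "ev a" "ev b" 1 1] continuous_ev by (simp add: ev_add_fun)
  show "fourier_coeff (ev (r *\<^sub>R a)) k = r *\<^sub>R fourier_coeff (ev a) k"
    using fourier_coeff_linear[of "ev a" "ev a" r 0] continuous_ev by (simp add: ev_scaleR_fun scaleR_conv_of_real)
  show "norm (fourier_coeff (ev a) k) \<le> norm a * Z"
    using cmod_fourier_coeff_le[OF continuous_ev, of a] abs_ev_le by (simp add: mult.commute)
qed

lemma bounded_linear_fc: "bounded_linear (\<lambda>a. fc a k)"
  unfolding fc_def divide_inverse
  by (rule bounded_linear_compose[OF bounded_linear_mult_left bounded_linear_coef])

lemma fourier_coeff_ev: "fourier_coeff (ev a) k = fc a k"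
proof (induction a rule: blk_induct)
  case (blk z j)
  show ?case using fourier_coeff_character[of z j k] by (simp add: fc_blk ev_blk[abs_def])
next
  case closed
  show ?case
    by (intro closed_Collect_eq continuous_intros linear_continuous_on bounded_linear_fc bounded_linear_fourier_ev)
next
  case zero
  show ?case using linear_0[OF bounded_linear.linear[OF bounded_linear_fourier_ev]] by (simp only: fc_simps)
next
  case (add a b)
  then show ?case using linear_add[OF bounded_linear.linear[OF bounded_linear_fourier_ev]] by (simp only: fc_simps)
next
  case (scaleR r a)
  then show ?case using linear_scale[OF bounded_linear.linear[OF bounded_linear_fourier_ev]]
    by (simp only: fc_simps scaleR_conv_of_real)
qed

lemma ev_inj: "(\<And>x. ev a x = ev b x) \<Longrightarrow> a = b"
  by (rule fc_eqI) (metis fourier_coeff_ev ext)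

lemma torus_periodic_ev: "torus_periodic (ev a)"
  unfolding torus_periodic_def
proof (intro allI)
  fix x :: "real^'d" and i
  have "cis (freq_dot k (x + axis i (2*pi))) = cis (freq_dot k x)" for k :: "int^'d"
    using cis_multiple_2pi[of "of_int (k$i)"] by (simp add: cis_mult[symmetric] mult_ac)
  then show "ev a (x + axis i (2*pi)) = ev a x" by (simp add: ev_def evc_def)
qed

lemma norm_sq_fc: "(cmod (coef a k))\<^sup>2 = (1 + freq_norm_sq k)^s * (cmod (fc a k))\<^sup>2"
  by (simp add: coef_fc norm_mult power_mult_distrib W_sq)

lemma ev_in_Hs: "ev a \<in> Hs s"
  unfolding Hs_def using coef_summable[of a]
  by (simp add: torus_periodic_ev continuous_ev fourier_coeff_ev norm_sq_fc)

lemma Hs_norm_ev: "Hs_norm s (ev a) = norm a"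
  by (simp add: Hs_norm_def norm_hl2_def fourier_coeff_ev norm_sq_fc)

end

section \<open>Multiplication\<close>

text \<open>Young's inequality for an absolutely summable and a square-summable sequence: the
  convolution is a superposition of translates of \<open>f\<close> with weights \<open>g\<close>,
  and translates have equal norm. It is proved for finite superpositions and passed to the
  limit.\<close>

lemma Young_L2_set:
  fixes f g :: "'k::ab_group_add \<Rightarrow> real"
  assumes f: "\<And>F. finite F \<Longrightarrow> L2_set f F \<le> A" "\<And>k. 0 \<le> f k"
    and g: "\<And>G. finite G \<Longrightarrow> sum g G \<le> B" "\<And>k. 0 \<le> g k"
  shows "(\<lambda>l. g l * f (k - l)) summable_on UNIV"
    and "finite F \<Longrightarrow> L2_set (\<lambda>k. \<Sum>\<^sub>\<infinity>l. g l * f (k - l)) F \<le> A * B"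
proof -
  have A: "A \<ge> 0" using f(1)[of "{}"] by simp
  have fA: "f k \<le> A" for k using f(1)[of "{k}"] f(2)[of k] by simp
  have gs: "g summable_on UNIV"
    by (rule nonneg_bdd_above_summable_on) (auto intro!: bdd_aboveI2 g)
  show s: "(\<lambda>l. g l * f (k - l)) summable_on UNIV" for k
    by (rule summable_on_comparison_test[OF summable_on_cmult_left[OF gs, of A]])
      (auto intro!: mult_left_mono fA mult_nonneg_nonneg g f)
  assume F: "finite F"
  have shift: "L2_set (\<lambda>k. f (k - l)) F \<le> A" for l
  proof -
    have "L2_set (\<lambda>k. f (k - l)) F = L2_set f ((\<lambda>k. k - l) ` F)"
      unfolding L2_set_def by (subst sum.reindex) (auto simp: inj_on_def)
    then show ?thesis using f(1)[of "(\<lambda>k. k - l) ` F"] F by simp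
  qed
  have le: "L2_set (\<lambda>k. \<Sum>l\<in>G. g l * f (k - l)) F \<le> A * B" if G: "finite G" for G
  proof -
    have "L2_set (\<lambda>k. \<Sum>l\<in>G. g l * f (k - l)) F \<le> (\<Sum>l\<in>G. L2_set (\<lambda>k. g l * f (k - l)) F)"
      by (rule L2_set_sum_le[OF G])
    also have "\<dots> = (\<Sum>l\<in>G. g l * L2_set (\<lambda>k. f (k - l)) F)"
      by (simp add: L2_set_right_distrib g)
    also have "\<dots> \<le> (\<Sum>l\<in>G. g l * A)"
      by (intro sum_mono mult_left_mono shift g)
    also have "\<dots> \<le> B * A" unfolding sum_distrib_right[symmetric] using g(1)[OF G] A by (rule mult_right_mono)
    finally show ?thesis by (simp add: mult.commute)
  qed
  have "((\<lambda>G. L2_set (\<lambda>k. \<Sum>l\<in>G. g l * f (k - l)) F) \<longlongrightarrow> L2_set (\<lambda>k. \<Sum>\<^sub>\<infinity>l. g l * f (k - l)) F)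
      (finite_subsets_at_top UNIV)"
    unfolding L2_set_def by (intro tendsto_intros infsum_tendsto s)
  then show "L2_set (\<lambda>k. \<Sum>\<^sub>\<infinity>l. g l * f (k - l)) F \<le> A * B"
    by (rule tendsto_upperbound) (auto intro!: le eventually_finite_subsets_at_top_weakI)
qed

text \<open>Fubini after the change of variables (k, j) to (j, k - j).\<close>

lemma infsum_convolution:
  fixes f g :: "'k::ab_group_add \<Rightarrow> complex"
  assumes f: "(\<lambda>k. norm (f k)) summable_on UNIV" and g: "(\<lambda>k. norm (g k)) summable_on UNIV"
  shows "(\<Sum>\<^sub>\<infinity>k. \<Sum>\<^sub>\<infinity>j. f j * g (k - j)) = infsum f UNIV * infsum g UNIV"
proof -
  have "(\<lambda>x. norm ((\<lambda>(j, l). f j * g l) x)) summable_on (UNIV \<times> UNIV)"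
    by (rule iffD2[OF Infinite_Sum.abs_summable_on_Sigma_iff])
      (use f g in \<open>simp add: norm_mult infsum_cmult_right' infsum_nonneg summable_on_cmult_left summable_on_cmult_right\<close>)
  then have s: "(\<lambda>(j, l). f j * g l) summable_on (UNIV \<times> UNIV)" by (rule abs_summable_summable)
  have bij: "bij_betw (\<lambda>(k, j). (j, k - j)) (UNIV \<times> UNIV) (UNIV \<times> (UNIV::'k set))"
    by (rule bij_betw_byWitness[where f'="\<lambda>(j, l). (j + l, j)"]) auto
  have s2: "(\<lambda>(k, j). f j * g (k - j)) summable_on (UNIV \<times> UNIV)"
    using s summable_on_reindex_bij_betw[OF bij, of "\<lambda>(j, l). f j * g l"] by (simp add: case_prod_beta')
  have "(\<Sum>\<^sub>\<infinity>k. \<Sum>\<^sub>\<infinity>j. f j * g (k - j)) = infsum (\<lambda>(k, j). f j * g (k - j)) (UNIV \<times> UNIV)"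
    by (rule infsum_Sigma'_banach[OF s2])
  also have "\<dots> = infsum (\<lambda>(j, l). f j * g l) (UNIV \<times> UNIV)"
    using infsum_reindex_bij_betw[OF bij, of "\<lambda>(j, l). f j * g l"] by (simp add: case_prod_beta')
  also have "\<dots> = (\<Sum>\<^sub>\<infinity>j. \<Sum>\<^sub>\<infinity>l. f j * g l)"
    by (rule infsum_Sigma'_banach[OF s, symmetric])
  also have "\<dots> = infsum f UNIV * infsum g UNIV"
    by (simp add: infsum_cmult_right' infsum_cmult_left')
  finally show ?thesis .
qed

context sobolev begin

text \<open>The constant of the algebra property. The summand 1 makes it at least 1, which
  simplifies later monotonicity arguments.\<close>

definition Cm :: real where "Cm = 1 + 2 * 2 ^ s * Z"

lemma Cm_ge_1: "1 \<le> Cm"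
  using Z_nonneg by (simp add: Cm_def)

text \<open>The weight at k is split by \<open>W_add_le\<close> between the two factors of each term
  of the convolution. Either half convolves a weighted, square-summable sequence with an unweighted,
  absolutely summable one, so Young's inequality applies to it.\<close>

lemma ex_mul:
  "\<exists>c. (\<forall>k. fc c k = (\<Sum>\<^sub>\<infinity>j. fc a j * fc b (k - j))) \<and> norm c \<le> Cm * norm a * norm b"
proof -
  define cv where "cv k = (\<Sum>\<^sub>\<infinity>j. fc a j * fc b (k - j))" for k
  define F1 where "F1 k = (\<Sum>\<^sub>\<infinity>l. cmod (fc a l) * cmod (coef b (k - l)))" for k
  define F2 where "F2 k = (\<Sum>\<^sub>\<infinity>l. cmod (fc b l) * cmod (coef a (k - l)))" for k
  have s1: "(\<lambda>l. cmod (fc a l) * cmod (coef b (k - l))) summable_on UNIV" for k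
    by (rule Young_L2_set(1)[of "\<lambda>k. cmod (coef b k)" "norm b" "\<lambda>k. cmod (fc a k)" "Z * norm a"])
      (simp_all add: L2_set_coef_le_norm sum_fc_le)
  have l1: "L2_set F1 F \<le> norm b * (Z * norm a)" if "finite F" for F
    unfolding F1_def
    by (rule Young_L2_set(2)[of "\<lambda>k. cmod (coef b k)" "norm b" "\<lambda>k. cmod (fc a k)" "Z * norm a"])
      (simp_all add: L2_set_coef_le_norm sum_fc_le that)
  have s2: "(\<lambda>l. cmod (fc b l) * cmod (coef a (k - l))) summable_on UNIV" for k
    by (rule Young_L2_set(1)[of "\<lambda>k. cmod (coef a k)" "norm a" "\<lambda>k. cmod (fc b k)" "Z * norm b"])
      (simp_all add: L2_set_coef_le_norm sum_fc_le)
  have l2: "L2_set F2 F \<le> norm a * (Z * norm b)" if "finite F" for F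
    unfolding F2_def
    by (rule Young_L2_set(2)[of "\<lambda>k. cmod (coef a k)" "norm a" "\<lambda>k. cmod (fc b k)" "Z * norm b"])
      (simp_all add: L2_set_coef_le_norm sum_fc_le that)
  \<comment> \<open>The reflection of l into k - l brings the half in which \<open>a\<close> carries
    the weight into the form of Young's inequality.\<close>
  have rev: "(\<lambda>l. cmod (coef a l) * cmod (fc b (k - l))) summable_on UNIV"
    "(\<Sum>\<^sub>\<infinity>l. cmod (coef a l) * cmod (fc b (k - l))) = F2 k" for k
  proof -
    have bij: "bij_betw (\<lambda>l. k - l) UNIV (UNIV::(int^'d) set)"
      by (rule bij_betw_byWitness[where f'="\<lambda>l. k - l"]) auto
    show "(\<lambda>l. cmod (coef a l) * cmod (fc b (k - l))) summable_on UNIV"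
      using summable_on_reindex_bij_betw[OF bij, of "\<lambda>l. cmod (fc b l) * cmod (coef a (k - l))"] s2[of k]
      by (simp add: mult.commute)
    show "(\<Sum>\<^sub>\<infinity>l. cmod (coef a l) * cmod (fc b (k - l))) = F2 k"
      using infsum_reindex_bij_betw[OF bij, of "\<lambda>l. cmod (fc b l) * cmod (coef a (k - l))"]
      by (simp add: mult.commute F2_def)
  qed
  have le: "W k * cmod (cv k) \<le> 2^s * (F1 k + F2 k)" for k
  proof -
    have pt: "W k * cmod (fc a l * fc b (k - l)) \<le>
       2^s * (cmod (fc a l) * cmod (coef b (k - l)) + cmod (coef a l) * cmod (fc b (k - l)))" for l
    proof -
      have "W k * cmod (fc a l * fc b (k - l)) \<le> 2^s * (W l + W (k - l)) * cmod (fc a l * fc b (k - l))"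
        using W_add_le[of l "k - l"] by (intro mult_right_mono) auto
      also have "\<dots> = 2^s * (cmod (fc a l) * cmod (coef b (k - l)) + cmod (coef a l) * cmod (fc b (k - l)))"
        using W_pos by (simp add: coef_fc norm_mult algebra_simps abs_of_pos)
      finally show ?thesis .
    qed
    have sm: "(\<lambda>l. 2^s * (cmod (fc a l) * cmod (coef b (k - l)) + cmod (coef a l) * cmod (fc b (k - l)))) summable_on UNIV"
      by (intro summable_on_cmult_right summable_on_add s1 rev)
    have sW: "(\<lambda>l. W k * cmod (fc a l * fc b (k - l))) summable_on UNIV"
      by (rule summable_on_comparison_test[OF sm]) (use pt W_pos[of k] in auto)
    have sn: "(\<lambda>l. cmod (fc a l * fc b (k - l))) summable_on UNIV"
      using summable_on_cmult_right[OF sW, of "inverse (W k)"] W_nz[of k] by (simp add: mult.assoc[symmetric])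
    have "W k * cmod (cv k) \<le> W k * (\<Sum>\<^sub>\<infinity>l. cmod (fc a l * fc b (k - l)))"
      unfolding cv_def using W_pos[of k] by (intro mult_left_mono norm_infsum_bound sn) auto
    also have "\<dots> = (\<Sum>\<^sub>\<infinity>l. W k * cmod (fc a l * fc b (k - l)))"
      by (simp add: infsum_cmult_right')
    also have "\<dots> \<le> (\<Sum>\<^sub>\<infinity>l. 2^s * (cmod (fc a l) * cmod (coef b (k - l)) + cmod (coef a l) * cmod (fc b (k - l))))"
      by (rule infsum_mono[OF sW sm]) (use pt in auto)
    also have "\<dots> = 2^s * (F1 k + F2 k)"
      using infsum_add[OF s1 rev(1)] rev(2) by (simp add: infsum_cmult_right' F1_def)
    finally show ?thesis .
  qed
  have bnd: "L2_set (\<lambda>k. cmod (of_real (W k) * cv k)) F \<le> Cm * norm a * norm b" if F: "finite F" for F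
  proof -
    have "L2_set (\<lambda>k. cmod (of_real (W k) * cv k)) F \<le> L2_set (\<lambda>k. 2^s * (F1 k + F2 k)) F"
      by (rule L2_set_mono) (use le W_pos in \<open>simp_all add: norm_mult abs_of_pos less_imp_le\<close>)
    also have "\<dots> \<le> 2^s * (L2_set F1 F + L2_set F2 F)"
      by (subst L2_set_right_distrib[symmetric]) (auto intro!: L2_set_triangle_ineq)
    also have "\<dots> \<le> 2^s * (norm b * (Z * norm a) + norm a * (Z * norm b))"
      by (intro mult_left_mono add_mono l1 l2 F) auto
    also have "\<dots> = (Cm - 1) * norm a * norm b" by (simp add: Cm_def algebra_simps)
    also have "\<dots> \<le> Cm * norm a * norm b" by (intro mult_right_mono) auto
    finally show ?thesis .
  qed
  have herm: "of_real (W (- k)) * cv (- k) = cnj (of_real (W k) * cv k)" for k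
  proof -
    have "cv (- k) = (\<Sum>\<^sub>\<infinity>j. fc a (- j) * fc b (- k - - j))"
      unfolding cv_def by (rule infsum_reindex_bij_witness[of _ uminus uminus]) auto
    also have "\<dots> = (\<Sum>\<^sub>\<infinity>j. cnj (fc a j * fc b (k - j)))"
    proof (rule infsum_cong)
      fix j
      have "- k - - j = - (k - j)" by simp
      then show "fc a (- j) * fc b (- k - - j) = cnj (fc a j * fc b (k - j))" by (simp only: fc_simps complex_cnj_mult)
    qed
    also have "\<dots> = cnj (cv k)" unfolding cv_def by (rule infsum_cnj)
    finally show ?thesis by simp
  qed
  obtain c where "\<And>k. coef c k = of_real (W k) * cv k" "norm c \<le> Cm * norm a * norm b"
    using ex_hl2[OF bnd herm] by blast
  then show ?thesis using W_nz by (intro exI[of _ c]) (simp add: fc_def cv_def)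
qed

definition mul :: "(int^'d) hl2 \<Rightarrow> (int^'d) hl2 \<Rightarrow> (int^'d) hl2" (infixl "\<odot>" 70) where
  "a \<odot> b = (SOME c. (\<forall>k. fc c k = (\<Sum>\<^sub>\<infinity>j. fc a j * fc b (k - j))) \<and> norm c \<le> Cm * norm a * norm b)"

lemma fc_mul: "fc (a \<odot> b) k = (\<Sum>\<^sub>\<infinity>j. fc a j * fc b (k - j))"
  and norm_mul_le: "norm (a \<odot> b) \<le> Cm * norm a * norm b"
  using someI_ex[OF ex_mul[of a b]] unfolding mul_def by auto

lemma ev_mul [simp]: "ev (a \<odot> b) x = ev a x * ev b x"
proof -
  have "evc (a \<odot> b) x = (\<Sum>\<^sub>\<infinity>k. \<Sum>\<^sub>\<infinity>j. (fc a j * cis (freq_dot j x)) * (fc b (k - j) * cis (freq_dot (k - j) x)))"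
    unfolding evc_def fc_mul infsum_cmult_left'[symmetric]
  proof (intro infsum_cong)
    fix k j :: "int^'d"
    have "cis (freq_dot k x) = cis (freq_dot j x) * cis (freq_dot (k - j) x)" by (simp add: cis_mult)
    then show "fc a j * fc b (k - j) * cis (freq_dot k x) =
        fc a j * cis (freq_dot j x) * (fc b (k - j) * cis (freq_dot (k - j) x))" by (simp only: mult_ac)
  qed
  also have "\<dots> = evc a x * evc b x"
    unfolding evc_def by (rule infsum_convolution[OF summable_fc_cis summable_fc_cis])
  finally show ?thesis by (simp only: evc_eq of_real_mult[symmetric] of_real_eq_iff)
qed

lemma bounded_bilinear_mul: "bounded_bilinear (\<odot>)"
proof
  show "\<exists>K. \<forall>a b. norm (a \<odot> b) \<le> norm a * norm b * K"
    using norm_mul_le by (intro exI[of _ Cm]) (auto simp: mult_ac)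
qed (rule ev_inj; simp add: algebra_simps)+

sublocale mul: bounded_bilinear "(\<odot>)" by (rule bounded_bilinear_mul)

lemma mul_commute: "a \<odot> b = b \<odot> a" and mul_assoc: "(a \<odot> b) \<odot> c = a \<odot> (b \<odot> c)"
  by (rule ev_inj; simp)+

definition cst :: "real \<Rightarrow> (int^'d) hl2" where "cst c = blk (of_real c) 0"

lemma ev_cst [simp]: "ev (cst c) x = c"
  by (simp add: cst_def ev_blk)

lemma mul_cst [simp]: "cst c \<odot> a = c *\<^sub>R a" "a \<odot> cst c = c *\<^sub>R a"
  by (rule ev_inj; simp)+

primrec pw :: "(int^'d) hl2 \<Rightarrow> nat \<Rightarrow> (int^'d) hl2" where
  "pw a 0 = cst 1" | "pw a (Suc n) = a \<odot> pw a n"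

lemma ev_pw [simp]: "ev (pw a n) x = ev a x ^ n"
  by (induction n) auto

lemma norm_pw_le: "norm (pw a n) \<le> (Cm * norm a) ^ n * norm (cst 1)"
proof (induction n)
  case (Suc n)
  have "norm (pw a (Suc n)) \<le> Cm * norm a * norm (pw a n)" using norm_mul_le by simp
  also have "\<dots> \<le> Cm * norm a * ((Cm * norm a) ^ n * norm (cst 1))"
    using Suc Cm_ge_1 by (intro mult_left_mono) auto
  finally show ?case by (simp add: mult.assoc)
qed simp

text \<open>Size and Lipschitz bound are proved together because a^(n+1) - b^(n+1) = a (a^n - b^n) +
  (a - b) b^n uses both.\<close>

lemma pw_Lipschitz: "\<exists>L\<ge>0. \<forall>a b. norm a \<le> R \<longrightarrow> norm b \<le> R \<longrightarrow> norm (pw a n) \<le> L \<and> norm (pw a n - pw b n) \<le> L * norm (a - b)"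
proof (induction n)
  case 0
  then show ?case by (intro exI[of _ "norm (cst 1)"]) auto
next
  case (Suc n)
  then obtain L where L: "L \<ge> 0" "\<And>a b :: (int^'d) hl2. norm a \<le> R \<Longrightarrow> norm b \<le> R \<Longrightarrow> norm (pw a n) \<le> L"
    "\<And>a b. norm a \<le> R \<Longrightarrow> norm b \<le> R \<Longrightarrow> norm (pw a n - pw b n) \<le> L * norm (a - b)" by blast
  show ?case
  proof (intro exI[of _ "Cm * \<bar>R\<bar> * L + Cm * L"] conjI allI impI)
    fix a b :: "(int^'d) hl2" assume ab: "norm a \<le> R" "norm b \<le> R"
    note L = L(1) L(2)[OF ab(1) ab(1)] L(2)[OF ab(2) ab(2)] L(3)[OF ab]
    have R: "R \<ge> 0" using ab norm_ge_zero[of a] by linarith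
    have "norm (pw a (Suc n)) \<le> Cm * norm a * norm (pw a n)" using norm_mul_le by simp
    also have "\<dots> \<le> Cm * R * L" using ab L R Cm_ge_1 by (intro mult_mono) auto
    finally show "norm (pw a (Suc n)) \<le> Cm * \<bar>R\<bar> * L + Cm * L" using L Cm_ge_1 R by (simp add: add_increasing2)
    have "norm (pw a (Suc n) - pw b (Suc n)) = norm (a \<odot> (pw a n - pw b n) + (a - b) \<odot> pw b n)"
      by (simp add: mul.diff_left mul.diff_right)
    also have "\<dots> \<le> Cm * norm a * norm (pw a n - pw b n) + Cm * norm (a - b) * norm (pw b n)"
      by (rule order_trans[OF norm_triangle_ineq add_mono[OF norm_mul_le norm_mul_le]])
    also have "\<dots> \<le> Cm * R * (L * norm (a - b)) + Cm * norm (a - b) * L"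
      using ab L R Cm_ge_1 by (intro add_mono mult_mono) auto
    finally show "norm (pw a (Suc n) - pw b (Suc n)) \<le> (Cm * \<bar>R\<bar> * L + Cm * L) * norm (a - b)"
      using R by (simp add: algebra_simps)
  qed (use L Cm_ge_1 in auto)
qed

section \<open>The exponential\<close>

text \<open>The series provides an element of the algebra together with norm estimates; algebraic
  identities are then read off from the pointwise exponential by \<open>ev_inj\<close>.\<close>

definition E :: "(int^'d) hl2 \<Rightarrow> (int^'d) hl2" where "E a = (\<Sum>n. (1 / fact n) *\<^sub>R pw a n)"

lemma summable_E_bound: "summable (\<lambda>n. (1 / fact n) * ((Cm * r) ^ n * norm (cst 1)))"
  using summable_mult2[OF summable_exp[of "Cm * r"], of "norm (cst 1)"]
  by (simp add: mult_ac divide_inverse)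

lemma summable_norm_E: "summable (\<lambda>n. norm ((1 / fact n) *\<^sub>R pw a n))"
proof (rule summable_comparison_test'[OF summable_E_bound[of "norm a"], where N=0])
  fix n
  show "norm (norm ((1 / fact n) *\<^sub>R pw a n)) \<le> (1 / fact n) * ((Cm * norm a) ^ n * norm (cst 1))"
    using norm_pw_le[of a n] by (simp add: divide_right_mono)
qed

lemma summable_E: "summable (\<lambda>n. (1 / fact n) *\<^sub>R pw a n)"
  by (rule summable_norm_cancel[OF summable_norm_E])

lemma ev_E [simp]: "ev (E a) x = exp (ev a x)"
proof -
  have "ev (E a) x = (\<Sum>n. ev ((1 / fact n) *\<^sub>R pw a n) x)"
    unfolding E_def by (rule bounded_linear.suminf[OF bounded_linear_ev summable_E])
  then show ?thesis by (simp add: exp_def divide_inverse)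
qed

lemma E_add: "E (a + b) = E a \<odot> E b" and E_0: "E 0 = cst 1" and E_cst: "E (cst c) = cst (exp c)"
  by (rule ev_inj; simp add: exp_add)+

lemma E_inverse: "E (- a) \<odot> E a = cst 1" "E a \<odot> E (- a) = cst 1"
  by (rule ev_inj; simp flip: exp_add)+

definition K1 :: real where "K1 = norm (cst 1) + 1"

lemma K1_ge_1: "1 \<le> K1" by (simp add: K1_def)

lemma norm_E_le: "norm (E a) \<le> K1 * exp (Cm * norm a)"
proof -
  have "norm (E a) \<le> (\<Sum>n. norm ((1 / fact n) *\<^sub>R pw a n))"
    unfolding E_def by (rule summable_norm[OF summable_norm_E])
  also have "\<dots> \<le> (\<Sum>n. (1 / fact n) * ((Cm * norm a) ^ n * norm (cst 1)))"
    by (rule suminf_le[OF _ summable_norm_E summable_E_bound])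
      (use norm_pw_le in \<open>auto simp: divide_right_mono\<close>)
  also have "\<dots> = norm (cst 1) * exp (Cm * norm a)"
    unfolding exp_def by (subst suminf_mult[symmetric]) (use summable_exp in \<open>auto simp: divide_inverse mult_ac\<close>)
  also have "\<dots> \<le> K1 * exp (Cm * norm a)" by (simp add: K1_def)
  finally show ?thesis .
qed

lemma norm_E_mul_le: "norm (E a \<odot> w) \<le> Cm * K1 * exp (Cm * norm a) * norm w"
proof -
  have "norm (E a \<odot> w) \<le> Cm * norm (E a) * norm w" by (rule norm_mul_le)
  also have "\<dots> \<le> Cm * (K1 * exp (Cm * norm a)) * norm w"
    using Cm_ge_1 norm_E_le by (intro mult_right_mono mult_left_mono) auto
  finally show ?thesis by (simp add: mult.assoc)
qed

text \<open>Dropping the first m terms leaves m powers of the norm times a full exponential series,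
  since 1 / (m + n)! is at most 1 / n!. The two claims are m = 1 and m = 2.\<close>

lemma norm_E_minus_le:
  shows "norm (E a - cst 1) \<le> Cm * K1 * norm a * exp (Cm * norm a)"
    and "norm (E a - cst 1 - a) \<le> (Cm)\<^sup>2 * K1 * (norm a)\<^sup>2 * exp (Cm * norm a)"
proof -
  have s1: "summable (\<lambda>n. (1 / fact (Suc n)) *\<^sub>R pw a (Suc n))"
    using summable_E[of a] by (subst summable_Suc_iff)
  have s2: "summable (\<lambda>n. (1 / fact (Suc (Suc n))) *\<^sub>R pw a (Suc (Suc n)))"
    using s1 by (subst summable_Suc_iff[where f="\<lambda>n. (1 / fact (Suc n)) *\<^sub>R pw a (Suc n)"])
  have b: "norm ((1 / fact (m + n)) *\<^sub>R pw a (m + n)) \<le> (Cm * norm a) ^ m * ((1 / fact n) * ((Cm * norm a) ^ n * norm (cst 1)))" for m n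
  proof -
    have "norm ((1 / fact (m + n)) *\<^sub>R pw a (m + n)) \<le> (1 / fact (m + n)) * ((Cm * norm a) ^ (m + n) * norm (cst 1))"
      using norm_pw_le[of a "m + n"] by (simp add: divide_right_mono)
    also have "\<dots> \<le> (1 / fact n) * ((Cm * norm a) ^ (m + n) * norm (cst 1))"
      using Cm_ge_1 by (intro mult_right_mono) (auto simp: fact_mono frac_le)
    finally show ?thesis by (simp add: power_add mult_ac)
  qed
  have val: "(\<Sum>n. (Cm * norm a) ^ m * ((1 / fact n) * ((Cm * norm a) ^ n * norm (cst 1)))) \<le> (Cm * norm a) ^ m * (K1 * exp (Cm * norm a))" for m
  proof -
    have "(\<Sum>n. (1 / fact n) * ((Cm * norm a) ^ n * norm (cst 1))) = norm (cst 1) * exp (Cm * norm a)"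
      unfolding exp_def by (subst suminf_mult[symmetric]) (use summable_exp in \<open>auto simp: divide_inverse mult_ac\<close>)
    then show ?thesis
      using summable_E_bound[of "norm a"] Cm_ge_1 by (subst suminf_mult) (auto simp: K1_def intro!: mult_left_mono)
  qed
  have le: "norm (\<Sum>n. (1 / fact (m + n)) *\<^sub>R pw a (m + n)) \<le> (Cm * norm a) ^ m * (K1 * exp (Cm * norm a))" for m
  proof -
    have s: "summable (\<lambda>n. (Cm * norm a) ^ m * ((1 / fact n) * ((Cm * norm a) ^ n * norm (cst 1))))"
      by (intro summable_mult summable_E_bound)
    have sn: "summable (\<lambda>n. norm ((1 / fact (m + n)) *\<^sub>R pw a (m + n)))"
      by (rule summable_comparison_test'[OF s, where N=0]) (use b in auto)
    show ?thesis
      by (rule order_trans[OF summable_norm[OF sn] order_trans[OF suminf_le[OF b sn s] val]])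
  qed
  have e1: "E a - cst 1 = (\<Sum>n. (1 / fact (Suc n)) *\<^sub>R pw a (Suc n))"
    unfolding E_def using suminf_split_head[OF summable_E[of a]] by simp
  have e2: "E a - cst 1 - a = (\<Sum>n. (1 / fact (Suc (Suc n))) *\<^sub>R pw a (Suc (Suc n)))"
    unfolding e1 using suminf_split_head[OF s1] by simp
  show "norm (E a - cst 1) \<le> Cm * K1 * norm a * exp (Cm * norm a)"
    using le[of 1] unfolding e1 by (simp add: mult_ac)
  show "norm (E a - cst 1 - a) \<le> (Cm)\<^sup>2 * K1 * (norm a)\<^sup>2 * exp (Cm * norm a)"
    using le[of 2] unfolding e2 by (simp add: power_mult_distrib mult_ac numeral_2_eq_2)
qed

end

section \<open>Density of trigonometric polynomials\<close>

text \<open>Embeds the torus as a product of unit circles. Periodic functions become functions on a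
  compact set, on which Stone-Weierstrass can be applied.\<close>

definition circle_map :: "real^'d::finite \<Rightarrow> complex^'d" where "circle_map x = (\<chi> i. cis (x $ i))"

lemma continuous_circle_map: "continuous_on S circle_map"
  unfolding circle_map_def by (intro continuous_intros)

lemma torus_periodic_int:
  assumes "torus_periodic f"
  shows "f (x + axis i (2 * pi * of_int n)) = f x"
proof -
  have nat: "f (x + axis i (2 * pi * of_nat m)) = f x" for x m
  proof (induction m)
    case (Suc m)
    have "x + axis i (2 * pi * of_nat (Suc m)) = (x + axis i (2 * pi * of_nat m)) + axis i (2 * pi)"
      by (simp add: vec_eq_iff axis_def algebra_simps)
    then show ?case using assms Suc by (simp only: torus_periodic_def)
  next
    case 0
    have "x + axis i 0 = x" by (simp add: vec_eq_iff axis_def)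
    then show ?case by (simp only: of_nat_0 mult_zero_right)
  qed
  show ?thesis
  proof (cases n rule: int_cases2)
    case (nonneg m)
    then show ?thesis using nat[of x m] by simp
  next
    case (nonpos m)
    have "x = (x + axis i (2 * pi * of_int n)) + axis i (2 * pi * of_nat m)"
      by (simp add: vec_eq_iff axis_def nonpos)
    then show ?thesis using nat[of "x + axis i (2 * pi * of_int n)" m] by metis
  qed
qed

lemma torus_periodic_vec_int:
  fixes f :: "real^'d::finite \<Rightarrow> 'b"
  assumes "torus_periodic f"
  shows "f (x + (\<chi> i. 2 * pi * of_int (n i))) = f x"
proof -
  have "f (x + (\<Sum>i\<in>A. axis i (2 * pi * of_int (n i)))) = f x" for A :: "'d set"
  proof (induction A rule: infinite_finite_induct)
    case (insert j A)
    then show ?case using torus_periodic_int[OF assms, of "x + (\<Sum>i\<in>A. axis i (2 * pi * of_int (n i)))" j "n j"]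
      by (simp add: add_ac)
  qed auto
  moreover have "(\<Sum>i\<in>UNIV. axis i (2 * pi * of_int (n i))) = (\<chi> i. 2 * pi * of_int (n i))"
    by (simp add: vec_eq_iff axis_def)
  ultimately show ?thesis by metis
qed

lemma circle_map_eqD:
  assumes "torus_periodic f" "circle_map x = circle_map y"
  shows "f x = f y"
proof -
  have "\<exists>n::int. x $ i = y $ i + 2 * pi * of_int n" for i
    using assms(2) sin_cos_eq_iff[of "x $ i" "y $ i"]
    by (auto simp: circle_map_def vec_eq_iff complex_eq_iff mult_ac)
  then obtain n where "\<And>i. x $ i = y $ i + 2 * pi * of_int (n i)" by metis
  then have "x = y + (\<chi> i. 2 * pi * of_int (n i))" by (simp add: vec_eq_iff)
  then show ?thesis using torus_periodic_vec_int[OF assms(1), of y n] by simp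
qed

lemma ex_torus_cell: "\<exists>y\<in>torus_cell. circle_map y = circle_map x"
proof -
  define y where "y = (\<chi> i. x $ i - 2 * pi * of_int \<lfloor>x $ i / (2 * pi)\<rfloor>)"
  have "0 \<le> y $ i \<and> y $ i \<le> 2 * pi" for i
  proof -
    have "of_int \<lfloor>x $ i / (2*pi)\<rfloor> \<le> x $ i / (2*pi)" "x $ i / (2*pi) \<le> of_int \<lfloor>x $ i / (2*pi)\<rfloor> + 1"
      by linarith+
    then have "2*pi * of_int \<lfloor>x $ i / (2*pi)\<rfloor> \<le> x $ i" "x $ i \<le> 2*pi * (of_int \<lfloor>x $ i / (2*pi)\<rfloor> + 1)"
      by (simp_all only: pos_le_divide_eq[of "2*pi"] pos_divide_le_eq[of "2*pi"] mult.commute[of _ "2*pi"] pi_gt_zero mult_pos_pos zero_less_numeral)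
    then show ?thesis by (simp add: y_def distrib_left)
  qed
  moreover have "cis (y $ i) = cis (x $ i)" for i
    using cis_multiple_2pi[of "of_int \<lfloor>x $ i / (2 * pi)\<rfloor>"]
    by (simp add: y_def flip: cis_divide)
  ultimately show ?thesis
    by (intro bexI[of _ y]) (auto simp: torus_cell_def mem_box_cart circle_map_def vec_eq_iff)
qed

lemma range_circle_map: "range circle_map = circle_map ` torus_cell"
proof
  show "range circle_map \<subseteq> circle_map ` torus_cell"
    using ex_torus_cell by (metis image_eqI image_subsetI)
qed auto

text \<open>Continuity passes to the quotient because \<open>circle_map\<close> sends closed subsets
  of the compact cell to closed sets.\<close>

lemma torus_periodic_factor:
  fixes f :: "real^'d::finite \<Rightarrow> real"
  assumes per: "torus_periodic f" and cont: "continuous_on UNIV f"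
  obtains F where "continuous_on (range circle_map) F" "\<And>x. F (circle_map x) = f x"
proof
  define F where "F p = f (SOME x. circle_map x = p)" for p
  show F: "F (circle_map x) = f x" for x
    unfolding F_def by (rule circle_map_eqD[OF per]) (rule someI[of _ x], rule refl)
  note R = range_circle_map[where 'a='d]
  have cl: "closed (circle_map ` S)" if "closed S" "S \<subseteq> torus_cell" for S :: "(real^'d) set"
  proof -
    have "compact S"
      using compact_Int_closed[OF compact_cbox that(1), of 0 "\<chi> i. 2*pi"] that(2)
      by (simp add: torus_cell_def Int_absorb1)
    then show ?thesis by (intro compact_imp_closed compact_continuous_image continuous_circle_map)
  qed
  have ct: "closed (torus_cell :: (real^'d) set)" by (simp add: torus_cell_def closed_cbox)
  show "continuous_on (range circle_map) F"
    unfolding continuous_on_closed_vimage[OF cl[OF ct order_refl, folded R]]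
  proof (intro allI impI)
    fix B :: "real set" assume "closed B"
    then have "closed (f -` B \<inter> torus_cell)"
      using continuous_on_closed_vimage[OF ct, of f] continuous_on_subset[OF cont] by blast
    then have "closed (circle_map ` (f -` B \<inter> torus_cell))" by (rule cl) auto
    moreover have "circle_map ` (f -` B \<inter> torus_cell) = F -` B \<inter> range circle_map"
      unfolding R using F by auto
    ultimately show "closed (F -` B \<inter> range circle_map)" by simp
  qed
qed

context sobolev begin

lemma ex_ev_polynomial:
  assumes "real_polynomial_function g"
  shows "\<exists>a. \<forall>x. g (circle_map x) = ev a x"
  using assms
proof (induction rule: real_polynomial_function.induct)
  case (linear h)
  interpret bounded_linear h by fact
  have eq: "circle_map x = (\<Sum>i\<in>UNIV. cos (x $ i) *\<^sub>R axis i 1 + sin (x $ i) *\<^sub>R axis i \<i>)" for x :: "real^'d"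
    by (simp add: vec_eq_iff circle_map_def axis_def complex_eq_iff if_distrib[of "\<lambda>z. _ *\<^sub>R z"] if_distrib[of Re] if_distrib[of Im] cong: if_cong)
  have fd: "freq_dot (axis i 1) x = x $ i" for i and x :: "real^'d"
    by (simp add: freq_dot_def axis_def if_distrib[of of_int] if_distrib[of "\<lambda>z. z * _"] cong: if_cong)
  \<comment> \<open>A real linear functional of the circle coordinates is a combination of cosines
    and sines; \<open>blk 1\<close> is the cosine and \<open>blk (- \<i>)\<close> the sine.\<close>
  show ?case
    by (rule exI[of _ "\<Sum>i\<in>UNIV. h (axis i 1) *\<^sub>R blk 1 (axis i 1) + h (axis i \<i>) *\<^sub>R blk (- \<i>) (axis i 1)"])
      (simp add: eq sum add scaleR ev_blk fd mult.commute)
next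
  case (const c)
  show ?case by (rule exI[of _ "cst c"]) simp
next
  case (add f g)
  then show ?case by (metis ev_add)
next
  case (mult f g)
  then show ?case by (metis ev_mul)
qed

lemma ex_ev_uniform_approx:
  fixes f :: "real^'d \<Rightarrow> real"
  assumes "torus_periodic f" "continuous_on UNIV f" "e > 0"
  obtains a where "\<And>x. \<bar>f x - ev a x\<bar> < e"
proof -
  obtain F where F: "continuous_on (range circle_map) F" "\<And>x. F (circle_map x) = f x"
    using torus_periodic_factor[OF assms(1,2)] by metis
  have "compact (range (circle_map :: real^'d \<Rightarrow> _))"
    unfolding range_circle_map torus_cell_def
    by (intro compact_continuous_image continuous_circle_map compact_cbox)
  from Stone_Weierstrass_real_polynomial_function[OF this F(1) assms(3)]
  obtain g where g: "real_polynomial_function g" "\<And>p. p \<in> range circle_map \<Longrightarrow> \<bar>F p - g p\<bar> < e"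
    by blast
  then obtain a where "\<And>x. g (circle_map x) = ev a x" using ex_ev_polynomial by blast
  then show ?thesis using g(2) F(2) by (intro that[of a]) (metis rangeI)
qed

text \<open>Vanishing coefficients make g orthogonal to every \<open>ev a\<close>. Since g is a
  uniform limit of such functions, the integral of its square is arbitrarily small.\<close>

lemma fourier_zero_imp_zero:
  fixes g :: "real^'d \<Rightarrow> real"
  assumes per: "torus_periodic g" and cont: "continuous_on UNIV g" and zero: "\<And>k. fourier_coeff g k = 0"
  shows "g x = 0"
proof -
  have i: "set_integrable lborel torus_cell h" if "continuous_on UNIV h" for h :: "real^'d \<Rightarrow> real"
    by (rule set_integrable_torus[OF that])
  define A where "A = (LINT x:torus_cell|lborel. \<bar>g x\<bar>)"
  have le: "\<bar>LINT x:torus_cell|lborel. g x * h x\<bar> \<le> A * B"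
    if h: "continuous_on UNIV h" "\<And>x. \<bar>h x\<bar> \<le> B" for h B
  proof -
    have "\<bar>LINT x:torus_cell|lborel. g x * h x\<bar> \<le> (LINT x:torus_cell|lborel. norm (g x * h x))"
      using set_integral_norm_bound[OF i[of "\<lambda>x. g x * h x"]] continuous_on_mult[OF cont h(1)] by simp
    also have "\<dots> \<le> (LINT x:torus_cell|lborel. \<bar>g x\<bar> * B)"
    proof (rule set_integral_mono)
      show "set_integrable lborel torus_cell (\<lambda>x. norm (g x * h x))"
        by (rule i) (intro continuous_intros cont h)
      show "set_integrable lborel torus_cell (\<lambda>x. \<bar>g x\<bar> * B)"
        by (rule i) (intro continuous_intros cont)
      show "norm (g x * h x) \<le> \<bar>g x\<bar> * B" for x
        using h(2)[of x] by (simp add: abs_mult mult_left_mono)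
    qed
    finally show ?thesis by (simp add: A_def)
  qed
  have bl: "bounded_linear (\<lambda>a. LINT x:torus_cell|lborel. g x * ev a x)"
  proof (rule bounded_linear_intro[of _ "A * Z"])
    fix a b :: "(int^'d) hl2" and r :: real
    note ig = i[of "\<lambda>x. g x * ev _ x"]
    show "(LINT x:torus_cell|lborel. g x * ev (a + b) x) = (LINT x:torus_cell|lborel. g x * ev a x) + (LINT x:torus_cell|lborel. g x * ev b x)"
      unfolding ev_add distrib_left by (rule set_integral_add) (intro ig continuous_intros cont continuous_ev)+
    show "(LINT x:torus_cell|lborel. g x * ev (r *\<^sub>R a) x) = r *\<^sub>R (LINT x:torus_cell|lborel. g x * ev a x)"
      by (simp add: mult.left_commute)
    show "norm (LINT x:torus_cell|lborel. g x * ev a x) \<le> norm a * (A * Z)"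
      using le[OF continuous_ev, of a "Z * norm a"] abs_ev_le by (simp add: mult_ac)
  qed
  have orth: "(LINT x:torus_cell|lborel. g x * ev a x) = 0" for a
  proof (induction a rule: blk_induct)
    case (blk z k)
    have c: "set_integrable lborel torus_cell (\<lambda>x. z * (complex_of_real (g x) * cis (- freq_dot (- k) x)))"
      by (intro set_integrable_torus continuous_intros cont)
    have "(LINT x:torus_cell|lborel. complex_of_real (g x) * cis (- freq_dot (- k) x)) = 0"
      using zero[of "- k"] by (simp add: fourier_coeff_def)
    then have "0 = Re (LINT x:torus_cell|lborel. z * (complex_of_real (g x) * cis (- freq_dot (- k) x)))"
      unfolding set_integral_mult_right by (simp only: mult_zero_right zero_complex.sel)
    also have "\<dots> = (LINT x|lborel. Re (indicator torus_cell x *\<^sub>R (z * (complex_of_real (g x) * cis (- freq_dot (- k) x)))))"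
      unfolding set_lebesgue_integral_def by (rule integral_bounded_linear[OF bounded_linear_Re c[unfolded set_integrable_def], symmetric])
    also have "\<dots> = (LINT x:torus_cell|lborel. g x * ev (blk z k) x)"
      unfolding set_lebesgue_integral_def
      by (rule Bochner_Integration.integral_cong) (simp_all add: ev_blk algebra_simps)
    finally show ?case by simp
  next
    case closed
    show ?case by (intro closed_Collect_eq linear_continuous_on bl continuous_on_const)
  next
    case (add a b)
    then show ?case using linear_add[OF bounded_linear.linear[OF bl]] by simp
  next
    case (scaleR r a)
    then show ?case using linear_scale[OF bounded_linear.linear[OF bl]] by simp
  qed (simp)
  have sq: "(LINT x:torus_cell|lborel. (g x)\<^sup>2) \<le> A * e" if e: "e > 0" for e
  proof -
    obtain a where a: "\<And>x. \<bar>g x - ev a x\<bar> < e"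
      using ex_ev_uniform_approx[OF per cont e] by metis
    have "(LINT x:torus_cell|lborel. (g x)\<^sup>2) = (LINT x:torus_cell|lborel. g x * (g x - ev a x) + g x * ev a x)"
      by (simp add: algebra_simps power2_eq_square)
    also have "\<dots> = (LINT x:torus_cell|lborel. g x * (g x - ev a x)) + (LINT x:torus_cell|lborel. g x * ev a x)"
      by (rule set_integral_add) (intro i continuous_intros cont continuous_ev)+
    also have "\<dots> \<le> A * e"
      using le[OF continuous_on_diff[OF cont continuous_ev], of a e] a orth less_imp_le by fastforce
    finally show ?thesis .
  qed
  have A: "A \<ge> 0" unfolding A_def set_lebesgue_integral_def by (rule integral_nonneg_AE) auto
  have "(LINT x:torus_cell|lborel. (g x)\<^sup>2) \<le> 0"
  proof (rule field_le_epsilon)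
    fix e :: real assume "e > 0"
    then have "A * (e / (A + 1)) \<le> e" using A by (simp add: field_simps)
    moreover have "(LINT x:torus_cell|lborel. (g x)\<^sup>2) \<le> A * (e / (A + 1))"
      using A \<open>e > 0\<close> by (intro sq) auto
    ultimately show "(LINT x:torus_cell|lborel. (g x)\<^sup>2) \<le> 0 + e" by linarith
  qed
  moreover have "(LINT x:torus_cell|lborel. (g x)\<^sup>2) \<ge> 0"
    unfolding set_lebesgue_integral_def by (rule integral_nonneg_AE) auto
  ultimately have "(LINT x:torus_cell|lborel. (g x)\<^sup>2) = 0" by simp
  moreover have si: "set_integrable lborel torus_cell (\<lambda>x. (g x)\<^sup>2)" by (intro i continuous_intros cont)
  ultimately have "((\<lambda>x. (g x)\<^sup>2) has_integral 0) (cbox 0 (\<chi> i. 2 * pi))"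
    using set_borel_integral_eq_integral[OF si] integrable_integral[of "\<lambda>x. (g x)\<^sup>2" torus_cell]
    by (simp add: torus_cell_def)
  moreover have "box (0::real^'d) (\<chi> i. 2 * pi) \<noteq> {}" by (simp add: interval_ne_empty_cart)
  ultimately have "(g y)\<^sup>2 = 0" if "y \<in> torus_cell" for y
    by (intro has_integral_0_cbox_imp_0[of 0 "\<chi> i. 2*pi" "\<lambda>x. (g x)\<^sup>2" y])
      (use that in \<open>auto simp: torus_cell_def intro: continuous_on_power continuous_on_subset[OF cont]\<close>)
  moreover obtain y where "y \<in> torus_cell" "circle_map y = circle_map x" using ex_torus_cell by blast
  ultimately show ?thesis using circle_map_eqD[OF per, of y x] by simp
qed

text \<open>The weighted coefficients of \<open>f\<close> define \<open>a\<close>; the difference of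
  \<open>f\<close> and \<open>ev a\<close> is continuous with vanishing coefficients. Together with
  \<open>ev_in_Hs\<close> this identifies the functions of the statement with the sequence
  type.\<close>

lemma Hs_imp_ev:
  assumes f: "f \<in> Hs s"
  obtains a where "f = ev a"
proof -
  have per: "torus_periodic f" and cont: "continuous_on UNIV f"
    and sm: "(\<lambda>k. (1 + freq_norm_sq k) ^ s * (cmod (fourier_coeff f k))\<^sup>2) summable_on UNIV"
    using f by (auto simp: Hs_def)
  define c where "c k = of_real (W k) * fourier_coeff f k" for k
  have "(\<lambda>k. (cmod (c k))\<^sup>2) summable_on UNIV"
    using sm by (simp add: c_def norm_mult power_mult_distrib W_sq)
  then obtain B where B: "\<And>F. finite F \<Longrightarrow> L2_set (\<lambda>k. cmod (c k)) F \<le> B"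
    unfolding square_summable_iff_L2_set_bounded by blast
  have herm: "c (- k) = cnj (c k)" for k
  proof -
    have "cnj (fourier_coeff f k) = fourier_coeff f (- k)"
      unfolding fourier_coeff_def set_lebesgue_integral_def complex_cnj_divide Bochner_Integration.integral_cnj[symmetric]
      by (simp add: cis_cnj)
    then show ?thesis by (simp add: c_def)
  qed
  obtain a where "\<And>k. coef a k = c k" using ex_hl2[OF B herm] by blast
  then have fca: "fc a k = fourier_coeff f k" for k using W_nz by (simp add: fc_def c_def)
  have "f x - ev a x = 0" for x
  proof (rule fourier_zero_imp_zero)
    show "torus_periodic (\<lambda>x. f x - ev a x)"
      using per torus_periodic_ev[of a] by (simp add: torus_periodic_def)
    show "continuous_on UNIV (\<lambda>x. f x - ev a x)" by (intro continuous_intros cont continuous_ev)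
    show "fourier_coeff (\<lambda>x. f x - ev a x) k = 0" for k
      using fourier_coeff_linear[OF cont continuous_ev[of UNIV a], of 1 "-1" k] by (simp add: fourier_coeff_ev fca)
  qed
  then show ?thesis by (intro that[of a]) (auto simp: fun_eq_iff)
qed

lemma L2_torus_norm_le:
  fixes f :: "real^'d \<Rightarrow> real"
  assumes "continuous_on UNIV f" "\<And>x. \<bar>f x\<bar> \<le> B"
  shows "L2_torus_norm f \<le> sqrt ((2*pi)^CARD('d)) * B"
proof -
  have B: "B \<ge> 0" using assms(2)[of undefined] by linarith
  have "(LINT x:torus_cell|lborel. (f x)\<^sup>2) \<le> (LINT (x::real^'d):torus_cell|lborel. B\<^sup>2)"
    by (rule set_integral_mono)
      (use assms in \<open>auto intro!: set_integrable_torus continuous_intros simp: abs_le_square_iff[symmetric] order_trans[OF _ abs_ge_self]\<close>)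
  also have "\<dots> = (2*pi)^CARD('d) * B\<^sup>2"
    unfolding set_lebesgue_integral_def using measure_torus_cell[where 'd='d] by simp
  finally have "L2_torus_norm f \<le> sqrt ((2*pi)^CARD('d) * B\<^sup>2)" by (simp add: L2_torus_norm_def)
  then show ?thesis using B by (simp add: real_sqrt_mult)
qed

section \<open>Logarithms\<close>

abbreviation TP :: "(int^'d) hl2 set" where "TP \<equiv> span (range (\<lambda>(z, k). blk z k))"

lemma TP_finite_support: "a \<in> TP \<Longrightarrow> \<exists>N. \<forall>k. fc a k \<noteq> 0 \<longrightarrow> (\<forall>i. \<bar>k $ i\<bar> \<le> int N)"
proof (induction rule: span_induct_alt)
  case base
  then show ?case by simp
next
  case (step c x y)
  then obtain zl N where zl: "x = (case zl of (z, l) \<Rightarrow> blk z l)"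
    and N: "\<And>k i. fc y k \<noteq> 0 \<Longrightarrow> \<bar>k $ i\<bar> \<le> int N" by blast
  obtain z l where x: "x = blk z l" using zl by (cases zl) auto
  define M where "M = nat (\<Sum>i\<in>UNIV. \<bar>l $ i\<bar>)"
  have M: "\<bar>l $ i\<bar> \<le> int M" for i
    unfolding M_def using member_le_sum[of i UNIV "\<lambda>i. \<bar>l $ i\<bar>"] by (simp add: sum_nonneg)
  have "\<bar>k $ i\<bar> \<le> int (max M N)" if k: "fc (c *\<^sub>R x + y) k \<noteq> 0" for k i
  proof (cases "fc y k = 0")
    case True
    then have "fc (blk z l) k \<noteq> 0" using k x by auto
    then have "k = l \<or> k = - l" by (auto simp: fc_blk split: if_splits)
    then show ?thesis using M[of i] by auto
  next
    case False
    then show ?thesis using N[of k i] by auto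
  qed
  then show ?case by blast
qed

text \<open>Frequencies add under multiplication, so a box that contains those of g grows by N with
  each factor.\<close>

lemma pw_support:
  assumes "\<And>k i. fc g k \<noteq> 0 \<Longrightarrow> \<bar>k $ i\<bar> \<le> int N"
  shows "fc (pw g n) k \<noteq> 0 \<Longrightarrow> \<bar>k $ i\<bar> \<le> int (n * N)"
proof (induction n arbitrary: k)
  case 0
  then show ?case by (auto simp: cst_def fc_blk split: if_splits)
next
  case (Suc n)
  have "\<exists>j. fc g j * fc (pw g n) (k - j) \<noteq> 0"
  proof (rule ccontr)
    assume "\<not> ?thesis"
    then have "fc (pw g (Suc n)) k = (\<Sum>\<^sub>\<infinity>j::int^'d. 0)"
      unfolding pw.simps fc_mul by (intro infsum_cong) blast
    then show False using Suc.prems by simp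
  qed
  then obtain j where "fc g j \<noteq> 0" "fc (pw g n) (k - j) \<noteq> 0" by auto
  then have "\<bar>j $ i\<bar> \<le> int N" "\<bar>(k - j) $ i\<bar> \<le> int (n * N)" using assms Suc.IH by blast+
  then show ?case by simp
qed

lemma polynomial_times_geometric_bounded:
  fixes c q :: real
  assumes "0 < q" "q < 1" "0 \<le> c" "0 < m"
  shows "\<exists>B. \<forall>n::nat. (1 + c * (real n)\<^sup>2) ^ m * q ^ n \<le> B"
proof -
  \<comment> \<open>The root distributes the geometric decay: each of the 2 m factors n gets its own
    r ^ n, and n r ^ n is bounded.\<close>
  define r where "r = root (2 * m) q"
  have r: "0 < r" "r < 1" "r ^ (2 * m) = q" using assms by (auto simp: r_def)
  have "Bseq (\<lambda>n. real n * r ^ n)"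
    using powser_times_n_limit_0[of r] r by (intro convergent_imp_Bseq convergentI) auto
  then obtain B where B: "\<And>n. real n * r ^ n \<le> B" "B > 0"
    using r unfolding Bseq_def by (auto simp: abs_mult)
  have "(1 + c * (real n)\<^sup>2) ^ m * q ^ n \<le> (1 + c * B\<^sup>2) ^ m" for n
  proof -
    have "q ^ n = ((r ^ n)\<^sup>2) ^ m"
      unfolding r(3)[symmetric] by (simp flip: power_mult add: mult_ac)
    then have "(1 + c * (real n)\<^sup>2) ^ m * q ^ n = ((1 + c * (real n)\<^sup>2) * (r ^ n)\<^sup>2) ^ m"
      by (simp add: power_mult_distrib)
    also have "(1 + c * (real n)\<^sup>2) * (r ^ n)\<^sup>2 = (r ^ n)\<^sup>2 + c * (real n * r ^ n)\<^sup>2"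
      by (simp add: algebra_simps power2_eq_square)
    also have "((r ^ n)\<^sup>2 + c * (real n * r ^ n)\<^sup>2) ^ m \<le> (1 + c * B\<^sup>2) ^ m"
      using r assms B by (intro power_mono add_mono mult_left_mono) (auto simp: power_le_one)
    finally show ?thesis .
  qed
  then show ?thesis by blast
qed

text \<open>Since the support of \<open>g\<^sup>n\<close> grows linearly in \<open>n\<close>, the Sobolev norm costs only a polynomial factor
  against the supremum norm: this is the spectral radius formula for trigonometric polynomials.\<close>

lemma norm_pw_TP_le:
  assumes g: "g \<in> TP" and sup: "\<And>x. \<bar>ev g x\<bar> \<le> \<rho>" and \<rho>: "\<rho> < \<rho>'"
  shows "\<exists>K. \<forall>n. norm (pw g n) \<le> K * \<rho>' ^ n"
proof -
  have \<rho>0: "0 \<le> \<rho>" using sup[of undefined] by linarith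
  obtain N where N: "\<And>k i. fc g k \<noteq> 0 \<Longrightarrow> \<bar>k $ i\<bar> \<le> int N" using TP_finite_support[OF g] by blast
  define c where "c = real CARD('d) * (real N)\<^sup>2"
  have c: "c \<ge> 0" by (simp add: c_def)
  have le: "norm (pw g n) \<le> (1 + c * (real n)\<^sup>2) ^ s * \<rho> ^ n * Z" for n
  proof (rule norm_hl2_le)
    fix F :: "(int^'d) set" assume F: "finite F"
    have cf: "cmod (fc (pw g n) k) \<le> \<rho> ^ n" for k
      unfolding fourier_coeff_ev[symmetric]
      by (rule cmod_fourier_coeff_le[OF continuous_ev]) (use sup in \<open>auto simp: power_abs intro!: power_mono\<close>)
    have pt: "cmod (coef (pw g n) k) \<le> (1 + c * (real n)\<^sup>2) ^ s * \<rho> ^ n * inverse (W k)" for k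
    proof (cases "fc (pw g n) k = 0")
      case True
      then show ?thesis using W_pos[of k] \<rho>0 c by (simp add: coef_fc)
    next
      case False
      have "freq_norm_sq k \<le> (\<Sum>i\<in>(UNIV::'d set). (real (n * N))\<^sup>2)"
        unfolding freq_norm_sq_def
      proof (rule sum_mono)
        fix i
        have "\<bar>k $ i\<bar> \<le> int (n * N)" by (rule pw_support[OF N False])
        then have "\<bar>real_of_int (k $ i)\<bar> \<le> real (n * N)" by linarith
        then show "(real_of_int (k $ i))\<^sup>2 \<le> (real (n * N))\<^sup>2" by (simp only: abs_le_square_iff[symmetric] abs_of_nat)
      qed
      then have "1 + freq_norm_sq k \<le> 1 + c * (real n)\<^sup>2" by (simp add: c_def power_mult_distrib mult_ac)
      then have W2: "(W k)\<^sup>2 \<le> (1 + c * (real n)\<^sup>2) ^ s"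
        unfolding W_sq using freq_norm_sq_nonneg[of k] by (intro power_mono) auto
      have "cmod (coef (pw g n) k) = (W k)\<^sup>2 * cmod (fc (pw g n) k) * inverse (W k)"
        using W_pos[of k] by (simp add: coef_fc norm_mult power2_eq_square abs_of_pos)
      also have "\<dots> \<le> (1 + c * (real n)\<^sup>2) ^ s * \<rho> ^ n * inverse (W k)"
        using W_pos[of k] cf[of k] W2 c by (intro mult_right_mono mult_mono) auto
      finally show ?thesis .
    qed
    have "L2_set (\<lambda>k. cmod (coef (pw g n) k)) F \<le> L2_set (\<lambda>k. (1 + c * (real n)\<^sup>2) ^ s * \<rho> ^ n * inverse (W k)) F"
      by (rule L2_set_mono) (use pt in auto)
    also have "\<dots> = (1 + c * (real n)\<^sup>2) ^ s * \<rho> ^ n * L2_set (\<lambda>k. inverse (W k)) F"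
      by (rule L2_set_right_distrib[symmetric]) (use c \<rho>0 in auto)
    also have "\<dots> \<le> (1 + c * (real n)\<^sup>2) ^ s * \<rho> ^ n * Z"
      by (intro mult_left_mono L2_set_inverse_W F) (use c \<rho>0 in auto)
    finally show "L2_set (\<lambda>k. cmod (coef (pw g n) k)) F \<le> (1 + c * (real n)\<^sup>2) ^ s * \<rho> ^ n * Z" .
  qed
  have "s > 0" using s by (cases s) auto
  define q where "q = (\<rho> + \<rho>') / (2 * \<rho>')"
  have q: "0 < q" "q < 1" "\<rho> \<le> q * \<rho>'" using \<rho> \<rho>0 by (auto simp: q_def field_simps)
  obtain B where B: "\<And>n::nat. (1 + c * (real n)\<^sup>2) ^ s * q ^ n \<le> B"
    using polynomial_times_geometric_bounded[OF q(1,2) c \<open>s > 0\<close>] by blast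
  have "norm (pw g n) \<le> (B * Z) * \<rho>' ^ n" for n
  proof -
    have "\<rho> ^ n \<le> (q * \<rho>') ^ n" using \<rho>0 q by (intro power_mono) auto
    then have "(1 + c * (real n)\<^sup>2) ^ s * \<rho> ^ n * Z \<le> (1 + c * (real n)\<^sup>2) ^ s * (q * \<rho>') ^ n * Z"
      using c Z_nonneg by (intro mult_right_mono mult_left_mono) auto
    also have "\<dots> = ((1 + c * (real n)\<^sup>2) ^ s * q ^ n) * (Z * \<rho>' ^ n)" by (simp add: power_mult_distrib)
    also have "\<dots> \<le> B * (Z * \<rho>' ^ n)" using B Z_nonneg \<rho> \<rho>0 by (intro mult_right_mono) auto
    finally show ?thesis using le[of n] by (simp add: mult_ac)
  qed
  then show ?thesis by blast
qed

text \<open>Induction through g^j h^(n+1) = g^(j+1) h^n + (h - g) g^j h^n. The extra power of g is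
  carried along because only pure powers of g are known to decay; estimating factor by factor would
  lose a constant at every step.\<close>

lemma norm_pw_perturb:
  assumes g: "\<And>n. norm (pw g n) \<le> K * \<rho> ^ n" and "0 \<le> \<rho>"
  shows "norm (pw g j \<odot> pw h n) \<le> K * \<rho> ^ j * (\<rho> + Cm * norm (h - g)) ^ n"
proof (induction n arbitrary: j)
  case 0
  then show ?case using g[of j] by simp
next
  case (Suc n)
  define \<delta> where "\<delta> = Cm * norm (h - g)"
  have "pw g j \<odot> pw h (Suc n) = pw g (Suc j) \<odot> pw h n + (h - g) \<odot> (pw g j \<odot> pw h n)"
    by (rule ev_inj) (simp add: algebra_simps)
  then have "norm (pw g j \<odot> pw h (Suc n)) \<le> norm (pw g (Suc j) \<odot> pw h n) + \<delta> * norm (pw g j \<odot> pw h n)"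
    unfolding \<delta>_def using norm_triangle_le[OF add_left_mono[OF norm_mul_le]] by metis
  also have "\<dots> \<le> K * \<rho> ^ Suc j * (\<rho> + \<delta>) ^ n + \<delta> * (K * \<rho> ^ j * (\<rho> + \<delta>) ^ n)"
    using Suc.IH[of "Suc j"] Suc.IH[of j] Cm_ge_1 unfolding \<delta>_def[symmetric]
    by (intro add_mono mult_left_mono) (auto simp: \<delta>_def)
  also have "\<dots> = K * \<rho> ^ j * (\<rho> + \<delta>) ^ Suc n" by (simp add: algebra_simps)
  finally show ?case by (simp add: \<delta>_def)
qed

lemma norm_pw_le_geometric:
  assumes "\<And>x. \<bar>ev h x\<bar> \<le> \<rho>" "\<rho> < 1"
  obtains K \<theta> where "0 < \<theta>" "\<theta> < 1" "\<And>n. norm (pw h n) \<le> K * \<theta> ^ n"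
proof -
  \<comment> \<open>The gap up to 1 is cut into four: one part for the supremum norm of the
    approximating polynomial, one for passing to its Sobolev norm, one for returning to h, and one
    is left over.\<close>
  define e where "e = (1 - \<rho>) / 4"
  have \<rho>0: "0 \<le> \<rho>" using assms(1)[of undefined] by linarith
  have e: "e > 0" using assms by (simp add: e_def)
  have "h \<in> closure TP" unfolding blk_dense by simp
  moreover have "0 < e / (Z + Cm)" using e Z_nonneg Cm_ge_1 by simp
  ultimately obtain g where g: "g \<in> TP" "dist g h < e / (Z + Cm)"
    unfolding closure_approachable by blast
  have d: "norm (h - g) * (Z + Cm) \<le> e"
    using g(2) Z_nonneg Cm_ge_1 by (simp add: dist_norm norm_minus_commute field_simps)
  have d1: "Z * norm (h - g) \<le> e" and d2: "Cm * norm (h - g) \<le> e"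
  proof -
    have "0 \<le> Z * norm (h - g)" "0 \<le> Cm * norm (h - g)" using Z_nonneg Cm_ge_1 by auto
    then show "Z * norm (h - g) \<le> e" "Cm * norm (h - g) \<le> e"
      using d unfolding distrib_left mult.commute[of "norm (h - g)"] by linarith+
  qed
  have "\<bar>ev g x\<bar> \<le> \<rho> + e" for x
    using assms(1)[of x] abs_ev_le[of "h - g" x] d1 by simp
  then obtain K where K: "\<And>n. norm (pw g n) \<le> K * (\<rho> + 2 * e) ^ n"
    using norm_pw_TP_le[OF g(1), of "\<rho> + e" "\<rho> + 2 * e"] e by auto
  have K0: "K \<ge> 0" using order_trans[OF norm_ge_zero K[of 0]] by simp
  have "norm (pw h n) \<le> K * (\<rho> + 3 * e) ^ n" for n
  proof -
    have "norm (pw h n) \<le> K * (\<rho> + 2 * e + Cm * norm (h - g)) ^ n"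
      using norm_pw_perturb[OF K, of 0 h n] \<rho>0 e by simp
    also have "\<dots> \<le> K * (\<rho> + 3 * e) ^ n"
      using d2 \<rho>0 e K0 Cm_ge_1 by (intro mult_left_mono power_mono) auto
    finally show ?thesis .
  qed
  moreover have "\<rho> + 3 * e < 1" "0 < \<rho> + 3 * e" using assms(2) \<rho>0 e by (auto simp: e_def field_simps)
  ultimately show ?thesis using that by blast
qed

text \<open>A bound on the supremum norm below 1 already makes the powers of h decay geometrically
  in the Sobolev norm, so the logarithmic series converges in the algebra. A bound on the Sobolev
  norm of h would be too much to ask for.\<close>

lemma ex_log_near_one:
  assumes "\<And>x. \<bar>ev h x\<bar> \<le> \<rho>" "\<rho> < 1"
  shows "\<exists>a. \<forall>x. ev a x = ln (1 - ev h x)"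
proof -
  obtain K \<theta> where K: "0 < \<theta>" "\<theta> < 1" "\<And>n. norm (pw h n) \<le> K * \<theta> ^ n"
    using norm_pw_le_geometric[OF assms] by metis
  have K0: "K \<ge> 0" using order_trans[OF norm_ge_zero K(3)[of 0]] by simp
  have sm: "summable (\<lambda>n. (1 / real (n + 1)) *\<^sub>R pw h (Suc n))"
  proof (rule summable_norm_cancel, rule summable_comparison_test'[where N=0])
    show "summable (\<lambda>n. K * \<theta> ^ n)" using K by (intro summable_mult summable_geometric) auto
    fix n
    have "norm ((1 / real (n + 1)) *\<^sub>R pw h (Suc n)) \<le> 1 * norm (pw h (Suc n))"
      unfolding norm_scaleR by (intro mult_right_mono) auto
    also have "\<dots> \<le> K * \<theta> ^ Suc n" using K(3)[of "Suc n"] by simp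
    also have "\<dots> \<le> K * \<theta> ^ n" using K K0 by (intro mult_left_mono) (auto simp: mult_left_le_one_le)
    finally show "norm (norm ((1 / real (n + 1)) *\<^sub>R pw h (Suc n))) \<le> K * \<theta> ^ n" by simp
  qed
  have "ev (- (\<Sum>n. (1 / real (n + 1)) *\<^sub>R pw h (Suc n))) x = ln (1 - ev h x)" for x
  proof -
    have h: "\<bar>ev h x\<bar> < 1" using assms(1)[of x] assms(2) by linarith
    have "ev (\<Sum>n. (1 / real (n + 1)) *\<^sub>R pw h (Suc n)) x = (\<Sum>n. ev ((1 / real (n + 1)) *\<^sub>R pw h (Suc n)) x)"
      by (rule bounded_linear.suminf[OF bounded_linear_ev sm])
    moreover have "summable (\<lambda>n. ev ((1 / real (n + 1)) *\<^sub>R pw h (Suc n)) x)"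
      by (rule bounded_linear.summable[OF bounded_linear_ev sm])
    ultimately have "ev (- (\<Sum>n. (1 / real (n + 1)) *\<^sub>R pw h (Suc n))) x = (\<Sum>n. - ev ((1 / real (n + 1)) *\<^sub>R pw h (Suc n)) x)"
      by (simp add: suminf_minus)
    also have "\<dots> = (\<Sum>n. (-1)^n * (1 / real (n + 1)) * ((1 - ev h x) - 1)^(Suc n))"
      by (intro suminf_cong) (simp add: power_minus[of "ev h x"] field_simps)
    also have "\<dots> = ln (1 - ev h x)"
      by (rule ln_series[symmetric]) (use h in auto)
    finally show ?thesis .
  qed
  then show ?thesis by blast
qed

lemma ev_positive_lower_bound:
  assumes "\<And>x. 0 < ev b x"
  obtains m where "0 < m" "\<And>x. m \<le> ev b x"
proof -
  have "compact (torus_cell :: (real^'d) set)" "(torus_cell :: (real^'d) set) \<noteq> {}"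
    using ex_torus_cell by (auto simp: torus_cell_def compact_cbox)
  from continuous_attains_inf[OF this continuous_ev[of _ b]]
  obtain y where y: "\<And>x. x \<in> torus_cell \<Longrightarrow> ev b y \<le> ev b x" by blast
  have "ev b y \<le> ev b x" for x
    using ex_torus_cell[of x] y circle_map_eqD[OF torus_periodic_ev[of b]] by metis
  then show ?thesis using that assms by blast
qed

text \<open>Dividing by an upper bound M gives b / M = 1 - h with h between 0 and 1 - m / M, where m
  > 0 is a lower bound supplied by compactness. The constant ln M is added back.\<close>

lemma ex_log:
  assumes "\<And>x. 0 < ev b x"
  obtains a where "\<And>x. ev a x = ln (ev b x)"
proof -
  obtain m where m: "0 < m" "\<And>x. m \<le> ev b x" using ev_positive_lower_bound[OF assms] by metis
  define M where "M = Z * norm b + 1"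
  have M: "ev b x < M" "M > 0" for x using abs_ev_le[of b x] assms[of x] Z_nonneg by (auto simp: M_def intro: add_nonneg_pos)
  have "\<bar>ev (cst 1 - (1 / M) *\<^sub>R b) x\<bar> \<le> 1 - m / M" for x
  proof -
    have "m / M \<le> ev b x / M" "ev b x / M \<le> 1"
      using m(2)[of x] M(1)[of x] M(2) by (simp_all add: divide_right_mono)
    then show ?thesis using m(1) M(2) by (simp add: abs_le_iff)
  qed
  moreover have "1 - m / M < 1" using m M(2) by simp
  ultimately obtain a where a: "\<And>x. ev a x = ln (1 - ev (cst 1 - (1 / M) *\<^sub>R b) x)"
    using ex_log_near_one[of "cst 1 - (1 / M) *\<^sub>R b" "1 - m / M"] by blast
  have "ev (a + cst (ln M)) x = ln (ev b x)" for x
    using M(2) assms[of x] by (simp add: a ln_div)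
  then show ?thesis using that by blast
qed

end

section \<open>Fourier multipliers\<close>

text \<open>Modulus at most 1 makes the multiplier a contraction on every Sobolev space; the
  symmetry keeps real functions real.\<close>

definition contr :: "('k::ab_group_add \<Rightarrow> complex) \<Rightarrow> bool" where
  "contr m \<longleftrightarrow> (\<forall>k. cmod (m k) \<le> 1 \<and> m (- k) = cnj (m k))"

definition mop :: "('k::ab_group_add \<Rightarrow> complex) \<Rightarrow> 'k hl2 \<Rightarrow> 'k hl2" where
  "mop m a = (SOME b. (\<forall>k. coef b k = m k * coef a k) \<and> norm b \<le> norm a)"

lemma
  assumes "contr m"
  shows coef_mop [simp]: "coef (mop m a) k = m k * coef a k" and norm_mop_le: "norm (mop m a) \<le> norm a"
proof -
  have "L2_set (\<lambda>k. cmod (m k * coef a k)) F \<le> norm a" if "finite F" for F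
    by (rule order_trans[OF L2_set_mono L2_set_coef_le_norm[OF that]])
      (use assms in \<open>auto simp: contr_def norm_mult intro: mult_left_le_one_le\<close>)
  then obtain b where "\<And>k. coef b k = m k * coef a k" "norm b \<le> norm a"
    using ex_hl2[of "\<lambda>k. m k * coef a k" "norm a"] assms by (auto simp: contr_def coef_uminus)
  then have "\<exists>b. (\<forall>k. coef b k = m k * coef a k) \<and> norm b \<le> norm a" by blast
  from someI_ex[OF this] show "coef (mop m a) k = m k * coef a k" "norm (mop m a) \<le> norm a"
    unfolding mop_def by auto
qed

lemma bounded_linear_mop:
  assumes "contr m" shows "bounded_linear (mop m)"
  by (rule bounded_linear_intro[of _ 1])
    (auto intro!: hl2_eqI simp: assms norm_mop_le algebra_simps)

text \<open>Pointwise convergence of the symbols gives strong convergence of the operators: finitely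
  many coefficients converge, and the remaining ones are uniformly small because the symbols are
  bounded.\<close>

lemma mop_tendsto:
  fixes m :: "'n \<Rightarrow> 'k::ab_group_add \<Rightarrow> complex"
  assumes m: "\<And>n. contr (m n)" and m': "contr m'" and lim: "\<And>k. ((\<lambda>n. m n k) \<longlongrightarrow> m' k) F"
  shows "((\<lambda>n. mop (m n) a) \<longlongrightarrow> mop m' a) F"
proof (rule tendstoI)
  fix e :: real assume e: "e > 0"
  define q where "q k = (cmod (coef a k))\<^sup>2" for k
  have q: "q summable_on UNIV" unfolding q_def by (rule coef_summable)
  \<comment> \<open>Two symbols differ by at most 2, so the tail contributes at most 4 times e^2/16;
    with e^2/4 from the finite part this stays below e^2.\<close>
  obtain F0 where F0: "finite F0" "norm (sum q F0 - infsum q UNIV) \<le> e\<^sup>2/16"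
    using infsum_finite_approximation[OF q, of "e\<^sup>2/16"] e by (auto simp: dist_norm)
  have tail: "sum q G \<le> e\<^sup>2/16" if "finite G" "G \<inter> F0 = {}" for G
  proof -
    have "sum q F0 + sum q G = sum q (F0 \<union> G)"
      using that F0 by (subst sum.union_disjoint) auto
    also have "\<dots> \<le> infsum q UNIV" by (rule finite_sum_le_infsum[OF q]) (use that F0 in \<open>auto simp: q_def\<close>)
    finally show ?thesis using F0(2) unfolding real_norm_def by linarith
  qed
  define r where "r n k = (cmod (m n k - m' k))\<^sup>2 * q k" for n k
  have "((\<lambda>n. \<Sum>k\<in>F0. r n k) \<longlongrightarrow> (\<Sum>k\<in>F0. (cmod (m' k - m' k))\<^sup>2 * q k)) F"
    unfolding r_def by (intro tendsto_intros lim)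
  then have "\<forall>\<^sub>F n in F. (\<Sum>k\<in>F0. r n k) < e\<^sup>2/4"
    using e by (intro order_tendstoD) auto
  then show "\<forall>\<^sub>F n in F. dist (mop (m n) a) (mop m' a) < e"
  proof eventually_elim
    case (elim n)
    have r4: "r n k \<le> 4 * q k" for k
    proof -
      have "cmod (m n k - m' k) \<le> cmod (m n k) + cmod (m' k)" by (rule norm_triangle_ineq4)
      also have "\<dots> \<le> 1 + 1" using m[of n] m' by (intro add_mono) (auto simp: contr_def)
      finally have "(cmod (m n k - m' k))\<^sup>2 \<le> 2\<^sup>2" by (intro power_mono) simp_all
      then show ?thesis unfolding r_def by (intro mult_right_mono) (auto simp: q_def)
    qed
    have r0: "r n k \<ge> 0" for k by (simp add: r_def q_def)
    have "norm (mop (m n) a - mop m' a) \<le> sqrt (e\<^sup>2/2)"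
    proof (rule norm_hl2_le)
      fix G :: "'k set" assume G: "finite G"
      have "(\<Sum>k\<in>G. (cmod (coef (mop (m n) a - mop m' a) k))\<^sup>2) = (\<Sum>k\<in>G. r n k)"
        by (simp add: m m' r_def q_def power_mult_distrib norm_mult flip: left_diff_distrib)
      also have "\<dots> = (\<Sum>k\<in>G \<inter> F0. r n k) + (\<Sum>k\<in>G - F0. r n k)"
        using G by (subst sum.union_disjoint[symmetric]) (auto intro!: sum.cong)
      also have "(\<Sum>k\<in>G \<inter> F0. r n k) \<le> (\<Sum>k\<in>F0. r n k)"
        by (rule sum_mono2) (use F0 r0 in auto)
      also have "(\<Sum>k\<in>G - F0. r n k) \<le> (\<Sum>k\<in>G - F0. 4 * q k)" by (intro sum_mono r4)
      also have "\<dots> = 4 * sum q (G - F0)" by (simp add: sum_distrib_left)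
      also have "sum q (G - F0) \<le> e\<^sup>2/16" by (rule tail) (use G in auto)
      finally have "(\<Sum>k\<in>G. (cmod (coef (mop (m n) a - mop m' a) k))\<^sup>2) \<le> e\<^sup>2/2"
        using elim by simp
      then show "L2_set (\<lambda>k. cmod (coef (mop (m n) a - mop m' a) k)) G \<le> sqrt (e\<^sup>2/2)"
        unfolding L2_set_def by simp
    qed
    also have "\<dots> < e" using e by (simp add: real_sqrt_divide field_simps)
    finally show ?case by (simp add: dist_norm)
  qed
qed

text \<open>The semigroup generated by the sum of the second derivatives in the directions of
  \<open>A\<close> only.\<close>

definition heat_on :: "'d set \<Rightarrow> real \<Rightarrow> (int^'d::finite) hl2 \<Rightarrow> (int^'d) hl2" where
  "heat_on A t = mop (\<lambda>k. of_real (exp (- t * (\<Sum>i\<in>A. (of_int (k $ i))\<^sup>2))))"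

abbreviation heatop :: "real \<Rightarrow> (int^'d::finite) hl2 \<Rightarrow> (int^'d) hl2" where
  "heatop \<equiv> heat_on UNIV"

definition transl :: "'d \<Rightarrow> real \<Rightarrow> (int^'d::finite) hl2 \<Rightarrow> (int^'d) hl2" where
  "transl i h = mop (\<lambda>k. cis (of_int (k $ i) * h))"

lemma contr_heat: "0 \<le> t \<Longrightarrow> contr (\<lambda>k::int^'d::finite. of_real (exp (- t * (\<Sum>i\<in>A. (of_int (k $ i))\<^sup>2))))"
  by (auto simp: contr_def sum_nonneg)

lemma contr_cis: "contr (\<lambda>k::int^'d::finite. cis (of_int (k $ i) * h))"
  by (auto simp: contr_def cis_cnj)

lemma coef_transl [simp]: "coef (transl i h a) k = cis (of_int (k $ i) * h) * coef a k"
  unfolding transl_def by (rule coef_mop[OF contr_cis])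

lemma coef_heat_on [simp]:
  "0 \<le> t \<Longrightarrow> coef (heat_on A t a) k = of_real (exp (- t * (\<Sum>i\<in>A. (of_int (k $ i))\<^sup>2))) * coef a k"
  unfolding heat_on_def by (rule coef_mop[OF contr_heat])

lemma bounded_linear_heat_on: "0 \<le> t \<Longrightarrow> bounded_linear (heat_on A t)"
  unfolding heat_on_def by (intro bounded_linear_mop contr_heat)

lemma norm_heat_on_le: "0 \<le> t \<Longrightarrow> norm (heat_on A t a) \<le> norm a"
  unfolding heat_on_def by (intro norm_mop_le contr_heat)

lemma norm_transl_le: "norm (transl i h a) \<le> norm a"
  unfolding transl_def by (intro norm_mop_le contr_cis)

lemma bounded_linear_transl: "bounded_linear (transl i h)"
  unfolding transl_def by (intro bounded_linear_mop contr_cis)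

lemma heat_on_add: "0 \<le> t \<Longrightarrow> 0 \<le> r \<Longrightarrow> heat_on A (t + r) a = heat_on A t (heat_on A r a)"
  by (rule hl2_eqI) (simp flip: exp_add of_real_mult add: algebra_simps)

lemma heat_on_0 [simp]: "heat_on A 0 a = a" "heat_on {} t a = a"
proof -
  have "contr (\<lambda>k::int^'d. of_real (exp (- t * (\<Sum>i\<in>{}. (of_int (k $ i))\<^sup>2))))" by (simp add: contr_def)
  from coef_mop[OF this] show "heat_on {} t a = a" unfolding heat_on_def by (intro hl2_eqI) simp
qed (rule hl2_eqI, simp)

lemma heat_on_insert:
  fixes i :: "'d::finite"
  shows "0 \<le> t \<Longrightarrow> i \<notin> A \<Longrightarrow> heat_on (insert i A) t a = heat_on {i} t (heat_on A t a)"
proof (rule hl2_eqI)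
  fix k :: "int^'d"
  assume t: "0 \<le> t" and i: "i \<notin> A"
  have "exp (- t * (\<Sum>j\<in>insert i A. (real_of_int (k $ j))\<^sup>2)) =
      exp (- t * (\<Sum>j\<in>{i}. (real_of_int (k $ j))\<^sup>2)) * exp (- t * (\<Sum>j\<in>A. (real_of_int (k $ j))\<^sup>2))"
    using i by (simp add: exp_add[symmetric] distrib_left)
  then show "coef (heat_on (insert i A) t a) k = coef (heat_on {i} t (heat_on A t a)) k"
    unfolding coef_heat_on[OF t] by (simp only: of_real_mult mult.assoc)
qed

lemma continuous_heat_on: "continuous_on {0..} (\<lambda>t. heat_on A t a)"
proof -
  \<comment> \<open>For negative t the symbol would not be a contraction; clamping at 0 allows a
    two-sided limit at every point.\<close>
  have "((\<lambda>t. heat_on A (max 0 t) a) \<longlongrightarrow> heat_on A (max 0 t0) a) (at t0)" for t0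
    unfolding heat_on_def by (rule mop_tendsto; (rule contr_heat)?) (auto intro!: tendsto_intros)
  then have "continuous_on UNIV (\<lambda>t. heat_on A (max 0 t) a)"
    by (simp add: continuous_on_eq_continuous_at isCont_def)
  then have "continuous_on {0..} (\<lambda>t. heat_on A (max 0 t) a)" by (rule continuous_on_subset) auto
  then show ?thesis by (rule continuous_on_eq) auto
qed

text \<open>Strong continuity in time is enough for joint continuity, since the operators are
  contractions and a change of the argument is not amplified.\<close>

lemma continuous_heat_on_joint:
  assumes f: "continuous_on S f" and g: "continuous_on S g" and f0: "\<And>x. x \<in> S \<Longrightarrow> 0 \<le> f x"
  shows "continuous_on S (\<lambda>x. heat_on A (f x) (g x))"
  unfolding continuous_on
proof
  fix x assume x: "x \<in> S"
  have "((\<lambda>y. norm (g y - g x) + norm (heat_on A (f y) (g x) - heat_on A (f x) (g x))) \<longlongrightarrow>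
     norm (g x - g x) + norm (heat_on A (f x) (g x) - heat_on A (f x) (g x))) (at x within S)"
  proof (intro tendsto_intros)
    show "(g \<longlongrightarrow> g x) (at x within S)" using g x by (simp add: continuous_on)
    have "continuous_on S (\<lambda>y. heat_on A (f y) (g x))"
      by (rule continuous_on_compose2[OF continuous_heat_on f]) (use f0 in auto)
    then show "((\<lambda>y. heat_on A (f y) (g x)) \<longlongrightarrow> heat_on A (f x) (g x)) (at x within S)"
      using x by (simp add: continuous_on)
  qed
  then have lim: "((\<lambda>y. norm (g y - g x) + norm (heat_on A (f y) (g x) - heat_on A (f x) (g x))) \<longlongrightarrow> 0) (at x within S)"
    by simp
  have le: "norm (heat_on A (f y) (g y) - heat_on A (f x) (g x)) \<le>
     norm (g y - g x) + norm (heat_on A (f y) (g x) - heat_on A (f x) (g x))" if "y \<in> S" for y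
  proof -
    have "heat_on A (f y) (g y) - heat_on A (f x) (g x) =
       heat_on A (f y) (g y - g x) + (heat_on A (f y) (g x) - heat_on A (f x) (g x))"
      by (simp add: linear_diff[OF bounded_linear.linear[OF bounded_linear_heat_on[OF f0[OF that]]]])
    then show ?thesis
      using norm_triangle_ineq[of "heat_on A (f y) (g y - g x)"] norm_heat_on_le[OF f0[OF that], of A "g y - g x"]
      by (smt (verit))
  qed
  show "((\<lambda>x. heat_on A (f x) (g x)) \<longlongrightarrow> heat_on A (f x) (g x)) (at x within S)"
    by (subst Lim_null, rule Lim_null_comparison[OF _ lim]) (use le in \<open>auto simp: eventually_at_filter\<close>)
qed

section \<open>Symmetric random walks\<close>

text \<open>Termwise comparison of power series. The series of exp (x^2) is spread over the even
  indices, where its coefficients 1 / (n div 2)! dominate 1 / n!.\<close>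

lemma cosh_le_exp_square: "cosh (x::real) \<le> exp (x\<^sup>2)"
proof -
  define f where "f n = (if even n then x ^ n /\<^sub>R fact n else 0)" for n
  define g where "g n = (if even n then x ^ n /\<^sub>R fact (n div 2) else 0)" for n
  have "(\<lambda>n. (x\<^sup>2) ^ n /\<^sub>R fact n) sums exp (x\<^sup>2)" by (rule exp_converges)
  then have "(\<lambda>n. g (2 * n)) sums exp (x\<^sup>2)" by (simp add: g_def power_mult)
  then have g: "g sums exp (x\<^sup>2)"
    by (subst (asm) sums_mono_reindex) (auto simp: strict_mono_def g_def elim!: evenE)
  show ?thesis
  proof (rule sums_le[OF _ _ g])
    show "f sums cosh x" unfolding f_def by (rule cosh_converges)
    show "f n \<le> g n" for n
    proof (cases "even n")
      case True
      then have "0 \<le> x ^ n" by (simp add: zero_le_power_eq)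
      then show ?thesis using True
        by (simp add: f_def g_def) (intro mult_right_mono le_imp_inverse_le fact_mono; simp)
    qed (simp add: f_def g_def)
  qed
qed

lemma walk_sum:
  fixes a b :: "'a::{comm_semiring_1}" and f :: "nat \<Rightarrow> 'a"
  assumes "\<And>j. j \<le> n \<Longrightarrow> f j = a ^ j * b ^ (n - j)"
  shows "(\<Sum>j\<le>n. of_nat (n choose j) * f j) = (a + b) ^ n"
  unfolding binomial_ring by (intro sum.cong) (auto simp: assms mult.assoc)

text \<open>The expectation of \<open>f (X\<^sub>1 + \<dots> + X\<^sub>n)\<close> for independent fair signs \<open>X\<^sub>i\<close>. With the scaling \<open>wstep\<close> the sum
  has variance 2, as the Gaussian kernel of \<open>e\<^sup>\<Delta>\<close> has.\<close>

definition walk_avg :: "nat \<Rightarrow> (real \<Rightarrow> 'a::real_vector) \<Rightarrow> 'a" where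
  "walk_avg n f = (\<Sum>j\<le>n. (real (n choose j) / 2 ^ n) *\<^sub>R f (2 * real j - real n))"

lemma walk_avg_exp: "walk_avg n (\<lambda>\<sigma>. exp (c * \<sigma>)) = (cosh c ^ n :: real)"
proof -
  have "(\<Sum>j\<le>n. of_nat (n choose j) * exp (c * (2 * real j - real n))) = (exp c + exp (- c)) ^ n"
  proof (rule walk_sum)
    fix j assume "j \<le> n"
    then show "exp (c * (2 * real j - real n)) = exp c ^ j * exp (- c) ^ (n - j)"
      by (simp flip: exp_of_nat_mult exp_add add: of_nat_diff algebra_simps)
  qed
  then show ?thesis
    unfolding walk_avg_def cosh_def
    by (simp add: sum_divide_distrib[symmetric] power_divide)
qed

lemma walk_avg_cis: "walk_avg n (\<lambda>\<sigma>. cis (c * \<sigma>)) = of_real (cos c ^ n)"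
proof -
  have "(\<Sum>j\<le>n. of_nat (n choose j) * cis (c * (2 * real j - real n))) = (cis c + cis (- c)) ^ n"
  proof (rule walk_sum)
    fix j assume "j \<le> n"
    then have "c * (2 * real j - real n) = real j * c + real (n - j) * (- c)"
      by (simp add: of_nat_diff algebra_simps)
    then show "cis (c * (2 * real j - real n)) = cis c ^ j * cis (- c) ^ (n - j)"
      by (simp only: Complex.DeMoivre cis_mult)
  qed
  also have "cis c + cis (- c) = 2 * of_real (cos c)" by (simp add: complex_eq_iff)
  finally show ?thesis
    unfolding walk_avg_def
    by (simp add: scaleR_conv_of_real sum_divide_distrib[symmetric] power_mult_distrib)
qed

text \<open>exp (c |x|) is dominated by exp (c x) + exp (- c x), and both averages are powers of
  cosh. If c is a fixed multiple of \<open>wstep n\<close>, then n c^2 is constant for n > 0 and the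
  bound is uniform in n.\<close>

lemma norm_walk_avg_le:
  assumes "\<And>\<sigma>. norm (f \<sigma>) \<le> B * exp (c * \<bar>\<sigma>\<bar>)" "0 \<le> B"
  shows "norm (walk_avg n f) \<le> B * (2 * exp (real n * c\<^sup>2))"
proof -
  have "norm (walk_avg n f) \<le> (\<Sum>j\<le>n. norm ((real (n choose j) / 2 ^ n) *\<^sub>R f (2 * real j - real n)))"
    unfolding walk_avg_def by (rule norm_sum)
  also have "\<dots> \<le> (\<Sum>j\<le>n. (real (n choose j) / 2 ^ n) *\<^sub>R (B * (exp (c * (2 * real j - real n)) + exp ((-c) * (2 * real j - real n)))))"
  proof (rule sum_mono)
    fix j
    have "exp (c * \<bar>x\<bar>) \<le> exp (c * x) + exp ((-c) * x)" for x :: real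
      by (cases "x \<ge> 0") auto
    then have "norm (f x) \<le> B * (exp (c * x) + exp ((-c) * x))" for x
      using assms by (meson mult_left_mono order_trans)
    then show "norm ((real (n choose j) / 2 ^ n) *\<^sub>R f (2 * real j - real n)) \<le>
      (real (n choose j) / 2 ^ n) *\<^sub>R (B * (exp (c * (2 * real j - real n)) + exp ((-c) * (2 * real j - real n))))"
      by (simp add: mult_left_mono divide_right_mono)
  qed
  also have "\<dots> = B * (walk_avg n (\<lambda>\<sigma>. exp (c * \<sigma>)) + walk_avg n (\<lambda>\<sigma>. exp ((-c) * \<sigma>)))"
    unfolding walk_avg_def by (simp add: sum.distrib sum_distrib_left algebra_simps add_divide_distrib)
  also have "\<dots> = B * (2 * cosh c ^ n)" unfolding walk_avg_exp by simp
  also have "\<dots> \<le> B * (2 * exp (c\<^sup>2) ^ n)"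
    using assms(2) by (intro mult_left_mono power_mono cosh_le_exp_square) auto
  finally show ?thesis by (simp add: exp_of_nat_mult)
qed

lemma walk_avg_linear: "linear g \<Longrightarrow> g (walk_avg n f) = walk_avg n (\<lambda>\<sigma>. g (f \<sigma>))"
  by (simp add: walk_avg_def linear_sum linear_scale)

lemma walk_avg_diff: "walk_avg n (\<lambda>\<sigma>. f \<sigma> - g \<sigma>) = walk_avg n f - walk_avg n g"
  by (simp add: walk_avg_def sum_subtractf scaleR_diff_right)

definition wstep :: "nat \<Rightarrow> real" where "wstep n = sqrt (2 / real n)"

text \<open>By the quadratic remainder of the logarithm, n ln (1 + y / n) differs from y by at most
  2 y^2 / n.\<close>

lemma tendsto_one_plus_over_n_power:
  assumes "y \<longlonglongrightarrow> (L::real)"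
  shows "(\<lambda>n. (1 + y n / real n) ^ n) \<longlonglongrightarrow> exp L"
proof -
  have y0: "(\<lambda>n. y n / real n) \<longlonglongrightarrow> 0"
    using tendsto_mult[OF assms lim_inverse_n] by (simp add: divide_inverse)
  have "(\<lambda>n. 2 * (y n * (y n / real n))) \<longlonglongrightarrow> 2 * (L * 0)"
    by (intro tendsto_intros assms y0)
  then have "(\<lambda>n. real n * ln (1 + y n / real n) - y n) \<longlonglongrightarrow> 0"
  proof (rule Lim_null_comparison[rotated, OF tendsto_eq_rhs])
    have "\<forall>\<^sub>F n in sequentially. \<bar>y n / real n\<bar> < 1/2"
      using tendstoD[OF y0, of "1/2"] by simp
    then show "\<forall>\<^sub>F n in sequentially. norm (real n * ln (1 + y n / real n) - y n) \<le> 2 * (y n * (y n / real n))"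
      using eventually_gt_at_top[of 0]
    proof eventually_elim
      case (elim n)
      have "\<bar>ln (1 + y n / real n) - y n / real n\<bar> \<le> 2 * (y n / real n)\<^sup>2"
        using elim by (intro abs_ln_one_plus_x_minus_x_bound) auto
      then have "real n * \<bar>ln (1 + y n / real n) - y n / real n\<bar> \<le> real n * (2 * (y n / real n)\<^sup>2)"
        by (intro mult_left_mono) auto
      moreover have "real n * ln (1 + y n / real n) - y n = real n * (ln (1 + y n / real n) - y n / real n)"
        using elim by (simp add: algebra_simps)
      ultimately show ?case using elim by (simp add: abs_mult power2_eq_square)
    qed
  qed simp
  from tendsto_add[OF this assms] have "(\<lambda>n. real n * ln (1 + y n / real n)) \<longlonglongrightarrow> L" by simp
  then have "(\<lambda>n. exp (real n * ln (1 + y n / real n))) \<longlonglongrightarrow> exp L" by (intro tendsto_intros)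
  moreover have "\<forall>\<^sub>F n in sequentially. exp (real n * ln (1 + y n / real n)) = (1 + y n / real n) ^ n"
    using tendstoD[OF y0, of "1/2"]
  proof (rule eventually_mono)
    fix n assume "dist (y n / real n) 0 < 1/2"
    then have "0 < 1 + y n / real n" unfolding dist_real_def diff_zero abs_less_iff by linarith
    then show "exp (real n * ln (1 + y n / real n)) = (1 + y n / real n) ^ n" by (simp add: exp_of_nat_mult)
  qed simp
  ultimately show ?thesis by (rule Lim_transform_eventually)
qed

text \<open>For n > 0 the factor sqrt (2 n) is 2 / \<open>wstep n\<close>, so this is a difference
  quotient at 0. It is used for sin and sinh.\<close>

lemma tendsto_scaled_derivative:
  fixes f :: "real \<Rightarrow> real"
  assumes "DERIV f 0 :> 1" "f 0 = 0"
  shows "(\<lambda>n. sqrt (2 * real n) * f (x * wstep n / 2)) \<longlonglongrightarrow> x"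
proof (cases "x = 0")
  case False
  have w0: "wstep \<longlonglongrightarrow> 0"
    unfolding wstep_def divide_inverse by (rule tendsto_eq_intros lim_inverse_n | simp)+
  define z where "z n = x * wstep n / 2" for n
  have "(\<lambda>n. f (z n) / z n) \<longlonglongrightarrow> 1"
  proof (rule filterlim_compose[of "\<lambda>h. f h / h"])
    show "((\<lambda>h. f h / h) \<longlongrightarrow> 1) (at 0)" using assms by (simp add: DERIV_def)
    have "z \<longlonglongrightarrow> x * 0 / 2" unfolding z_def by (intro tendsto_intros w0) auto
    moreover have "\<forall>\<^sub>F n in sequentially. z n \<noteq> 0"
      using eventually_gt_at_top[of 0] by eventually_elim (use False in \<open>simp add: z_def wstep_def\<close>)
    ultimately show "filterlim z (at 0) sequentially" by (simp add: filterlim_at)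
  qed
  then have "(\<lambda>n. x * (f (z n) / z n)) \<longlonglongrightarrow> x * 1" by (intro tendsto_intros)
  moreover have "\<forall>\<^sub>F n in sequentially. x * (f (z n) / z n) = sqrt (2 * real n) * f (x * wstep n / 2)"
    using eventually_gt_at_top[of 0]
  proof eventually_elim
    case (elim n)
    have "sqrt (2 * real n) * wstep n = 2"
      using elim by (simp add: wstep_def flip: real_sqrt_mult)
    then have "sqrt (2 * real n) * z n = x" by (simp add: z_def mult.left_commute)
    moreover have "z n \<noteq> 0" using False elim by (simp add: z_def wstep_def)
    ultimately show ?case by (simp add: z_def[symmetric] field_simps)
  qed
  ultimately show ?thesis by (rule Lim_transform_eventually[THEN tendsto_eq_rhs]) simp
qed (simp add: assms)

lemma tendsto_cos_wstep: "(\<lambda>n. cos (x * wstep n) ^ n) \<longlonglongrightarrow> exp (- x\<^sup>2)"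
proof -
  \<comment> \<open>Chosen so that the half-angle formula cos t = 1 - 2 sin^2 (t/2) reads 1 + y n /
    n. The cosh case below is the same with sinh.\<close>
  define y where "y n = - (sqrt (2 * real n) * sin (x * wstep n / 2))\<^sup>2" for n
  have "y \<longlonglongrightarrow> - x\<^sup>2"
    unfolding y_def by (intro tendsto_intros tendsto_scaled_derivative) (auto intro!: derivative_eq_intros)
  from tendsto_one_plus_over_n_power[OF this]
  have "(\<lambda>n. (1 + y n / real n) ^ n) \<longlonglongrightarrow> exp (- x\<^sup>2)" .
  moreover have "\<forall>\<^sub>F n in sequentially. (1 + y n / real n) ^ n = cos (x * wstep n) ^ n"
    using eventually_gt_at_top[of 0]
  proof eventually_elim
    case (elim n)
    have "cos (x * wstep n) = 1 - 2 * (sin (x * wstep n / 2))\<^sup>2"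
      using cos_double_sin[of "x * wstep n / 2"] by simp
    then show ?case using elim by (simp add: y_def power_mult_distrib)
  qed
  ultimately show ?thesis by (rule Lim_transform_eventually)
qed

lemma tendsto_cosh_wstep: "(\<lambda>n. cosh (x * wstep n) ^ n) \<longlonglongrightarrow> exp (x\<^sup>2)"
proof -
  define y where "y n = (sqrt (2 * real n) * sinh (x * wstep n / 2))\<^sup>2" for n
  have "y \<longlonglongrightarrow> x\<^sup>2"
    unfolding y_def by (intro tendsto_intros tendsto_scaled_derivative) (auto intro!: derivative_eq_intros)
  from tendsto_one_plus_over_n_power[OF this]
  have "(\<lambda>n. (1 + y n / real n) ^ n) \<longlonglongrightarrow> exp (x\<^sup>2)" .
  moreover have "\<forall>\<^sub>F n in sequentially. (1 + y n / real n) ^ n = cosh (x * wstep n) ^ n"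
    using eventually_gt_at_top[of 0]
  proof eventually_elim
    case (elim n)
    have "cosh (x * wstep n) = 1 + 2 * (sinh (x * wstep n / 2))\<^sup>2"
      using cosh_double_cosh[of "x * wstep n / 2"] by (simp add: cosh_square_eq)
    then show ?case using elim by (simp add: y_def power_mult_distrib)
  qed
  ultimately show ?thesis by (rule Lim_transform_eventually)
qed

text \<open>The central limit theorem on the Fourier side: averaging translations over the walk
  multiplies the k-th coefficient by the n-th power of a cosine, which tends to the Gaussian symbol
  of the heat semigroup.\<close>

lemma tendsto_walk_heat:
  assumes t: "0 \<le> t"
  shows "(\<lambda>n. walk_avg n (\<lambda>\<sigma>. transl i (sqrt t * wstep n * \<sigma>) a)) \<longlonglongrightarrow> heat_on {i} t a"
proof -
  define m where "m n k = complex_of_real (cos (of_int (k $ i) * sqrt t * wstep n) ^ n)" for n and k :: "int^'a"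
  have m: "contr (m n)" for n
    by (auto simp: contr_def m_def norm_power intro!: power_le_one)
  have "walk_avg n (\<lambda>\<sigma>. transl i (sqrt t * wstep n * \<sigma>) a) = mop (m n) a" for n
  proof (rule hl2_eqI)
    fix k
    have "coef (walk_avg n (\<lambda>\<sigma>. transl i (sqrt t * wstep n * \<sigma>) a)) k =
      walk_avg n (\<lambda>\<sigma>. coef (transl i (sqrt t * wstep n * \<sigma>) a) k)"
      by (rule walk_avg_linear[OF bounded_linear.linear[OF bounded_linear_coef]])
    also have "\<dots> = walk_avg n (\<lambda>\<sigma>. cis (of_int (k $ i) * sqrt t * wstep n * \<sigma>) * coef a k)"
      by (simp add: mult_ac)
    also have "\<dots> = walk_avg n (\<lambda>\<sigma>. cis (of_int (k $ i) * sqrt t * wstep n * \<sigma>)) * coef a k"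
      by (rule walk_avg_linear[symmetric]) (rule bounded_linear.linear[OF bounded_linear_mult_left])
    also have "\<dots> = coef (mop (m n) a) k" unfolding walk_avg_cis by (simp add: m m_def)
    finally show "coef (walk_avg n (\<lambda>\<sigma>. transl i (sqrt t * wstep n * \<sigma>) a)) k = coef (mop (m n) a) k" .
  qed
  moreover have "(\<lambda>n. mop (m n) a) \<longlonglongrightarrow> heat_on {i} t a"
    unfolding heat_on_def
  proof (rule mop_tendsto[OF m contr_heat[OF t]])
    fix k
    have "(\<lambda>n. cos (of_int (k $ i) * sqrt t * wstep n) ^ n) \<longlonglongrightarrow> exp (- (of_int (k $ i) * sqrt t)\<^sup>2)"
      by (rule tendsto_cos_wstep)
    moreover have "- (of_int (k $ i) * sqrt t)\<^sup>2 = - t * (\<Sum>i\<in>{i}. (real_of_int (k $ i))\<^sup>2)"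
      using t by (simp add: power_mult_distrib)
    ultimately show "(\<lambda>n. m n k) \<longlonglongrightarrow> of_real (exp (- t * (\<Sum>i\<in>{i}. (of_int (k $ i))\<^sup>2)))"
      unfolding m_def by (intro tendsto_of_real) simp
  qed
  ultimately show ?thesis by simp
qed

section \<open>The conjugated heat semigroup\<close>

context sobolev begin

lemma ev_transl [simp]: "ev (transl i h a) x = ev a (x + axis i h)"
proof -
  have "evc (transl i h a) x = evc a (x + axis i h)"
    unfolding evc_def by (intro infsum_cong) (simp add: fc_def cis_mult[symmetric] mult_ac)
  then show ?thesis by (simp add: ev_def)
qed

text \<open>Lower semicontinuity of the Sobolev norm. A norm bound is also a uniform bound, so by
  dominated convergence pointwise limits carry over to Fourier coefficients and thence to finite
  sections of the norm.\<close>

lemma norm_le_pointwise_limit: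
  assumes b: "\<forall>\<^sub>F n in sequentially. norm (X n) \<le> B" and lim: "\<And>y. (\<lambda>n. ev (X n) y) \<longlonglongrightarrow> ev x y"
  shows "norm x \<le> B"
proof -
  obtain N where N: "\<And>n. N \<le> n \<Longrightarrow> norm (X n) \<le> B" using b by (auto simp: eventually_sequentially)
  define Y where "Y n = X (n + N)" for n
  have Y: "norm (Y n) \<le> B" for n using N by (simp add: Y_def)
  have ev: "(\<lambda>n. ev (Y n) y) \<longlonglongrightarrow> ev x y" for y
    unfolding Y_def by (rule LIMSEQ_ignore_initial_segment[OF lim])
  have fcl: "(\<lambda>n. fc (Y n) k) \<longlonglongrightarrow> fc x k" for k
  proof -
    let ?f = "\<lambda>a x. indicator torus_cell x *\<^sub>R (complex_of_real (ev a x) * cis (- freq_dot k x))"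
    have "(\<lambda>n. LINT y|lborel. ?f (Y n) y) \<longlonglongrightarrow> (LINT y|lborel. ?f x y)"
    proof (rule integral_dominated_convergence)
      have m: "?f a \<in> borel_measurable lborel" for a
        by (rule borel_measurable_integrable[OF set_integrable_torus[unfolded set_integrable_def]])
          (intro continuous_intros continuous_ev)
      show "?f x \<in> borel_measurable lborel" "\<And>n. ?f (Y n) \<in> borel_measurable lborel" by (rule m)+
      have "set_integrable lborel torus_cell (\<lambda>y::real^'d. Z * B)"
        by (rule set_integrable_torus) (rule continuous_on_const)
      then show "integrable lborel (\<lambda>y. indicator torus_cell (y::real^'d) * (Z * B))"
        by (simp add: set_integrable_def)
      show "AE y in lborel. (\<lambda>n. ?f (Y n) y) \<longlonglongrightarrow> ?f x y"
        by (intro AE_I2 tendsto_intros ev)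
      show "AE y in lborel. norm (?f (Y n) y) \<le> indicator torus_cell y * (Z * B)" for n
      proof (rule AE_I2)
        fix y
        have "\<bar>ev (Y n) y\<bar> \<le> Z * B"
          using abs_ev_le[of "Y n" y] mult_left_mono[OF Y Z_nonneg] by (rule order_trans)
        then show "norm (?f (Y n) y) \<le> indicator torus_cell y * (Z * B)"
          by (simp add: norm_mult indicator_def)
      qed
    qed
    then show ?thesis
      unfolding fourier_coeff_ev[symmetric] fourier_coeff_def set_lebesgue_integral_def
      by (intro tendsto_divide tendsto_const) auto
  qed
  show ?thesis
  proof (rule norm_hl2_le)
    fix F :: "(int^'d) set" assume F: "finite F"
    have "(\<lambda>n. L2_set (\<lambda>k. cmod (coef (Y n) k)) F) \<longlonglongrightarrow> L2_set (\<lambda>k. cmod (coef x k)) F"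
      unfolding L2_set_def coef_fc by (intro tendsto_intros fcl)
    then show "L2_set (\<lambda>k. cmod (coef x k)) F \<le> B"
      by (rule LIMSEQ_le_const2) (use L2_set_coef_le_norm[OF F] Y order_trans in blast)
  qed
qed

section \<open>Quantitative derivatives along the coordinate directions\<close>

definition Lip :: "'d \<Rightarrow> (int^'d) hl2 \<Rightarrow> bool" where
  "Lip i w \<longleftrightarrow> (\<exists>C\<ge>0. \<forall>h. norm (transl i h w - w) \<le> C * \<bar>h\<bar>)"

text \<open>The derivative in direction i, in the Sobolev norm and with a quadratic remainder for
  all h. After division by \<epsilon> with h of order \<epsilon>, this remainder is of order
  \<epsilon>, which yields a rate of convergence.\<close>

definition deriv_at :: "'d \<Rightarrow> (int^'d) hl2 \<Rightarrow> (int^'d) hl2 \<Rightarrow> bool" where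
  "deriv_at i \<phi> a \<longleftrightarrow> (\<exists>C\<ge>0. \<forall>h. norm (transl i h \<phi> - \<phi> - h *\<^sub>R a) \<le> C * h\<^sup>2)"

text \<open>Small h are handled by the remainder, where h^2 is at most |h|; for |h| > 1 the trivial
  bound by twice the norm of \<phi> suffices.\<close>

lemma deriv_at_imp_Lip: "deriv_at i \<phi> a \<Longrightarrow> Lip i \<phi>"
proof -
  assume "deriv_at i \<phi> a"
  then obtain C where C: "C \<ge> 0" "\<And>h. norm (transl i h \<phi> - \<phi> - h *\<^sub>R a) \<le> C * h\<^sup>2"
    by (auto simp: deriv_at_def)
  have "norm (transl i h \<phi> - \<phi>) \<le> (C + norm a + 2 * norm \<phi>) * \<bar>h\<bar>" for h
  proof (cases "\<bar>h\<bar> \<le> 1")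
    case True
    have "norm (transl i h \<phi> - \<phi>) \<le> norm (transl i h \<phi> - \<phi> - h *\<^sub>R a) + norm (h *\<^sub>R a)"
      using norm_triangle_ineq[of "transl i h \<phi> - \<phi> - h *\<^sub>R a" "h *\<^sub>R a"] by simp
    also have "\<dots> \<le> C * h\<^sup>2 + \<bar>h\<bar> * norm a" using C(2)[of h] by simp
    also have "\<dots> \<le> C * \<bar>h\<bar> + \<bar>h\<bar> * norm a"
    proof -
      have "h\<^sup>2 \<le> \<bar>h\<bar>" using True by (metis abs_ge_zero mult_left_le power2_abs power2_eq_square)
      then show ?thesis using C(1) by (simp add: mult_left_mono)
    qed
    also have "\<dots> \<le> (C + norm a + 2 * norm \<phi>) * \<bar>h\<bar>" by (simp add: algebra_simps)
    finally show ?thesis .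
  next
    case False
    have "norm (transl i h \<phi> - \<phi>) \<le> 2 * norm \<phi>"
      using norm_triangle_ineq4[of "transl i h \<phi>" \<phi>] norm_transl_le[of i h \<phi>] by linarith
    also have "\<dots> \<le> (2 * norm \<phi>) * \<bar>h\<bar>" using False by (simp add: mult_le_cancel_left1)
    also have "\<dots> \<le> (C + norm a + 2 * norm \<phi>) * \<bar>h\<bar>" using C(1) by (intro mult_right_mono) auto
    finally show ?thesis .
  qed
  then show ?thesis unfolding Lip_def using C(1) by (intro exI[of _ "C + norm a + 2 * norm \<phi>"]) auto
qed

lemma bounded_linear_blk: "bounded_linear (\<lambda>z. blk z k)"
proof (rule bounded_linear_intro[of _ "norm (blk 1 k) + norm (blk \<i> k)"])
  fix z y :: complex and r :: real
  show "blk (z + y) k = blk z k + blk y k" "blk (r *\<^sub>R z) k = r *\<^sub>R blk z k"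
    by (rule ev_inj; simp add: ev_blk algebra_simps)+
  have "blk z k = Re z *\<^sub>R blk 1 k + Im z *\<^sub>R blk \<i> k"
    by (rule ev_inj) (simp add: ev_blk)
  then have "norm (blk z k) \<le> \<bar>Re z\<bar> * norm (blk 1 k) + \<bar>Im z\<bar> * norm (blk \<i> k)"
    using norm_triangle_ineq[of "Re z *\<^sub>R blk 1 k" "Im z *\<^sub>R blk \<i> k"] by simp
  also have "\<dots> \<le> cmod z * norm (blk 1 k) + cmod z * norm (blk \<i> k)"
    by (intro add_mono mult_right_mono abs_Re_le_cmod abs_Im_le_cmod) auto
  finally show "norm (blk z k) \<le> norm z * (norm (blk 1 k) + norm (blk \<i> k))" by (simp add: algebra_simps)
qed

lemma transl_blk: "transl i h (blk z k) = blk (z * cis (of_int (k $ i) * h)) k"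
  by (rule ev_inj) (simp add: ev_blk cis_mult[symmetric] mult_ac)

lemma cmod_cis_minus_le: "cmod (cis \<theta> - 1 - \<i> * \<theta>) \<le> \<theta>\<^sup>2"
proof -
  have "\<bar>sin \<theta> - \<theta>\<bar> \<le> \<theta>\<^sup>2 / 2"
    using Maclaurin_sin_bound[of \<theta> 2] by (simp add: numeral_2_eq_2 sin_coeff_def)
  moreover have "\<bar>cos \<theta> - 1\<bar> \<le> \<theta>\<^sup>2 / 2"
  proof -
    have "\<bar>cos \<theta> - 1\<bar> = 2 * (sin (\<theta> / 2))\<^sup>2" using cos_double_sin[of "\<theta> / 2"] by simp
    also have "\<dots> \<le> 2 * (\<theta> / 2)\<^sup>2"
      using abs_sin_x_le_abs_x[of "\<theta> / 2"] by (simp only: abs_le_square_iff)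
    finally show ?thesis by (simp add: power_divide)
  qed
  ultimately show ?thesis using cmod_le[of "cis \<theta> - 1 - \<i> * \<theta>"] by simp
qed

lemma deriv_at_blk: "deriv_at i (blk z k) (blk (\<i> * of_int (k $ i) * z) k)"
proof -
  interpret bounded_linear "\<lambda>z. blk z k" by (rule bounded_linear_blk)
  obtain B where B: "B \<ge> 0" "\<And>z. norm (blk z k) \<le> norm z * B" using nonneg_bounded by blast
  have "norm (transl i h (blk z k) - blk z k - h *\<^sub>R blk (\<i> * of_int (k $ i) * z) k)
     \<le> (cmod z * (of_int (k $ i))\<^sup>2 * B) * h\<^sup>2" for h
  proof -
    have "transl i h (blk z k) - blk z k - h *\<^sub>R blk (\<i> * of_int (k $ i) * z) k =
      blk (z * (cis (of_int (k $ i) * h) - 1 - \<i> * (of_int (k $ i) * h))) k"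
      unfolding transl_blk diff[symmetric] scaleR[symmetric] by (simp add: algebra_simps scaleR_conv_of_real)
    also have "norm \<dots> \<le> (cmod z * (of_int (k $ i) * h)\<^sup>2) * B"
      using cmod_cis_minus_le[of "of_int (k $ i) * h"] B(1)
      by (intro order_trans[OF B(2)] mult_right_mono) (auto simp: norm_mult mult_left_mono)
    finally show ?thesis by (simp add: power_mult_distrib mult_ac)
  qed
  then show ?thesis unfolding deriv_at_def using B(1) by (intro exI[of _ "cmod z * (of_int (k $ i))\<^sup>2 * B"]) auto
qed

lemma deriv_at_add: "deriv_at i \<phi> a \<Longrightarrow> deriv_at i \<psi> b \<Longrightarrow> deriv_at i (\<phi> + \<psi>) (a + b)"
proof -
  assume "deriv_at i \<phi> a" "deriv_at i \<psi> b"
  then obtain C D where C: "C \<ge> 0" "\<And>h. norm (transl i h \<phi> - \<phi> - h *\<^sub>R a) \<le> C * h\<^sup>2"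
    and D: "D \<ge> 0" "\<And>h. norm (transl i h \<psi> - \<psi> - h *\<^sub>R b) \<le> D * h\<^sup>2" by (auto simp: deriv_at_def)
  have "norm (transl i h (\<phi> + \<psi>) - (\<phi> + \<psi>) - h *\<^sub>R (a + b)) \<le> (C + D) * h\<^sup>2" for h
  proof -
    have "transl i h (\<phi> + \<psi>) - (\<phi> + \<psi>) - h *\<^sub>R (a + b) = (transl i h \<phi> - \<phi> - h *\<^sub>R a) + (transl i h \<psi> - \<psi> - h *\<^sub>R b)"
      by (simp add: linear_add[OF bounded_linear.linear[OF bounded_linear_transl]] algebra_simps)
    then show ?thesis using norm_triangle_mono[OF C(2)[of h] D(2)[of h]] by (simp add: algebra_simps)
  qed
  then show ?thesis unfolding deriv_at_def using C D by (intro exI[of _ "C + D"]) auto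
qed

lemma deriv_at_scaleR: "deriv_at i \<phi> a \<Longrightarrow> deriv_at i (r *\<^sub>R \<phi>) (r *\<^sub>R a)"
proof -
  assume "deriv_at i \<phi> a"
  then obtain C where C: "C \<ge> 0" "\<And>h. norm (transl i h \<phi> - \<phi> - h *\<^sub>R a) \<le> C * h\<^sup>2"
    by (auto simp: deriv_at_def)
  have "norm (transl i h (r *\<^sub>R \<phi>) - r *\<^sub>R \<phi> - h *\<^sub>R (r *\<^sub>R a)) \<le> (\<bar>r\<bar> * C) * h\<^sup>2" for h
  proof -
    have "transl i h (r *\<^sub>R \<phi>) - r *\<^sub>R \<phi> - h *\<^sub>R (r *\<^sub>R a) = r *\<^sub>R (transl i h \<phi> - \<phi> - h *\<^sub>R a)"
      by (simp add: linear_scale[OF bounded_linear.linear[OF bounded_linear_transl]] algebra_simps)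
    then show ?thesis using mult_left_mono[OF C(2)[of h], of "\<bar>r\<bar>"] by (simp add: mult.assoc)
  qed
  then show ?thesis unfolding deriv_at_def using C by (intro exI[of _ "\<bar>r\<bar> * C"]) auto
qed

lemma deriv_at_cst: "deriv_at i (cst c) 0"
  using deriv_at_blk[of i "of_real c" 0]
    linear_0[OF bounded_linear.linear[OF bounded_linear_blk]] by (simp add: cst_def)

section \<open>Conjugation of the heat semigroup by exponentials\<close>

definition conj_heat :: "'d set \<Rightarrow> (int^'d) hl2 \<Rightarrow> real \<Rightarrow> real \<Rightarrow> (int^'d) hl2 \<Rightarrow> (int^'d) hl2" where
  "conj_heat A \<phi> \<epsilon> t w = E (- ((1 / \<epsilon>) *\<^sub>R \<phi>)) \<odot> heat_on A t (E ((1 / \<epsilon>) *\<^sub>R \<phi>) \<odot> w)"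

lemma bounded_linear_conj_heat: "0 \<le> t \<Longrightarrow> bounded_linear (conj_heat A \<phi> \<epsilon> t)"
  unfolding conj_heat_def
  by (intro bounded_linear_compose[OF mul.bounded_linear_right]
      bounded_linear_compose[OF bounded_linear_heat_on] mul.bounded_linear_right)

lemma E_cancel: "E a \<odot> (E (- a) \<odot> b) = b" "E (- a) \<odot> (E a \<odot> b) = b"
  by (simp_all add: mul_assoc[symmetric] E_inverse)

lemma conj_heat_insert: "0 \<le> t \<Longrightarrow> i \<notin> A \<Longrightarrow>
  conj_heat (insert i A) \<phi> \<epsilon> t w = conj_heat {i} \<phi> \<epsilon> t (conj_heat A \<phi> \<epsilon> t w)"
  unfolding conj_heat_def E_cancel using heat_on_insert[of t i A] by metis

text \<open>Under conjugation a translation becomes the same translation followed by multiplication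
  with the exponential of the increment of \<phi> over \<epsilon>. Only the increment occurs, so the
  factor 1 / \<epsilon> can be paid for by a step of order \<epsilon>.\<close>

lemma tendsto_walk_conj_heat:
  assumes t: "0 \<le> t"
  shows "(\<lambda>n. walk_avg n (\<lambda>\<sigma>. E ((1 / \<epsilon>) *\<^sub>R (transl i (sqrt t * wstep n * \<sigma>) \<phi> - \<phi>)) \<odot> transl i (sqrt t * wstep n * \<sigma>) w))
    \<longlonglongrightarrow> conj_heat {i} \<phi> \<epsilon> t w"
proof -
  let ?T = "\<lambda>n \<sigma>. transl i (sqrt t * wstep n * \<sigma>)"
  have "(\<lambda>n. E (- ((1 / \<epsilon>) *\<^sub>R \<phi>)) \<odot> walk_avg n (\<lambda>\<sigma>. ?T n \<sigma> (E ((1 / \<epsilon>) *\<^sub>R \<phi>) \<odot> w))) \<longlonglongrightarrow> conj_heat {i} \<phi> \<epsilon> t w"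
    unfolding conj_heat_def by (intro mul.tendsto tendsto_const tendsto_walk_heat t)
  moreover have "E (- ((1 / \<epsilon>) *\<^sub>R \<phi>)) \<odot> walk_avg n (\<lambda>\<sigma>. ?T n \<sigma> (E ((1 / \<epsilon>) *\<^sub>R \<phi>) \<odot> w)) =
      walk_avg n (\<lambda>\<sigma>. E ((1 / \<epsilon>) *\<^sub>R (?T n \<sigma> \<phi> - \<phi>)) \<odot> ?T n \<sigma> w)" for n
  proof -
    have "E (- ((1 / \<epsilon>) *\<^sub>R \<phi>)) \<odot> walk_avg n (\<lambda>\<sigma>. ?T n \<sigma> (E ((1 / \<epsilon>) *\<^sub>R \<phi>) \<odot> w)) =
       walk_avg n (\<lambda>\<sigma>. E (- ((1 / \<epsilon>) *\<^sub>R \<phi>)) \<odot> ?T n \<sigma> (E ((1 / \<epsilon>) *\<^sub>R \<phi>) \<odot> w))"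
      by (rule walk_avg_linear[OF bounded_linear.linear[OF mul.bounded_linear_right]])
    moreover have "E (- ((1 / \<epsilon>) *\<^sub>R \<phi>)) \<odot> ?T n \<sigma> (E ((1 / \<epsilon>) *\<^sub>R \<phi>) \<odot> w) = E ((1 / \<epsilon>) *\<^sub>R (?T n \<sigma> \<phi> - \<phi>)) \<odot> ?T n \<sigma> w" for \<sigma>
      by (rule ev_inj) (simp add: exp_add[symmetric] mult.assoc[symmetric] right_diff_distrib)
    ultimately show ?thesis by simp
  qed
  ultimately show ?thesis by simp
qed

lemma wstep_sq: "0 < n \<Longrightarrow> real n * (wstep n)\<^sup>2 = 2"
  by (simp add: wstep_def)

lemma wstep_nonneg: "0 \<le> wstep n"
  by (simp add: wstep_def)

text \<open>Since sqrt t is at most \<epsilon>, the exponent along the walk is at most C times the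
  rescaled walk position, independently of \<epsilon>. The exponential moments of the walk then give
  the bound; the 2 in the exponent of \<open>M\<close> is its variance.\<close>

lemma norm_conj_heat_single_le:
  assumes "Lip i \<phi>"
  obtains M where "0 \<le> M" "\<And>\<epsilon> t w. 0 < \<epsilon> \<Longrightarrow> 0 \<le> t \<Longrightarrow> t \<le> \<epsilon>\<^sup>2 \<Longrightarrow> norm (conj_heat {i} \<phi> \<epsilon> t w) \<le> M * norm w"
proof -
  obtain C where C: "C \<ge> 0" "\<And>h. norm (transl i h \<phi> - \<phi>) \<le> C * \<bar>h\<bar>" using assms by (auto simp: Lip_def)
  define M where "M = Cm * K1 * (2 * exp (2 * (Cm * C)\<^sup>2))"
  have "norm (conj_heat {i} \<phi> \<epsilon> t w) \<le> M * norm w" if \<epsilon>: "0 < \<epsilon>" and t: "0 \<le> t" "t \<le> \<epsilon>\<^sup>2" for \<epsilon> t w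
  proof -
    have st: "sqrt t \<le> \<epsilon>" using t \<epsilon> by (simp add: real_le_lsqrt)
    have "norm (walk_avg n (\<lambda>\<sigma>. E ((1 / \<epsilon>) *\<^sub>R (transl i (sqrt t * wstep n * \<sigma>) \<phi> - \<phi>)) \<odot> transl i (sqrt t * wstep n * \<sigma>) w)) \<le> M * norm w"
      if n: "0 < n" for n
    proof -
      have "norm (walk_avg n (\<lambda>\<sigma>. E ((1 / \<epsilon>) *\<^sub>R (transl i (sqrt t * wstep n * \<sigma>) \<phi> - \<phi>)) \<odot> transl i (sqrt t * wstep n * \<sigma>) w))
        \<le> (Cm * K1 * norm w) * (2 * exp (real n * (Cm * C * wstep n)\<^sup>2))"
      proof (rule norm_walk_avg_le)
        fix \<sigma> :: real
        have "norm ((1 / \<epsilon>) *\<^sub>R (transl i (sqrt t * wstep n * \<sigma>) \<phi> - \<phi>)) \<le> (1 / \<epsilon>) * (C * \<bar>sqrt t * wstep n * \<sigma>\<bar>)"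
          using C(2)[of "sqrt t * wstep n * \<sigma>"] \<epsilon> by (simp add: divide_right_mono)
        also have "\<dots> = (1 / \<epsilon>) * (C * (sqrt t * wstep n * \<bar>\<sigma>\<bar>))" using t wstep_nonneg by (simp add: abs_mult)
        also have "\<dots> \<le> (1 / \<epsilon>) * (C * (\<epsilon> * wstep n * \<bar>\<sigma>\<bar>))"
          using C \<epsilon> st wstep_nonneg by (intro mult_left_mono mult_right_mono) auto
        also have "\<dots> = C * wstep n * \<bar>\<sigma>\<bar>" using \<epsilon> by simp
        finally have le: "norm ((1 / \<epsilon>) *\<^sub>R (transl i (sqrt t * wstep n * \<sigma>) \<phi> - \<phi>)) \<le> C * wstep n * \<bar>\<sigma>\<bar>" .
        have "norm (E ((1 / \<epsilon>) *\<^sub>R (transl i (sqrt t * wstep n * \<sigma>) \<phi> - \<phi>)) \<odot> transl i (sqrt t * wstep n * \<sigma>) w)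
          \<le> Cm * K1 * exp (Cm * norm ((1 / \<epsilon>) *\<^sub>R (transl i (sqrt t * wstep n * \<sigma>) \<phi> - \<phi>))) * norm (transl i (sqrt t * wstep n * \<sigma>) w)"
          by (rule norm_E_mul_le)
        also have "\<dots> \<le> Cm * K1 * exp (Cm * (C * wstep n * \<bar>\<sigma>\<bar>)) * norm w"
          using Cm_ge_1 K1_ge_1 by (intro mult_mono norm_transl_le order_refl iffD2[OF exp_le_cancel_iff] mult_left_mono[OF le]) auto
        finally show "norm (E ((1 / \<epsilon>) *\<^sub>R (transl i (sqrt t * wstep n * \<sigma>) \<phi> - \<phi>)) \<odot> transl i (sqrt t * wstep n * \<sigma>) w)
          \<le> Cm * K1 * norm w * exp (Cm * C * wstep n * \<bar>\<sigma>\<bar>)" by (simp add: mult_ac)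
      qed (use Cm_ge_1 K1_ge_1 in auto)
      also have "real n * (Cm * C * wstep n)\<^sup>2 = (Cm * C)\<^sup>2 * (real n * (wstep n)\<^sup>2)" by (simp add: power_mult_distrib)
      also have "\<dots> = 2 * (Cm * C)\<^sup>2" using wstep_sq[OF n] by simp
      finally show ?thesis by (simp add: M_def mult_ac)
    qed
    then show ?thesis
      by (intro LIMSEQ_le_const2[OF tendsto_norm[OF tendsto_walk_conj_heat[OF t(1)]]] exI[of _ 1]) auto
  qed
  moreover have "M \<ge> 0" using Cm_ge_1 K1_ge_1 by (simp add: M_def)
  ultimately show ?thesis using that by blast
qed

lemma norm_E_diff_le:
  "norm (E x - E y) \<le> (Cm * K1)\<^sup>2 * norm (x - y) * exp (Cm * (norm y + norm (x - y)))"
proof -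
  have "E x - E y = E y \<odot> (E (x - y) - cst 1)"
    by (rule ev_inj) (simp add: right_diff_distrib flip: exp_add)
  then have "norm (E x - E y) \<le> Cm * K1 * exp (Cm * norm y) * norm (E (x - y) - cst 1)"
    using norm_E_mul_le by metis
  also have "\<dots> \<le> Cm * K1 * exp (Cm * norm y) * (Cm * K1 * norm (x - y) * exp (Cm * norm (x - y)))"
    using Cm_ge_1 K1_ge_1 by (intro mult_left_mono norm_E_minus_le) auto
  finally show ?thesis by (simp add: power2_eq_square exp_add distrib_left mult_ac)
qed

text \<open>On the level of the walk, the exponent is replaced by its linearisation and the shift of
  \<open>w\<close> is dropped. Both errors are of order \<epsilon>, up to exponential growth in the
  position, which the walk integrates.\<close>

lemma norm_conj_heat_single_diff_le:
  assumes \<phi>: "deriv_at i \<phi> a" and w: "Lip i w"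
  obtains D where "\<And>\<epsilon>. 0 < \<epsilon> \<Longrightarrow> norm (conj_heat {i} \<phi> \<epsilon> (\<epsilon>\<^sup>2) w - E (a \<odot> a) \<odot> w) \<le> D * \<epsilon>"
proof -
  obtain C1 where C1: "C1 \<ge> 0" "\<And>h. norm (transl i h \<phi> - \<phi> - h *\<^sub>R a) \<le> C1 * h\<^sup>2" using \<phi> by (auto simp: deriv_at_def)
  obtain C2 where C2: "C2 \<ge> 0" "\<And>h. norm (transl i h \<phi> - \<phi>) \<le> C2 * \<bar>h\<bar>" using deriv_at_imp_Lip[OF \<phi>] by (auto simp: Lip_def)
  obtain C3 where C3: "C3 \<ge> 0" "\<And>h. norm (transl i h w - w) \<le> C3 * \<bar>h\<bar>" using w by (auto simp: Lip_def)
  \<comment> \<open>Collects all growth rates in the position v. The summand 1 pays for the factors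
    |v| and v^2, which are at most exp |v| and 2 exp |v|.\<close>
  define c where "c = Cm * (2 * norm a + C2) + 1"
  define D0 where "D0 = Cm * (Cm * K1)\<^sup>2 * C1 * 2 * norm w + Cm * K1 * C3"
  define D where "D = D0 * (2 * exp (2 * c\<^sup>2))"
  have D0: "D0 \<ge> 0" using C1 C3 Cm_ge_1 K1_ge_1 by (simp add: D0_def)
  have "norm (conj_heat {i} \<phi> \<epsilon> (\<epsilon>\<^sup>2) w - E (a \<odot> a) \<odot> w) \<le> D * \<epsilon>" if \<epsilon>: "0 < \<epsilon>" for \<epsilon>
  proof -
    define F where "F n \<sigma> = E ((1 / \<epsilon>) *\<^sub>R (transl i (sqrt (\<epsilon>\<^sup>2) * wstep n * \<sigma>) \<phi> - \<phi>)) \<odot> transl i (sqrt (\<epsilon>\<^sup>2) * wstep n * \<sigma>) w" for n \<sigma>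
    define G where "G n \<sigma> = E ((wstep n * \<sigma>) *\<^sub>R a) \<odot> w" for n \<sigma>
    define X where "X n = walk_avg n (F n) - walk_avg n (G n)" for n
    \<comment> \<open>The averages of \<open>G\<close> are identified in the limit only pointwise,
      through powers of cosh, so the norm bound has to pass through a pointwise limit.\<close>
    show ?thesis
    proof (rule norm_le_pointwise_limit[of X])
      fix y
      have "(\<lambda>n. ev (walk_avg n (F n)) y) \<longlonglongrightarrow> ev (conj_heat {i} \<phi> \<epsilon> (\<epsilon>\<^sup>2) w) y"
        unfolding F_def by (intro bounded_linear.tendsto[OF bounded_linear_ev] tendsto_walk_conj_heat) auto
      moreover have "(\<lambda>n. ev (walk_avg n (G n)) y) \<longlonglongrightarrow> ev (E (a \<odot> a) \<odot> w) y"
      proof -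
        have "ev (walk_avg n (G n)) y = cosh (ev a y * wstep n) ^ n * ev w y" for n
        proof -
          have "ev (walk_avg n (G n)) y = walk_avg n (\<lambda>\<sigma>. ev (G n \<sigma>) y)"
            by (rule walk_avg_linear[OF bounded_linear.linear[OF bounded_linear_ev]])
          also have "\<dots> = walk_avg n (\<lambda>\<sigma>. exp (ev a y * wstep n * \<sigma>) * ev w y)"
            by (simp add: G_def mult_ac)
          also have "\<dots> = walk_avg n (\<lambda>\<sigma>. exp (ev a y * wstep n * \<sigma>)) * ev w y"
            by (rule walk_avg_linear[symmetric]) (rule bounded_linear.linear[OF bounded_linear_mult_left])
          finally show ?thesis unfolding walk_avg_exp .
        qed
        moreover have "(\<lambda>n. cosh (ev a y * wstep n) ^ n * ev w y) \<longlonglongrightarrow> exp ((ev a y)\<^sup>2) * ev w y"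
          by (intro tendsto_intros tendsto_cosh_wstep)
        ultimately show ?thesis by (simp add: power2_eq_square)
      qed
      ultimately show "(\<lambda>n. ev (X n) y) \<longlonglongrightarrow> ev (conj_heat {i} \<phi> \<epsilon> (\<epsilon>\<^sup>2) w - E (a \<odot> a) \<odot> w) y"
        unfolding X_def ev_simps by (intro tendsto_diff)
    next
      show "\<forall>\<^sub>F n in sequentially. norm (X n) \<le> D * \<epsilon>"
        using eventually_gt_at_top[of 0]
      proof eventually_elim
        case (elim n)
        have "norm (walk_avg n (\<lambda>\<sigma>. F n \<sigma> - G n \<sigma>)) \<le> (D0 * \<epsilon>) * (2 * exp (real n * (c * wstep n)\<^sup>2))"
        proof (rule norm_walk_avg_le)
          fix \<sigma> :: real
          \<comment> \<open>\<open>v\<close> is the position of the walk before scaling with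
            \<epsilon>, \<open>x\<close> the true exponent and \<open>y\<close> its
            linearisation.\<close>
          define v where "v = wstep n * \<sigma>"
          define T where "T = transl i (\<epsilon> * v)"
          define x where "x = (1 / \<epsilon>) *\<^sub>R (T \<phi> - \<phi>)"
          define y where "y = v *\<^sub>R a"
          have v: "\<bar>v\<bar> = wstep n * \<bar>\<sigma>\<bar>" using wstep_nonneg by (simp add: v_def abs_mult)
          have FG: "F n \<sigma> - G n \<sigma> = (E x - E y) \<odot> T w + E y \<odot> (T w - w)"
            using \<epsilon> unfolding F_def G_def x_def y_def T_def v_def
            by (simp add: mul.diff_left mul.diff_right mult.assoc)
          have "norm x \<le> C2 * \<bar>v\<bar>"
            using C2(2)[of "\<epsilon> * v"] \<epsilon> by (simp add: x_def T_def abs_mult divide_le_eq mult_ac)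
          then have nxy: "norm (x - y) \<le> (C2 + norm a) * \<bar>v\<bar>"
            using norm_triangle_ineq4[of x y] by (simp add: y_def algebra_simps)
          have "x - y = (1 / \<epsilon>) *\<^sub>R (T \<phi> - \<phi> - (\<epsilon> * v) *\<^sub>R a)"
            using \<epsilon> by (simp add: x_def y_def scaleR_diff_right)
          then have "norm (x - y) \<le> (1 / \<epsilon>) * (C1 * (\<epsilon> * v)\<^sup>2)"
            using C1(2)[of "\<epsilon> * v"] \<epsilon> by (simp add: T_def divide_right_mono)
          also have "\<dots> = C1 * \<epsilon> * v\<^sup>2" using \<epsilon> by (simp add: power2_eq_square)
          also have "\<dots> \<le> C1 * \<epsilon> * (2 * exp \<bar>v\<bar>)"
          proof -
            have "\<bar>v\<bar>\<^sup>2 / 2 \<le> exp \<bar>v\<bar>" using exp_lower_Taylor_quadratic[of "\<bar>v\<bar>"] by simp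
            then show ?thesis using C1 \<epsilon> by (intro mult_left_mono) auto
          qed
          finally have nxy2: "norm (x - y) \<le> C1 * \<epsilon> * (2 * exp \<bar>v\<bar>)" .
          have ny: "norm y = norm a * \<bar>v\<bar>" by (simp add: y_def)
          have e1: "Cm * (norm y + norm (x - y)) + \<bar>v\<bar> \<le> c * \<bar>v\<bar>"
          proof -
            have "Cm * (norm y + norm (x - y)) \<le> Cm * (norm a * \<bar>v\<bar> + (C2 + norm a) * \<bar>v\<bar>)"
              using Cm_ge_1 ny nxy by (intro mult_left_mono) auto
            then show ?thesis by (simp add: c_def algebra_simps)
          qed
          have "norm ((E x - E y) \<odot> T w) \<le> Cm * norm (E x - E y) * norm (T w)" by (rule norm_mul_le)
          also have "\<dots> \<le> Cm * ((Cm * K1)\<^sup>2 * norm (x - y) * exp (Cm * (norm y + norm (x - y)))) * norm w"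
            using Cm_ge_1 by (intro mult_mono norm_E_diff_le) (auto simp: T_def norm_transl_le)
          also have "\<dots> \<le> Cm * ((Cm * K1)\<^sup>2 * (C1 * \<epsilon> * (2 * exp \<bar>v\<bar>)) * exp (Cm * (norm y + norm (x - y)))) * norm w"
            using Cm_ge_1 nxy2 by (intro mult_right_mono mult_left_mono) auto
          also have "\<dots> = (Cm * (Cm * K1)\<^sup>2 * C1 * 2 * norm w) * \<epsilon> * exp (Cm * (norm y + norm (x - y)) + \<bar>v\<bar>)"
            by (simp add: exp_add mult_ac)
          also have "\<dots> \<le> (Cm * (Cm * K1)\<^sup>2 * C1 * 2 * norm w) * \<epsilon> * exp (c * \<bar>v\<bar>)"
            using Cm_ge_1 C1 \<epsilon> e1 by (intro mult_left_mono) auto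
          finally have t1: "norm ((E x - E y) \<odot> T w) \<le> (Cm * (Cm * K1)\<^sup>2 * C1 * 2 * norm w) * \<epsilon> * exp (c * \<bar>v\<bar>)" .
          have "norm (E y \<odot> (T w - w)) \<le> Cm * K1 * exp (Cm * norm y) * norm (T w - w)" by (rule norm_E_mul_le)
          also have "\<dots> \<le> Cm * K1 * exp (Cm * norm y) * (C3 * \<epsilon> * exp \<bar>v\<bar>)"
          proof -
            have "norm (T w - w) \<le> C3 * (\<epsilon> * \<bar>v\<bar>)" using C3(2)[of "\<epsilon> * v"] \<epsilon> by (simp add: T_def abs_mult)
            also have "\<dots> \<le> C3 * (\<epsilon> * exp \<bar>v\<bar>)"
              using C3 \<epsilon> exp_ge_add_one_self[of "\<bar>v\<bar>"] by (intro mult_left_mono) linarith+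
            finally show ?thesis using Cm_ge_1 K1_ge_1 by (intro mult_left_mono) (auto simp: mult_ac)
          qed
          also have "\<dots> = (Cm * K1 * C3) * \<epsilon> * exp (Cm * norm y + \<bar>v\<bar>)" by (simp add: exp_add mult_ac)
          also have "\<dots> \<le> (Cm * K1 * C3) * \<epsilon> * exp (c * \<bar>v\<bar>)"
          proof -
            have "Cm * norm y + \<bar>v\<bar> \<le> c * \<bar>v\<bar>"
            proof -
              have "Cm * norm y \<le> Cm * (norm y + norm (x - y))" using Cm_ge_1 by (intro mult_left_mono) auto
              then show ?thesis using e1 by linarith
            qed
            then show ?thesis using Cm_ge_1 K1_ge_1 C3 \<epsilon> by (intro mult_left_mono) auto
          qed
          finally have t2: "norm (E y \<odot> (T w - w)) \<le> (Cm * K1 * C3) * \<epsilon> * exp (c * \<bar>v\<bar>)" .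
          have "norm (F n \<sigma> - G n \<sigma>) \<le> D0 * \<epsilon> * exp (c * \<bar>v\<bar>)"
            unfolding FG D0_def using norm_triangle_mono[OF t1 t2] by (simp add: algebra_simps)
          then show "norm (F n \<sigma> - G n \<sigma>) \<le> D0 * \<epsilon> * exp (c * wstep n * \<bar>\<sigma>\<bar>)" by (simp add: v mult.assoc)
        qed (use D0 \<epsilon> in auto)
        also have "real n * (c * wstep n)\<^sup>2 = c\<^sup>2 * (real n * (wstep n)\<^sup>2)" by (simp add: power_mult_distrib)
        also have "\<dots> = 2 * c\<^sup>2" using wstep_sq[OF elim] by simp
        finally show ?case by (simp add: X_def walk_avg_diff D_def mult_ac)
      qed
    qed
  qed
  then show ?thesis using that by blast
qed

text \<open>Banach-Steinhaus: on blocks, which are Lipschitz under translation, there is a linear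
  rate, and the bound uniform in \<epsilon> extends the convergence to their closed span.\<close>

lemma conj_heat_single_tendsto:
  assumes \<phi>: "deriv_at i \<phi> a"
  shows "((\<lambda>\<epsilon>. conj_heat {i} \<phi> \<epsilon> (\<epsilon>\<^sup>2) w) \<longlongrightarrow> E (a \<odot> a) \<odot> w) (at_right 0)"
proof -
  obtain M where M: "0 \<le> M" "\<And>\<epsilon> t w. 0 < \<epsilon> \<Longrightarrow> 0 \<le> t \<Longrightarrow> t \<le> \<epsilon>\<^sup>2 \<Longrightarrow> norm (conj_heat {i} \<phi> \<epsilon> t w) \<le> M * norm w"
    using norm_conj_heat_single_le[OF deriv_at_imp_Lip[OF \<phi>]] by metis
  have lin: "linear (conj_heat {i} \<phi> \<epsilon> (\<epsilon>\<^sup>2))" for \<epsilon>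
    by (rule bounded_linear.linear[OF bounded_linear_conj_heat]) auto
  have pos: "\<forall>\<^sub>F \<epsilon>::real in at_right 0. 0 < \<epsilon>" by (simp add: eventually_at_filter)
  show ?thesis
  proof (induction w rule: blk_induct)
    case (blk z k)
    obtain D where D: "\<And>\<epsilon>. 0 < \<epsilon> \<Longrightarrow> norm (conj_heat {i} \<phi> \<epsilon> (\<epsilon>\<^sup>2) (blk z k) - E (a \<odot> a) \<odot> blk z k) \<le> D * \<epsilon>"
      using norm_conj_heat_single_diff_le[OF \<phi> deriv_at_imp_Lip[OF deriv_at_blk]] by blast
    have "((\<lambda>\<epsilon>. D * \<epsilon>) \<longlongrightarrow> D * 0) (at_right 0)" by (intro tendsto_intros)
    then have D0: "((\<lambda>\<epsilon>. D * \<epsilon>) \<longlongrightarrow> 0) (at_right 0)" by simp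
    have "((\<lambda>\<epsilon>. conj_heat {i} \<phi> \<epsilon> (\<epsilon>\<^sup>2) (blk z k) - E (a \<odot> a) \<odot> blk z k) \<longlongrightarrow> 0) (at_right 0)"
      by (rule Lim_null_comparison[OF eventually_mono[OF pos D] D0])
    then show ?case by (rule LIM_zero_cancel)
  next
    case zero
    show ?case using linear_0[OF lin] by (simp add: mul.zero_right)
  next
    case (add v w)
    from tendsto_add[OF this] show ?case by (simp add: linear_add[OF lin] mul.add_right)
  next
    case (scaleR r w)
    from tendsto_scaleR[OF tendsto_const this, of r] show ?case
      by (simp add: linear_scale[OF lin] mul.scaleR_right)
  next
    case closed
    have "((\<lambda>\<epsilon>. conj_heat {i} \<phi> \<epsilon> (\<epsilon>\<^sup>2) w) \<longlongrightarrow> E (a \<odot> a) \<odot> w) (at_right 0)"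
      if X: "\<And>n. ((\<lambda>\<epsilon>. conj_heat {i} \<phi> \<epsilon> (\<epsilon>\<^sup>2) (X n)) \<longlongrightarrow> E (a \<odot> a) \<odot> X n) (at_right 0)" and "X \<longlonglongrightarrow> w" for X w
    proof (rule tendstoI)
      fix e :: real assume e: "e > 0"
      define M' where "M' = M + Cm * norm (E (a \<odot> a)) + 1"
      have M': "M' > 0" using M(1) Cm_ge_1 by (simp add: M'_def add_nonneg_pos)
      have "0 < e / (3 * M')" using e M' by simp
      then obtain n where n: "norm (X n - w) < e / (3 * M')"
        using LIMSEQ_D[OF \<open>X \<longlonglongrightarrow> w\<close>] by blast
      then have nM: "M' * norm (X n - w) < e / 3" using M' by (simp add: field_simps)
      have "\<forall>\<^sub>F \<epsilon> in at_right 0. dist (conj_heat {i} \<phi> \<epsilon> (\<epsilon>\<^sup>2) (X n)) (E (a \<odot> a) \<odot> X n) < e / 3"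
        using tendstoD[OF X[of n], of "e/3"] e by simp
      with pos show "\<forall>\<^sub>F \<epsilon> in at_right 0. dist (conj_heat {i} \<phi> \<epsilon> (\<epsilon>\<^sup>2) w) (E (a \<odot> a) \<odot> w) < e"
      proof eventually_elim
        case (elim \<epsilon>)
        have "norm (conj_heat {i} \<phi> \<epsilon> (\<epsilon>\<^sup>2) (X n - w)) \<le> M * norm (X n - w)" using elim by (intro M) auto
        also have "\<dots> \<le> M' * norm (X n - w)" using Cm_ge_1 by (intro mult_right_mono) (auto simp: M'_def)
        finally have 1: "norm (conj_heat {i} \<phi> \<epsilon> (\<epsilon>\<^sup>2) (X n) - conj_heat {i} \<phi> \<epsilon> (\<epsilon>\<^sup>2) w) < e / 3"
          using nM by (simp add: linear_diff[OF lin])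
        have "norm (E (a \<odot> a) \<odot> (X n - w)) \<le> Cm * norm (E (a \<odot> a)) * norm (X n - w)" by (rule norm_mul_le)
        also have "\<dots> \<le> M' * norm (X n - w)" using M(1) by (intro mult_right_mono) (auto simp: M'_def)
        finally have 2: "norm (E (a \<odot> a) \<odot> X n - E (a \<odot> a) \<odot> w) < e / 3"
          using nM by (simp add: mul.diff_right)
        have 3: "norm (conj_heat {i} \<phi> \<epsilon> (\<epsilon>\<^sup>2) (X n) - E (a \<odot> a) \<odot> X n) < e / 3"
          using elim by (simp add: dist_norm)
        have "conj_heat {i} \<phi> \<epsilon> (\<epsilon>\<^sup>2) w - E (a \<odot> a) \<odot> w =
          - (conj_heat {i} \<phi> \<epsilon> (\<epsilon>\<^sup>2) (X n) - conj_heat {i} \<phi> \<epsilon> (\<epsilon>\<^sup>2) w) +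
          (conj_heat {i} \<phi> \<epsilon> (\<epsilon>\<^sup>2) (X n) - E (a \<odot> a) \<odot> X n) + (E (a \<odot> a) \<odot> X n - E (a \<odot> a) \<odot> w)"
          by simp
        then have "norm (conj_heat {i} \<phi> \<epsilon> (\<epsilon>\<^sup>2) w - E (a \<odot> a) \<odot> w) < e / 3 + e / 3 + e / 3"
          using norm_add_less[OF norm_add_less[OF _ 3] 2] 1 by (metis norm_minus_cancel)
        then show ?case by (simp add: dist_norm)
      qed
    qed
    then show ?case unfolding closed_sequential_limits by auto
  qed
qed

text \<open>Here \<open>conj_heat UNIV \<phi> \<epsilon> t\<close> is the heat semigroup at time \<open>t\<close> conjugated by \<open>exp (\<phi> / \<epsilon>)\<close>. For
  \<open>t = \<epsilon>\<^sup>2\<close> it averages, over a Gaussian \<open>N\<close> of variance 2, the multiplication by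
  \<open>exp ((\<phi>(x + \<epsilon>N) - \<phi>(x)) / \<epsilon>)\<close> followed by a shift by \<open>\<epsilon>N\<close>; the exponent tends to \<open>\<nabla>\<phi> \<bullet> N\<close>,
  whose exponential moment is \<open>exp \<bar>\<nabla>\<phi>\<bar>\<^sup>2\<close>. The coordinates of \<open>N\<close> are replaced one by one, which is
  the reason for the set \<open>A\<close>.\<close>

lemma
  assumes \<phi>: "\<And>i. deriv_at i \<phi> (a i)"
  shows norm_conj_heat_le: "\<exists>M\<ge>0. \<forall>\<epsilon> t w. 0 < \<epsilon> \<longrightarrow> 0 \<le> t \<longrightarrow> t \<le> \<epsilon>\<^sup>2 \<longrightarrow> norm (conj_heat A \<phi> \<epsilon> t w) \<le> M * norm w"
    and conj_heat_tendsto: "((\<lambda>\<epsilon>. conj_heat A \<phi> \<epsilon> (\<epsilon>\<^sup>2) w) \<longlongrightarrow> E (\<Sum>i\<in>A. a i \<odot> a i) \<odot> w) (at_right 0)"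
proof (induction A rule: infinite_finite_induct)
  case (infinite A)
  { case 1 show ?case using infinite by simp }
  { case 2 show ?case using infinite by simp }
next
  case empty
  have "conj_heat {} \<phi> \<epsilon> t w = w" for \<epsilon> t w by (simp add: conj_heat_def E_cancel)
  then show "\<exists>M\<ge>0. \<forall>\<epsilon> t w. 0 < \<epsilon> \<longrightarrow> 0 \<le> t \<longrightarrow> t \<le> \<epsilon>\<^sup>2 \<longrightarrow> norm (conj_heat {} \<phi> \<epsilon> t w) \<le> M * norm w"
    and "((\<lambda>\<epsilon>. conj_heat {} \<phi> \<epsilon> (\<epsilon>\<^sup>2) w) \<longlongrightarrow> E (\<Sum>i\<in>{}. a i \<odot> a i) \<odot> w) (at_right 0)"
    by (auto intro: exI[of _ 1] simp: E_0)
next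
  case (insert i A)
  obtain M where M: "M \<ge> 0" "\<And>\<epsilon> t w. 0 < \<epsilon> \<Longrightarrow> 0 \<le> t \<Longrightarrow> t \<le> \<epsilon>\<^sup>2 \<Longrightarrow> norm (conj_heat A \<phi> \<epsilon> t w) \<le> M * norm w"
    using insert.IH(1) by blast
  obtain N where N: "N \<ge> 0" "\<And>\<epsilon> t w. 0 < \<epsilon> \<Longrightarrow> 0 \<le> t \<Longrightarrow> t \<le> \<epsilon>\<^sup>2 \<Longrightarrow> norm (conj_heat {i} \<phi> \<epsilon> t w) \<le> N * norm w"
    using norm_conj_heat_single_le[OF deriv_at_imp_Lip[OF \<phi>]] by metis
  { case 1
    have "norm (conj_heat (insert i A) \<phi> \<epsilon> t w) \<le> (N * M) * norm w" if "0 < \<epsilon>" "0 \<le> t" "t \<le> \<epsilon>\<^sup>2" for \<epsilon> t w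
      using order_trans[OF N(2)[OF that] mult_left_mono[OF M(2)[OF that] N(1)]]
      by (simp only: conj_heat_insert[OF that(2) insert.hyps(2)] mult.assoc)
    then show ?case using M(1) N(1) by (intro exI[of _ "N * M"]) auto }
  { case 2
    define v where "v = E (\<Sum>i\<in>A. a i \<odot> a i) \<odot> w"
    \<comment> \<open>The inner factor is replaced by its limit \<open>v\<close>. The error passes
      through the outer operator, whose norm is bounded uniformly in \<epsilon>; what remains is the
      case of one direction.\<close>
    have "((\<lambda>\<epsilon>. conj_heat {i} \<phi> \<epsilon> (\<epsilon>\<^sup>2) (conj_heat A \<phi> \<epsilon> (\<epsilon>\<^sup>2) w - v)) \<longlongrightarrow> 0) (at_right 0)"
    proof (rule Lim_null_comparison)
      show "\<forall>\<^sub>F \<epsilon> in at_right 0. norm (conj_heat {i} \<phi> \<epsilon> (\<epsilon>\<^sup>2) (conj_heat A \<phi> \<epsilon> (\<epsilon>\<^sup>2) w - v)) \<le> N * norm (conj_heat A \<phi> \<epsilon> (\<epsilon>\<^sup>2) w - v)"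
        by (auto simp: eventually_at_filter intro!: always_eventually N)
      have "((\<lambda>\<epsilon>. N * norm (conj_heat A \<phi> \<epsilon> (\<epsilon>\<^sup>2) w - v)) \<longlongrightarrow> N * norm (v - v)) (at_right 0)"
        using insert.IH(2) unfolding v_def by (intro tendsto_intros)
      then show "((\<lambda>\<epsilon>. N * norm (conj_heat A \<phi> \<epsilon> (\<epsilon>\<^sup>2) w - v)) \<longlongrightarrow> 0) (at_right 0)" by simp
    qed
    from tendsto_add[OF this conj_heat_single_tendsto[OF \<phi>[of i], of v]]
    have "((\<lambda>\<epsilon>. conj_heat {i} \<phi> \<epsilon> (\<epsilon>\<^sup>2) (conj_heat A \<phi> \<epsilon> (\<epsilon>\<^sup>2) w)) \<longlongrightarrow> E (a i \<odot> a i) \<odot> v) (at_right 0)"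
      using linear_diff[OF bounded_linear.linear[OF bounded_linear_conj_heat[of "x\<^sup>2" "{i}" \<phi> x for x]]] by simp
    moreover have "E (a i \<odot> a i) \<odot> v = E (\<Sum>i\<in>insert i A. a i \<odot> a i) \<odot> w"
      using insert.hyps by (simp add: v_def E_add mul_assoc)
    ultimately show ?case by (simp only: conj_heat_insert[OF zero_le_power2 insert.hyps(2)]) }
qed

end

section \<open>Mild solutions near an approximate one\<close>

text \<open>The substitution r = t u makes the interval of integration independent of t, so that
  continuity of parameter integrals applies.\<close>

lemma continuous_on_Duhamel:
  fixes A :: "real \<Rightarrow> 'a::banach \<Rightarrow> 'a"
  assumes A: "continuous_on ({0..T} \<times> UNIV) (\<lambda>(t, x). A t x)" and f: "continuous_on {0..T} f"
  shows "continuous_on {0..T} (\<lambda>t. integral {0..t} (\<lambda>r. A (t - r) (f r)))"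
proof -
  have "continuous_on ({0..T} \<times> cbox 0 1) (\<lambda>(t, u). A (t * (1 - u)) (f (t * u)))"
  proof -
    have t: "t * (1 - u) \<in> {0..T}" "t * u \<in> {0..T}" if "t \<in> {0..T}" "u \<in> {0..1}" for t u :: real
      using that mult_left_le[of "1 - u" t] mult_left_le[of u t] by auto
    have "continuous_on ({0..T} \<times> cbox 0 1) (\<lambda>p. f (fst p * snd p))"
      by (rule continuous_on_compose2[OF f]) (use t in \<open>auto intro!: continuous_intros\<close>)
    then have "continuous_on ({0..T} \<times> cbox 0 1) (\<lambda>p. (fst p * (1 - snd p), f (fst p * snd p)))"
      by (intro continuous_intros)
    moreover have "(\<lambda>p. (fst p * (1 - snd p), f (fst p * snd p))) ` ({0..T} \<times> cbox 0 1) \<subseteq> {0..T} \<times> UNIV"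
      using t(1) by (intro image_subsetI) (simp only: mem_Times_iff fst_conv snd_conv cbox_interval UNIV_I simp_thms)
    ultimately have "continuous_on ({0..T} \<times> cbox 0 1) (\<lambda>p. case (fst p * (1 - snd p), f (fst p * snd p)) of (t, x) \<Rightarrow> A t x)"
      by (rule continuous_on_compose2[OF A])
    then show ?thesis by (simp add: case_prod_beta')
  qed
  from integral_continuous_on_param[OF this]
  have "continuous_on {0..T} (\<lambda>t. t *\<^sub>R integral {0..1} (\<lambda>u. A (t * (1 - u)) (f (t * u))))"
    by (intro continuous_intros) simp
  moreover have "t *\<^sub>R integral {0..1} (\<lambda>u. A (t * (1 - u)) (f (t * u))) = integral {0..t} (\<lambda>r. A (t - r) (f r))"
    if "t \<in> {0..T}" for t
  proof (cases "t = 0")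
    case False
    then have t: "t > 0" using that by simp
    have "continuous_on {0..t} (\<lambda>r. case (t - r, f r) of (t, x) \<Rightarrow> A t x)"
      by (rule continuous_on_compose2[OF A]) (use that in \<open>auto intro!: continuous_intros continuous_on_subset[OF f]\<close>)
    then have "(\<lambda>r. A (t - r) (f r)) integrable_on {0..t}"
      by (intro integrable_continuous_interval) simp
    then have "((\<lambda>r. A (t - r) (f r)) has_integral integral {0..t} (\<lambda>r. A (t - r) (f r))) (cbox 0 t)"
      by (simp add: integrable_integral)
    from has_integral_affinity'[OF this t, of 0]
    have "((\<lambda>u. A (t * (1 - u)) (f (t * u))) has_integral integral {0..t} (\<lambda>r. A (t - r) (f r)) /\<^sub>R t) {0..1}"
      using t by (simp add: right_diff_distrib)
    then show ?thesis using t by (simp add: integral_unique)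
  qed simp
  ultimately show ?thesis by (rule continuous_on_eq)
qed

lemma Duhamel_integrable:
  fixes A :: "real \<Rightarrow> 'a::banach \<Rightarrow> 'a"
  assumes A: "continuous_on ({0..T} \<times> UNIV) (\<lambda>(t, x). A t x)" and f: "continuous_on {0..T} f"
    and t: "t \<in> {0..T}"
  shows "continuous_on {0..t} (\<lambda>r. A (t - r) (f r))"
    and "(\<lambda>r. A (t - r) (f r)) integrable_on {0..t}"
proof -
  have "continuous_on {0..t} (\<lambda>r. case (t - r, f r) of (t, x) \<Rightarrow> A t x)"
    by (rule continuous_on_compose2[OF A]) (use t in \<open>auto intro!: continuous_intros continuous_on_subset[OF f]\<close>)
  then show c: "continuous_on {0..t} (\<lambda>r. A (t - r) (f r))" by simp
  show "(\<lambda>r. A (t - r) (f r)) integrable_on {0..t}" by (rule integrable_continuous_interval[OF c])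
qed

text \<open>Contraction in a tube of radius R around z. The Duhamel map has Lipschitz constant M L T
  \<le> 1/2 there, so the image of any curve in the tube is R/2-close to the image of z, and that is
  R/2-close to z by the defect. One statement serves for existence, for following an approximate
  path, and for dependence on the initial value.\<close>

lemma shadowing:
  fixes A :: "real \<Rightarrow> 'a::banach \<Rightarrow> 'a" and N :: "'a \<Rightarrow> 'a" and z :: "real \<Rightarrow> 'a"
  assumes T: "0 \<le> T" and R: "0 \<le> R" and L: "0 \<le> L" and M0: "0 \<le> M"
    and A: "continuous_on ({0..T} \<times> UNIV) (\<lambda>(t, x). A t x)"
    and lin: "\<And>t. t \<in> {0..T} \<Longrightarrow> linear (A t)"
    and M: "\<And>t x. t \<in> {0..T} \<Longrightarrow> norm (A t x) \<le> M * norm x"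
    and z: "continuous_on {0..T} z" and N: "continuous_on UNIV N"
    and Lip: "\<And>t a b. t \<in> {0..T} \<Longrightarrow> norm (a - z t) \<le> R \<Longrightarrow> norm (b - z t) \<le> R \<Longrightarrow> norm (N a - N b) \<le> L * norm (a - b)"
    and small: "M * L * T \<le> 1 / 2"
    and defect: "\<And>t. t \<in> {0..T} \<Longrightarrow> norm (A t w0 + integral {0..t} (\<lambda>r. A (t - r) (N (z r))) - z t) \<le> R / 2"
  obtains w where "continuous_on {0..T} w" "\<And>t. t \<in> {0..T} \<Longrightarrow> norm (w t - z t) \<le> R"
    "\<And>t. t \<in> {0..T} \<Longrightarrow> w t = A t w0 + integral {0..t} (\<lambda>r. A (t - r) (N (w r)))"
proof -
  \<comment> \<open>Clamping time to [0, T] turns curves on the interval into bounded continuous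
    functions on the line, which form a complete space.\<close>
  define cl where "cl t = max 0 (min T t)" for t
  have cl: "cl t \<in> {0..T}" "t \<in> {0..T} \<Longrightarrow> cl t = t" for t using T by (auto simp: cl_def)
  define P where "P g t = A t w0 + integral {0..t} (\<lambda>r. A (t - r) (N (g r)))" for g t
  have contP: "continuous_on {0..T} (P g)" if g: "continuous_on {0..T} g" for g
  proof -
    have "continuous_on {0..T} (\<lambda>t. case (t, w0) of (t, x) \<Rightarrow> A t x)"
      by (rule continuous_on_compose2[OF A]) (auto intro!: continuous_intros)
    moreover have "continuous_on {0..T} (\<lambda>r. N (g r))" by (rule continuous_on_compose2[OF N g]) simp
    ultimately show ?thesis unfolding P_def by (intro continuous_intros continuous_on_Duhamel[OF A]) auto
  qed
  have bc: "(\<lambda>t. g (cl t)) \<in> bcontfun" if g: "continuous_on {0..T} g" for g :: "real \<Rightarrow> 'a"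
  proof -
    have "continuous_on UNIV (\<lambda>t. g (cl t))"
      by (rule continuous_on_compose2[OF g]) (use cl in \<open>auto simp: cl_def[abs_def] intro!: continuous_intros\<close>)
    moreover have "range (\<lambda>t. g (cl t)) \<subseteq> g ` {0..T}" using cl by auto
    then have "bounded (range (\<lambda>t. g (cl t)))"
      using bounded_subset compact_imp_bounded[OF compact_continuous_image[OF g compact_Icc]] by blast
    ultimately show ?thesis by (simp add: bcontfun_def)
  qed
  define \<Phi> where "\<Phi> g = Bcontfun (\<lambda>t. P (apply_bcontfun g) (cl t))" for g :: "real \<Rightarrow>\<^sub>C 'a"
  have \<Phi>: "apply_bcontfun (\<Phi> g) t = P (apply_bcontfun g) (cl t)" for g t
    unfolding \<Phi>_def by (subst Bcontfun_inverse) (auto intro!: bc contP)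
  define S where "S = {g :: real \<Rightarrow>\<^sub>C 'a. \<forall>t\<in>{0..T}. norm (apply_bcontfun g t - z t) \<le> R}"
  have PL: "norm (P g t - P h t) \<le> (M * L * T) * D"
    if g: "continuous_on {0..T} g" "continuous_on {0..T} h" and t: "t \<in> {0..T}"
      and gz: "\<And>r. r \<in> {0..T} \<Longrightarrow> norm (g r - z r) \<le> R" "\<And>r. r \<in> {0..T} \<Longrightarrow> norm (h r - z r) \<le> R"
      and D: "\<And>r. r \<in> {0..T} \<Longrightarrow> norm (g r - h r) \<le> D" for g h t D
  proof -
    have c: "continuous_on {0..T} (\<lambda>r. N (g r))" "continuous_on {0..T} (\<lambda>r. N (h r))"
      by (rule continuous_on_compose2[OF N]; (rule g | simp))+
    note i = Duhamel_integrable[OF A c(1) t] Duhamel_integrable[OF A c(2) t]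
    have "0 \<le> norm (A t w0)" by simp
    have D0: "0 \<le> D" using order_trans[OF norm_ge_zero D[OF t]] .
    have "norm (P g t - P h t) = norm (integral {0..t} (\<lambda>r. A (t - r) (N (g r)) - A (t - r) (N (h r))))"
      unfolding P_def using i by (simp add: integral_diff)
    also have "\<dots> \<le> (M * (L * D)) * (t - 0)"
    proof (rule integral_bound)
      show "continuous_on {0..t} (\<lambda>r. A (t - r) (N (g r)) - A (t - r) (N (h r)))" by (intro continuous_intros i)
      fix r assume r: "r \<in> {0..t}"
      then have r': "r \<in> {0..T}" "t - r \<in> {0..T}" using t by auto
      have "norm (A (t - r) (N (g r)) - A (t - r) (N (h r))) = norm (A (t - r) (N (g r) - N (h r)))"
        by (simp add: linear_diff[OF lin[OF r'(2)]])
      also have "\<dots> \<le> M * norm (N (g r) - N (h r))" by (rule M[OF r'(2)])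
      also have "norm (N (g r) - N (h r)) \<le> L * D"
        using Lip[OF r'(1) gz(1)[OF r'(1)] gz(2)[OF r'(1)]] mult_left_mono[OF D[OF r'(1)] L] by linarith
      finally show "norm (A (t - r) (N (g r)) - A (t - r) (N (h r))) \<le> M * (L * D)" using M0 by (simp add: mult_left_mono)
    qed (use t in auto)
    also have "\<dots> \<le> (M * (L * D)) * T" using t M0 L D0 by (intro mult_left_mono) auto
    finally show ?thesis by (simp add: mult_ac)
  qed
  have S0: "Bcontfun (\<lambda>t. z (cl t)) \<in> S"
    unfolding S_def using R cl by (simp add: Bcontfun_inverse[OF bc[OF z]])
  have "closed S"
  proof -
    have "S = PiC {0..T} (\<lambda>t. cball (z t) R)"
      by (auto simp: S_def mem_PiC_iff Pi_iff dist_norm norm_minus_commute)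
    then show ?thesis by (simp add: closed_PiC)
  qed
  have PS: "norm (P g t - z t) \<le> R"
    if g: "continuous_on {0..T} g" "\<And>r. r \<in> {0..T} \<Longrightarrow> norm (g r - z r) \<le> R" and t: "t \<in> {0..T}" for g t
  proof -
    have "norm (P g t - P z t) \<le> (M * L * T) * R" by (rule PL[OF g(1) z t g(2)]) (use R g in auto)
    also have "\<dots> \<le> (1 / 2) * R" using small R by (rule mult_right_mono)
    finally have "norm (P g t - P z t) \<le> R / 2" by simp
    moreover have "norm (P z t - z t) \<le> R / 2" unfolding P_def by (rule defect[OF t])
    ultimately show ?thesis using norm_triangle_ineq[of "P g t - P z t" "P z t - z t"] by simp
  qed
  have "\<exists>!g. g \<in> S \<and> \<Phi> g = g"
  proof (rule Banach_fix[of S "1/2"])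
    show "complete S" using \<open>closed S\<close> complete_UNIV complete_eq_closed by metis
    show "S \<noteq> {}" using S0 by auto
    show "\<Phi> ` S \<subseteq> S" using PS by (auto simp: S_def \<Phi> cl)
    show "dist (\<Phi> g) (\<Phi> h) \<le> 1 / 2 * dist g h" if "g \<in> S" "h \<in> S" for g h
    proof (rule dist_bound)
      fix t
      have "norm (P (apply_bcontfun g) (cl t) - P (apply_bcontfun h) (cl t)) \<le> (M * L * T) * dist g h"
        by (rule PL) (use that cl dist_bounded[of g _ h] in \<open>auto simp: S_def dist_norm\<close>)
      also have "\<dots> \<le> (1 / 2) * dist g h" using small by (rule mult_right_mono) simp
      finally show "dist (apply_bcontfun (\<Phi> g) t) (apply_bcontfun (\<Phi> h) t) \<le> 1 / 2 * dist g h"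
        by (simp add: \<Phi> dist_norm)
    qed
  qed auto
  then obtain g where g: "g \<in> S" "\<Phi> g = g" by blast
  show ?thesis
  proof (rule that[of "apply_bcontfun g"])
    fix t assume t: "t \<in> {0..T}"
    show "norm (apply_bcontfun g t - z t) \<le> R" using g t by (simp add: S_def)
    show "apply_bcontfun g t = A t w0 + integral {0..t} (\<lambda>r. A (t - r) (N (apply_bcontfun g r)))"
      using \<Phi>[of g t] g cl(2)[OF t] by (simp add: P_def)
  qed simp
qed

section \<open>Controlled trajectories\<close>

lemma continuous_heatop: "continuous_on ({0..T} \<times> UNIV) (\<lambda>(t, x). heatop t x)"
  unfolding case_prod_beta' by (rule continuous_heat_on_joint) (auto intro!: continuous_intros)

text \<open>Strong continuity at time 0, made uniform along the compact curve \<open>g\<close> by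
  uniform continuity on a square.\<close>

lemma heatop_near_identity:
  fixes g :: "real \<Rightarrow> (int^'d::finite) hl2"
  assumes g: "continuous_on {0..1} g" and e: "0 < e"
  obtains \<delta> where "0 < \<delta>" "\<And>t \<sigma>. 0 \<le> t \<Longrightarrow> t \<le> \<delta> \<Longrightarrow> \<sigma> \<in> {0..1} \<Longrightarrow> norm (heatop t (g \<sigma>) - g \<sigma>) < e"
proof -
  have "continuous_on ({0..1} \<times> {0..1}) (\<lambda>p. heatop (fst p) (g (snd p)))"
    by (rule continuous_heat_on_joint) (auto intro!: continuous_intros continuous_on_compose2[OF g])
  then have "uniformly_continuous_on ({0..1} \<times> {0..1}) (\<lambda>p. heatop (fst p) (g (snd p)))"
    by (rule compact_uniformly_continuous) (intro compact_Times compact_Icc)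
  then obtain d where d: "d > 0" "\<And>p q. p \<in> {0..1} \<times> {0..1} \<Longrightarrow> q \<in> {0..1} \<times> {0..1} \<Longrightarrow> dist q p < d \<Longrightarrow>
      dist (heatop (fst q) (g (snd q))) (heatop (fst p) (g (snd p))) < e"
    using e unfolding uniformly_continuous_on_def by meson
  show ?thesis
  proof (rule that[of "min 1 (d / 2)"])
    fix t \<sigma> :: real assume t: "0 \<le> t" "t \<le> min 1 (d / 2)" "\<sigma> \<in> {0..1}"
    then have "dist (t, \<sigma>) (0, \<sigma>) < d" using d(1) by (simp add: dist_Pair_Pair)
    then show "norm (heatop t (g \<sigma>) - g \<sigma>) < e"
      using d(2)[of "(0, \<sigma>)" "(t, \<sigma>)"] t by (simp add: dist_norm)
  qed (use d in auto)
qed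

text \<open>\<open>U\<close> stands for the potentials that constant controls produce. Constants
  among them keep a constant state stationary, and allow a phase to be lowered.\<close>

locale controlled = sobolev s W for s :: nat and W :: "int^'d::finite \<Rightarrow> real" +
  fixes \<kappa> :: real and p :: nat and U :: "(int^'d) hl2 set"
  assumes U: "subspace U" and cst_U: "\<And>c. cst c \<in> U"
begin

definition NL :: "(int^'d) hl2 \<Rightarrow> (int^'d) hl2 \<Rightarrow> (int^'d) hl2" where
  "NL V a = V \<odot> a - \<kappa> *\<^sub>R pw a (Suc p)"

text \<open>Controls with finitely many values and Borel level sets are closed under concatenation,
  and for them both square-integrability and the approximation of the Duhamel integrand are
  elementary.\<close>

definition simple_control :: "(real \<Rightarrow> (int^'d) hl2) \<Rightarrow> bool" where
  "simple_control u \<longleftrightarrow> finite (range u) \<and> range u \<subseteq> U \<and> (\<forall>c. {r. u r = c} \<in> sets borel)"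

text \<open>The mild formulation with the gauge integral on the Banach space type, where changes at
  single points and linear changes of variable are easy. It is converted to the integral of
  \<open>mild_solution\<close> only at the end.\<close>

definition trajectory :: "(real \<Rightarrow> (int^'d) hl2) \<Rightarrow> real \<Rightarrow> (real \<Rightarrow> (int^'d) hl2) \<Rightarrow> bool" where
  "trajectory u T \<psi> \<longleftrightarrow> simple_control u \<and> continuous_on {0..T} \<psi> \<and>
     (\<forall>t\<in>{0..T}. ((\<lambda>r. heatop (t - r) (NL (u r) (\<psi> r))) has_integral (\<psi> t - heatop t (\<psi> 0))) {0..t})"

definition reach :: "real \<Rightarrow> (int^'d) hl2 \<Rightarrow> (int^'d) hl2 \<Rightarrow> bool" where
  "reach T a b \<longleftrightarrow> 0 \<le> T \<and> (\<exists>u \<psi>. trajectory u T \<psi> \<and> \<psi> 0 = a \<and> \<psi> T = b)"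

lemma simple_control_append:
  assumes "simple_control u" "simple_control v"
  shows "simple_control (\<lambda>r. if r < T then u r else v (r - T))"
proof -
  have "finite (range (\<lambda>r. if r < T then u r else v (r - T)))"
    by (rule finite_subset[of _ "range u \<union> range v"]) (use assms in \<open>auto simp: simple_control_def\<close>)
  moreover have "{r. (if r < T then u r else v (r - T)) = c} \<in> sets borel" for c
  proof -
    have [measurable]: "{r. u r = c} \<in> sets borel" "{r. v r = c} \<in> sets borel"
      using assms by (auto simp: simple_control_def)
    have "(\<lambda>r. r - T) -` {r. v r = c} \<inter> space borel \<in> sets borel"
      by (rule measurable_sets[of _ borel borel]) measurable
    then have "{..<T} \<inter> {r. u r = c} \<union> {T..} \<inter> ((\<lambda>r. r - T) -` {r. v r = c} \<inter> space borel) \<in> sets borel"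
      by (intro sets.Un sets.Int) auto
    also have "{..<T} \<inter> {r. u r = c} \<union> {T..} \<inter> ((\<lambda>r. r - T) -` {r. v r = c} \<inter> space borel)
      = {r. (if r < T then u r else v (r - T)) = c}" by auto
    finally show ?thesis .
  qed
  ultimately show ?thesis using assms by (auto simp: simple_control_def)
qed

lemma simple_control_const: "V \<in> U \<Longrightarrow> simple_control (\<lambda>_. V)"
  unfolding simple_control_def by auto

lemma reach_trans:
  assumes "reach T1 a b" "reach T2 b c"
  shows "reach (T1 + T2) a c"
proof -
  obtain u \<psi> where T1: "0 \<le> T1" and u: "simple_control u" and \<psi>: "continuous_on {0..T1} \<psi>" "\<psi> 0 = a" "\<psi> T1 = b"
    and iu: "\<And>t. t \<in> {0..T1} \<Longrightarrow> ((\<lambda>r. heatop (t - r) (NL (u r) (\<psi> r))) has_integral (\<psi> t - heatop t (\<psi> 0))) {0..t}"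
    using assms(1) unfolding reach_def trajectory_def by blast
  obtain v \<zeta> where T2: "0 \<le> T2" and v: "simple_control v" and \<zeta>: "continuous_on {0..T2} \<zeta>" "\<zeta> 0 = b" "\<zeta> T2 = c"
    and iv: "\<And>t. t \<in> {0..T2} \<Longrightarrow> ((\<lambda>r. heatop (t - r) (NL (v r) (\<zeta> r))) has_integral (\<zeta> t - heatop t (\<zeta> 0))) {0..t}"
    using assms(2) unfolding reach_def trajectory_def by blast
  define w where "w r = (if r < T1 then u r else v (r - T1))" for r
  define \<xi> where "\<xi> r = (if r \<le> T1 then \<psi> r else \<zeta> (r - T1))" for r
  have "continuous_on ({0..T1} \<union> {T1..T1 + T2}) \<xi>"
    unfolding \<xi>_def
  proof (rule continuous_on_If)
    show "continuous_on {T1..T1 + T2} (\<lambda>r. \<zeta> (r - T1))"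
      by (rule continuous_on_compose2[OF \<zeta>(1)]) (auto intro!: continuous_intros)
  qed (use \<psi> \<zeta> in auto)
  moreover have "{0..T1} \<union> {T1..T1 + T2} = {0..T1 + T2}" using T1 T2 by auto
  ultimately have c\<xi>: "continuous_on {0..T1 + T2} \<xi>" by simp
  \<comment> \<open>The control switches at T1 itself while the state does so only after T1; for t
    \<le> T1 the integrands differ at most at that point.\<close>
  have first: "((\<lambda>r. heatop (t - r) (NL (w r) (\<xi> r))) has_integral (\<xi> t - heatop t (\<xi> 0))) {0..t}"
    if t: "t \<in> {0..T1}" for t
  proof -
    have "\<xi> t - heatop t (\<xi> 0) = \<psi> t - heatop t (\<psi> 0)" using t T1 by (simp add: \<xi>_def)
    then show ?thesis
      using has_integral_spike[OF negligible_sing[of T1] _ iu[OF t]] t by (auto simp: w_def \<xi>_def)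
  qed
  have "((\<lambda>r. heatop (t - r) (NL (w r) (\<xi> r))) has_integral (\<xi> t - heatop t (\<xi> 0))) {0..t}"
    if t: "t \<in> {0..T1 + T2}" for t
  proof (cases "t \<le> T1")
    case True
    then show ?thesis using first t by auto
  next
    case False
    then have t1: "T1 < t" "t - T1 \<in> {0..T2}" using t by auto
    \<comment> \<open>The Duhamel formula of the first phase is transported from T1 to t by the
      semigroup law, and the second phase is appended to it.\<close>
    have "((\<lambda>r. heatop (t - T1) (heatop (T1 - r) (NL (w r) (\<xi> r)))) has_integral heatop (t - T1) (\<xi> T1 - heatop T1 (\<xi> 0))) {0..T1}"
      using has_integral_linear[OF first[of T1] bounded_linear_heat_on[of "t - T1"]] T1 t1 by (simp add: o_def)
    also have "heatop (t - T1) (\<xi> T1 - heatop T1 (\<xi> 0)) = heatop (t - T1) b - heatop t (\<xi> 0)"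
      using t1 T1 heat_on_add[of "t - T1" T1 UNIV "\<xi> 0"] \<psi>
      by (simp add: linear_diff[OF bounded_linear.linear[OF bounded_linear_heat_on]] \<xi>_def)
    finally have "((\<lambda>r. heatop (t - T1) (heatop (T1 - r) (NL (w r) (\<xi> r)))) has_integral (heatop (t - T1) b - heatop t (\<xi> 0))) {0..T1}" .
    then have i1: "((\<lambda>r. heatop (t - r) (NL (w r) (\<xi> r))) has_integral (heatop (t - T1) b - heatop t (\<xi> 0))) {0..T1}"
      by (rule has_integral_eq[rotated]) (use t1 heat_on_add[of "t - T1" "T1 - r" UNIV for r, symmetric] in auto)
    have "((\<lambda>r. heatop (t - T1 - (r + - T1)) (NL (v (r + - T1)) (\<zeta> (r + - T1)))) has_integral (\<zeta> (t - T1) - heatop (t - T1) b)) {0 - - T1..t - T1 - - T1}"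
      using has_integral_shift_real_ivl[OF iv[OF t1(2)], of "- T1"] \<zeta> by simp
    then have "((\<lambda>r. heatop (t - r) (NL (v (r - T1)) (\<zeta> (r - T1)))) has_integral (\<zeta> (t - T1) - heatop (t - T1) b)) {T1..t}"
      by simp
    then have i2: "((\<lambda>r. heatop (t - r) (NL (w r) (\<xi> r))) has_integral (\<zeta> (t - T1) - heatop (t - T1) b)) {T1..t}"
      by (rule has_integral_spike[OF negligible_sing[of T1], rotated]) (auto simp: w_def \<xi>_def)
    have "\<xi> t - heatop t (\<xi> 0) = (heatop (t - T1) b - heatop t (\<xi> 0)) + (\<zeta> (t - T1) - heatop (t - T1) b)"
      using t1 by (simp add: \<xi>_def)
    then show ?thesis using has_integral_combine[OF T1 less_imp_le[OF t1(1)] i1 i2] by simp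
  qed
  then have "trajectory w (T1 + T2) \<xi>"
    unfolding trajectory_def using simple_control_append[OF u v, of T1] c\<xi> by (simp add: w_def[abs_def])
  moreover have "\<xi> 0 = a" "\<xi> (T1 + T2) = c" using T1 T2 \<psi> \<zeta> by (auto simp: \<xi>_def)
  ultimately show ?thesis unfolding reach_def using T1 T2 by auto
qed

lemma continuous_pw: "continuous_on UNIV (\<lambda>a. pw a n)"
  by (induction n) (auto intro!: continuous_intros mul.continuous_on)

lemma continuous_NL: "continuous_on UNIV (NL V)"
  unfolding NL_def[abs_def] by (intro continuous_intros continuous_pw mul.continuous_on)

lemma reachI:
  assumes V: "V \<in> U" and T: "0 \<le> T" and w: "continuous_on {0..T} w"
    and eq: "\<And>t. t \<in> {0..T} \<Longrightarrow> w t = heatop t w0 + integral {0..t} (\<lambda>r. heatop (t - r) (NL V (w r)))"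
  shows "reach T w0 (w T)"
proof -
  have w0: "w 0 = w0" using eq[of 0] T by simp
  have "((\<lambda>r. heatop (t - r) (NL V (w r))) has_integral (w t - heatop t (w 0))) {0..t}" if "t \<in> {0..T}" for t
  proof -
    have c: "continuous_on {0..T} (\<lambda>r. NL V (w r))" by (rule continuous_on_compose2[OF continuous_NL w]) simp
    show ?thesis
      using Duhamel_integrable(2)[OF continuous_heatop c that] eq[OF that] w0 by (simp add: has_integral_iff)
  qed
  then have "trajectory (\<lambda>_. V) T w" unfolding trajectory_def using w simple_control_const[OF V] by simp
  then show ?thesis unfolding reach_def using T w0 by auto
qed

text \<open>The dependence on V is kept explicit because the potential is scaled like 1 / \<delta>
  while R, and hence L, stays fixed.\<close>

lemma NL_Lipschitz:
  "\<exists>L\<ge>0. \<forall>V a b. norm a \<le> R \<longrightarrow> norm b \<le> R \<longrightarrow>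
     norm (\<kappa> *\<^sub>R pw a (Suc p)) \<le> L \<and> norm (NL V a - NL V b) \<le> (Cm * norm V + L) * norm (a - b)"
proof -
  obtain L where L: "L \<ge> 0" "\<And>a b :: (int^'d) hl2. norm a \<le> R \<Longrightarrow> norm b \<le> R \<Longrightarrow>
      norm (pw a (Suc p)) \<le> L \<and> norm (pw a (Suc p) - pw b (Suc p)) \<le> L * norm (a - b)"
    using pw_Lipschitz[of R "Suc p"] by blast
  show ?thesis
  proof (intro exI[of _ "\<bar>\<kappa>\<bar> * L"] conjI allI impI)
    fix V a b :: "(int^'d) hl2" assume ab: "norm a \<le> R" "norm b \<le> R"
    show "norm (\<kappa> *\<^sub>R pw a (Suc p)) \<le> \<bar>\<kappa>\<bar> * L" using L(2)[OF ab] unfolding norm_scaleR by (intro mult_left_mono) auto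
    have "NL V a - NL V b = V \<odot> (a - b) - \<kappa> *\<^sub>R (pw a (Suc p) - pw b (Suc p))"
      unfolding NL_def mul.diff_right scaleR_diff_right by simp
    also have "norm \<dots> \<le> Cm * norm V * norm (a - b) + \<bar>\<kappa>\<bar> * (L * norm (a - b))"
      using L(2)[OF ab] by (intro order_trans[OF norm_triangle_ineq4] add_mono norm_mul_le)
        (simp only: norm_scaleR mult_left_mono abs_ge_zero)
    finally show "norm (NL V a - NL V b) \<le> (Cm * norm V + \<bar>\<kappa>\<bar> * L) * norm (a - b)" by (simp add: algebra_simps)
  qed (use L in auto)
qed

section \<open>Small-time approximate steering\<close>

text \<open>The time \<open>\<tau>\<close> is the same for all initial data near \<open>a\<close>; this is what makes it possible to
  adjust the total time in the end.\<close>

definition steer :: "(int^'d) hl2 \<Rightarrow> (int^'d) hl2 \<Rightarrow> bool" where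
  "steer a b \<longleftrightarrow> (\<forall>e>0. \<forall>T>0. \<exists>\<tau>>0. \<tau> \<le> T \<and> (\<exists>\<eta>>0. \<forall>a'. norm (a' - a) < \<eta> \<longrightarrow>
     (\<exists>b'. reach \<tau> a' b' \<and> norm (b' - b) < e)))"

lemma steer_trans:
  assumes "steer a b" "steer b c" shows "steer a c"
  unfolding steer_def
proof (intro allI impI)
  fix e T :: real assume e: "e > 0" and T: "T > 0"
  obtain \<tau>2 \<eta>2 where 2: "\<tau>2 > 0" "\<tau>2 \<le> T / 2" "\<eta>2 > 0"
    "\<And>b'. norm (b' - b) < \<eta>2 \<Longrightarrow> \<exists>c'. reach \<tau>2 b' c' \<and> norm (c' - c) < e"
    using assms(2) e T unfolding steer_def by (metis half_gt_zero)
  obtain \<tau>1 \<eta>1 where 1: "\<tau>1 > 0" "\<tau>1 \<le> T / 2" "\<eta>1 > 0"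
    "\<And>a'. norm (a' - a) < \<eta>1 \<Longrightarrow> \<exists>b'. reach \<tau>1 a' b' \<and> norm (b' - b) < \<eta>2"
    using assms(1) 2(3) T unfolding steer_def by (metis half_gt_zero)
  have "\<exists>c'. reach (\<tau>1 + \<tau>2) a' c' \<and> norm (c' - c) < e" if "norm (a' - a) < \<eta>1" for a'
    using 1(4)[OF that] 2(4) reach_trans by blast
  then show "\<exists>\<tau>>0. \<tau> \<le> T \<and> (\<exists>\<eta>>0. \<forall>a'. norm (a' - a) < \<eta> \<longrightarrow> (\<exists>b'. reach \<tau> a' b' \<and> norm (b' - c) < e))"
    using 1 2 by (intro exI[of _ "\<tau>1 + \<tau>2"]) auto
qed

lemma steer_limit:
  assumes "\<And>e. e > 0 \<Longrightarrow> \<exists>c. steer a c \<and> norm (c - b) < e"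
  shows "steer a b"
  unfolding steer_def
proof (intro allI impI)
  fix e T :: real assume e: "e > 0" and T: "T > 0"
  obtain c where c: "steer a c" "norm (c - b) < e / 2" using assms[of "e/2"] e by auto
  then obtain \<tau> \<eta> where 1: "\<tau> > 0" "\<tau> \<le> T" "\<eta> > 0"
    "\<And>a'. norm (a' - a) < \<eta> \<Longrightarrow> \<exists>b'. reach \<tau> a' b' \<and> norm (b' - c) < e / 2"
    using e T unfolding steer_def by (metis half_gt_zero)
  have "\<exists>b'. reach \<tau> a' b' \<and> norm (b' - b) < e" if a': "norm (a' - a) < \<eta>" for a'
  proof -
    obtain b' where b': "reach \<tau> a' b'" "norm (b' - c) < e / 2" using 1(4)[OF a'] by blast
    have "norm (b' - b) < e" using norm_add_less[OF b'(2) c(2)] by simp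
    then show ?thesis using b' by blast
  qed
  then show "\<exists>\<tau>>0. \<tau> \<le> T \<and> (\<exists>\<eta>>0. \<forall>a'. norm (a' - a) < \<eta> \<longrightarrow> (\<exists>b'. reach \<tau> a' b' \<and> norm (b' - b) < e))"
    using 1 by blast
qed

lemma has_vector_derivative_E:
  "((\<lambda>t. E (t *\<^sub>R V)) has_vector_derivative V \<odot> E (t *\<^sub>R V)) (at t within S)"
proof -
  define C where "C = Cm * norm (E (t *\<^sub>R V)) * ((Cm)\<^sup>2 * K1 * (norm V)\<^sup>2)"
  have C0: "0 \<le> C" using Cm_ge_1 K1_ge_1 by (simp add: C_def)
  show ?thesis
    unfolding has_vector_derivative_def
  proof (rule has_derivativeI_sandwich[of 1 _ _ _ _ "\<lambda>y. C * \<bar>y - t\<bar> * exp (Cm * (\<bar>y - t\<bar> * norm V))"])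
    show "bounded_linear (\<lambda>x. x *\<^sub>R (V \<odot> E (t *\<^sub>R V)))" by (rule bounded_linear_scaleR_left)
    have "((\<lambda>y. C * \<bar>y - t\<bar> * exp (Cm * (\<bar>y - t\<bar> * norm V))) \<longlongrightarrow> C * \<bar>t - t\<bar> * exp (Cm * (\<bar>t - t\<bar> * norm V))) (at t within S)"
      by (intro tendsto_intros)
    then show "((\<lambda>y. C * \<bar>y - t\<bar> * exp (Cm * (\<bar>y - t\<bar> * norm V))) \<longlongrightarrow> 0) (at t within S)" by simp
    fix y assume y: "y \<noteq> t"
    define h where "h = y - t"
    have "E (y *\<^sub>R V) - E (t *\<^sub>R V) - h *\<^sub>R (V \<odot> E (t *\<^sub>R V)) = E (t *\<^sub>R V) \<odot> (E (h *\<^sub>R V) - cst 1 - h *\<^sub>R V)"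
    proof (rule ev_inj)
      fix x
      have "exp (y * ev V x) = exp (t * ev V x) * exp (h * ev V x)"
        by (simp add: h_def flip: exp_add) (simp add: algebra_simps)
      then show "ev (E (y *\<^sub>R V) - E (t *\<^sub>R V) - h *\<^sub>R (V \<odot> E (t *\<^sub>R V))) x = ev (E (t *\<^sub>R V) \<odot> (E (h *\<^sub>R V) - cst 1 - h *\<^sub>R V)) x"
        by (simp add: algebra_simps)
    qed
    also have "norm \<dots> \<le> Cm * norm (E (t *\<^sub>R V)) * norm (E (h *\<^sub>R V) - cst 1 - h *\<^sub>R V)" by (rule norm_mul_le)
    also have "\<dots> \<le> Cm * norm (E (t *\<^sub>R V)) * ((Cm)\<^sup>2 * K1 * (norm (h *\<^sub>R V))\<^sup>2 * exp (Cm * norm (h *\<^sub>R V)))"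
      using Cm_ge_1 by (intro mult_left_mono norm_E_minus_le) auto
    also have "\<dots> = C * \<bar>h\<bar> * exp (Cm * (\<bar>h\<bar> * norm V)) * \<bar>h\<bar>"
      by (simp add: C_def power_mult_distrib power2_eq_square mult_ac)
    finally show "norm ((E (y *\<^sub>R V) - E (t *\<^sub>R V)) - (y - t) *\<^sub>R (V \<odot> E (t *\<^sub>R V))) / norm (y - t)
       \<le> C * \<bar>y - t\<bar> * exp (Cm * (\<bar>y - t\<bar> * norm V))"
      using y by (simp add: h_def divide_le_eq)
  qed simp
qed

lemma continuous_E_line: "continuous_on S (\<lambda>t. E (t *\<^sub>R V))"
  by (rule continuous_on_vector_derivative) (rule has_vector_derivative_E)

section \<open>Elementary steering moves\<close>

lemma reach_0: "reach 0 a a"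
proof -
  have "trajectory (\<lambda>_. 0) 0 (\<lambda>_. a)"
    unfolding trajectory_def using simple_control_const[OF subspace_0[OF U]] by auto
  then show ?thesis unfolding reach_def by auto
qed

lemma ex_small_positive:
  fixes c :: real assumes "\<And>x. x \<in> set xs \<Longrightarrow> 0 < x"
  shows "\<exists>\<delta>>0. \<forall>x\<in>set xs. \<delta> \<le> (x::real)"
  using assms
proof (induction xs)
  case (Cons y ys)
  then obtain \<delta> where "\<delta> > 0" "\<forall>x\<in>set ys. \<delta> \<le> x" by auto
  then show ?case using Cons.prems[of y] by (intro exI[of _ "min \<delta> y"]) auto
qed (auto intro: exI[of _ 1])

text \<open>With the potential V / \<delta>, the path E ((t / \<delta>) V) a solves the equation
  without diffusion and nonlinearity, and for small \<delta> these are perturbations. The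
  contraction constant contains Cm times the norm of V, which does not shrink with \<delta>; hence
  the restriction to small V.\<close>

lemma steer_small_control:
  assumes V: "V \<in> U" and small: "Cm * norm V \<le> 1 / 4"
  shows "steer a (E V \<odot> a)"
  unfolding steer_def
proof (intro allI impI)
  fix e T :: real assume e: "e > 0" and T: "T > 0"
  define R where "R = min 1 (e / 2)"
  have R: "0 < R" "R \<le> 1" "R < e" using e by (auto simp: R_def)
  define B where "B = Cm * K1 * exp (Cm * norm V) * norm a"
  have B: "norm (E (\<sigma> *\<^sub>R V) \<odot> a) \<le> B" if "\<sigma> \<in> {0..1}" for \<sigma>
  proof -
    have "Cm * norm (\<sigma> *\<^sub>R V) \<le> Cm * norm V"
      using that Cm_ge_1 by (intro mult_left_mono) (auto intro: mult_left_le_one_le)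
    then have "Cm * K1 * exp (Cm * norm (\<sigma> *\<^sub>R V)) * norm a \<le> B"
      unfolding B_def using Cm_ge_1 K1_ge_1 by (intro mult_right_mono mult_left_mono) auto
    then show ?thesis using norm_E_mul_le order_trans by blast
  qed
  obtain L where L: "L \<ge> 0" "\<And>a. norm a \<le> B + 1 \<Longrightarrow> norm (\<kappa> *\<^sub>R pw a (Suc p)) \<le> L"
    "\<And>V a b. norm a \<le> B + 1 \<Longrightarrow> norm b \<le> B + 1 \<Longrightarrow> norm (NL V a - NL V b) \<le> (Cm * norm V + L) * norm (a - b)"
    using NL_Lipschitz[of "B + 1"] by blast
  \<comment> \<open>The driving term in rescaled time: \<open>V' \<odot> z t\<close> is g (t /
    \<delta>) / \<delta>. It does not involve \<delta>, so \<delta>1 can be fixed before \<delta> is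
    chosen.\<close>
  define g where "g \<sigma> = V \<odot> (E (\<sigma> *\<^sub>R V) \<odot> a)" for \<sigma>
  have "continuous_on {0..1} g"
    unfolding g_def by (intro mul.continuous_on continuous_on_const continuous_E_line)
  then obtain \<delta>1 where \<delta>1: "\<delta>1 > 0" "\<And>t \<sigma>. 0 \<le> t \<Longrightarrow> t \<le> \<delta>1 \<Longrightarrow> \<sigma> \<in> {0..1} \<Longrightarrow> norm (heatop t (g \<sigma>) - g \<sigma>) < R / 8"
    using heatop_near_identity[of g "R / 8"] R(1) by auto
  obtain \<delta>2 where \<delta>2: "\<delta>2 > 0" "\<And>t \<sigma>. 0 \<le> t \<Longrightarrow> t \<le> \<delta>2 \<Longrightarrow> \<sigma> \<in> {0..1::real} \<Longrightarrow> norm (heatop t a - a) < R / 8"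
    using heatop_near_identity[of "\<lambda>_. a" "R / 8"] R(1) by auto
  \<comment> \<open>The entries bound, in this order, the horizon, the effect of diffusion on the
    driving term and on a, the nonlinear part of the defect, and the nonlinear part of the
    contraction constant.\<close>
  have pos: "0 < x" if "x \<in> set [T, \<delta>1, \<delta>2, R / (8 * (L + 1)), 1 / (4 * (L + 1))]" for x
    using that T \<delta>1(1) \<delta>2(1) R(1) L(1) by auto
  obtain \<delta> where \<delta>0: "\<delta> > 0" and \<delta>s: "\<forall>x\<in>set [T, \<delta>1, \<delta>2, R / (8 * (L + 1)), 1 / (4 * (L + 1))]. \<delta> \<le> x"
    using ex_small_positive[OF pos] by blast
  have \<delta>: "\<delta> \<le> T" "\<delta> \<le> \<delta>1" "\<delta> \<le> \<delta>2" "\<delta> \<le> R / (8 * (L + 1))" "\<delta> \<le> 1 / (4 * (L + 1))" using \<delta>s by auto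
  have "0 < 8 * (L + 1)" "0 < 4 * (L + 1)" using L(1) by auto
  then have "\<delta> * (8 * (L + 1)) \<le> R" "\<delta> * (4 * (L + 1)) \<le> 1"
    using \<delta>(4,5) by (simp_all only: pos_le_divide_eq)
  then have \<delta>L: "\<delta> * L \<le> R / 8" "\<delta> * L \<le> 1 / 4" using \<delta>0 by (auto simp: algebra_simps)
  define V' where "V' = (1 / \<delta>) *\<^sub>R V"
  have V': "V' \<in> U" unfolding V'_def by (rule subspace_scale[OF U V])
  define z where "z t = E (t *\<^sub>R V') \<odot> a" for t
  have cz: "continuous_on S z" for S
    unfolding z_def by (intro mul.continuous_on continuous_on_const continuous_E_line)
  have zg: "V' \<odot> z t = (1 / \<delta>) *\<^sub>R g (t / \<delta>)" for t
    by (simp add: z_def g_def V'_def mul.scaleR_left)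
  have zB: "norm (z t) \<le> B" if "t \<in> {0..\<delta>}" for t
    using B[of "t / \<delta>"] that \<delta>0 by (simp add: z_def V'_def)
  have zint: "((\<lambda>r. V' \<odot> z r) has_integral (z t - a)) {0..t}" if "0 \<le> t" for t
  proof -
    have "((\<lambda>r. (V' \<odot> E (r *\<^sub>R V')) \<odot> a) has_integral (E (t *\<^sub>R V') \<odot> a - E (0 *\<^sub>R V') \<odot> a)) {0..t}"
      by (rule fundamental_theorem_of_calculus[OF that])
        (rule bounded_linear.has_vector_derivative[OF mul.bounded_linear_left has_vector_derivative_E])
    then show ?thesis by (simp add: z_def mul_assoc E_0)
  qed
  have near: "\<exists>b'. reach \<delta> a' b' \<and> norm (b' - E V \<odot> a) < e" if a': "norm (a' - a) < R / 8" for a'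
  proof -
    have "\<exists>w. continuous_on {0..\<delta>} w \<and> (\<forall>t\<in>{0..\<delta>}. norm (w t - z t) \<le> R \<and>
        w t = heatop t a' + integral {0..t} (\<lambda>r. heatop (t - r) (NL V' (w r))))"
    proof (rule shadowing[of \<delta> R "Cm * norm V' + L" 1 heatop z "NL V'" a'])
      show "continuous_on ({0..\<delta>} \<times> UNIV) (\<lambda>(t, x::(int^'d) hl2). heatop t x)" by (rule continuous_heatop)
      show "linear (heatop t :: (int^'d) hl2 \<Rightarrow> _)" if "t \<in> {0..\<delta>}" for t
        using that by (intro bounded_linear.linear bounded_linear_heat_on) auto
      show "norm (heatop t x) \<le> 1 * norm x" if "t \<in> {0..\<delta>}" for t and x :: "(int^'d) hl2"
        using that norm_heat_on_le[of t UNIV x] by simp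
      show "norm (NL V' x - NL V' y) \<le> (Cm * norm V' + L) * norm (x - y)"
        if "t \<in> {0..\<delta>}" "norm (x - z t) \<le> R" "norm (y - z t) \<le> R" for t x y
        using zB[OF that(1)] that(2,3) R(2) norm_triangle_ineq[of "x - z t" "z t"] norm_triangle_ineq[of "y - z t" "z t"]
        by (intro L(3)) auto
      have "1 * (Cm * norm V' + L) * \<delta> = Cm * norm V + \<delta> * L" using \<delta>0 by (simp add: V'_def algebra_simps)
      then show "1 * (Cm * norm V' + L) * \<delta> \<le> 1 / 2" using small \<delta>L by simp
      fix t assume t: "t \<in> {0..\<delta>}"
      have cN: "continuous_on {0..\<delta>} (\<lambda>r. NL V' (z r))" by (rule continuous_on_compose2[OF continuous_NL cz]) simp
      note di = Duhamel_integrable[OF continuous_heatop cN t]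
      have cV: "continuous_on {0..t} (\<lambda>r. V' \<odot> z r)" by (intro mul.continuous_on continuous_on_const cz)
      \<comment> \<open>Of the admissible defect R/2, one half goes to the integral (R/8 from
        diffusion and R/8 from the nonlinearity) and the other to the initial value.\<close>
      have "norm (integral {0..t} (\<lambda>r. heatop (t - r) (NL V' (z r)) - V' \<odot> z r)) \<le> (R / (8 * \<delta>) + L) * (t - 0)"
      proof (rule integral_bound)
        show "continuous_on {0..t} (\<lambda>r. heatop (t - r) (NL V' (z r)) - V' \<odot> z r)" by (intro continuous_intros di cV)
        fix r assume r: "r \<in> {0..t}"
        then have tr: "0 \<le> t - r" "t - r \<le> \<delta>1" "r \<in> {0..\<delta>}" "r / \<delta> \<in> {0..1}" using t \<delta> \<delta>0 by auto
        note lin = bounded_linear.linear[OF bounded_linear_heat_on[OF tr(1), of UNIV]]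
        have "heatop (t - r) (NL V' (z r)) - V' \<odot> z r =
           (1 / \<delta>) *\<^sub>R (heatop (t - r) (g (r / \<delta>)) - g (r / \<delta>)) - heatop (t - r) (\<kappa> *\<^sub>R pw (z r) (Suc p))"
          unfolding NL_def linear_diff[OF lin] zg linear_scale[OF lin] scaleR_diff_right by simp
        also have "norm \<dots> \<le> (1 / \<delta>) * (R / 8) + L"
        proof (rule order_trans[OF norm_triangle_ineq4 add_mono])
          show "norm ((1 / \<delta>) *\<^sub>R (heatop (t - r) (g (r / \<delta>)) - g (r / \<delta>))) \<le> (1 / \<delta>) * (R / 8)"
            unfolding norm_scaleR using \<delta>1(2)[OF tr(1,2,4)] \<delta>0 by (intro mult_mono) auto
          have "norm (\<kappa> *\<^sub>R pw (z r) (Suc p)) \<le> L" using zB[OF tr(3)] by (intro L(2)) simp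
          then show "norm (heatop (t - r) (\<kappa> *\<^sub>R pw (z r) (Suc p))) \<le> L"
            using norm_heat_on_le[OF tr(1)] order_trans by blast
        qed
        finally show "norm (heatop (t - r) (NL V' (z r)) - V' \<odot> z r) \<le> R / (8 * \<delta>) + L" by simp
      qed (use t in auto)
      also have "\<dots> \<le> (R / (8 * \<delta>) + L) * \<delta>" using t R L \<delta>0 by (intro mult_left_mono) auto
      also have "\<dots> \<le> R / 4" using \<delta>L(1) \<delta>0 by (simp add: algebra_simps)
      finally have i1: "norm (integral {0..t} (\<lambda>r. heatop (t - r) (NL V' (z r)) - V' \<odot> z r)) \<le> R / 4" .
      have t0: "0 \<le> t" "t \<le> \<delta>2" using t \<delta> by auto
      note lin = bounded_linear.linear[OF bounded_linear_heat_on[OF t0(1), of UNIV]]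
      have hd: "heatop t a' - a = heatop t (a' - a) + (heatop t a - a)" by (simp add: linear_diff[OF lin])
      have i2: "norm (heatop t a' - a) \<le> R / 8 + R / 8"
        unfolding hd
        by (rule norm_triangle_mono[OF order_trans[OF norm_heat_on_le[OF t0(1)] less_imp_le[OF a']] less_imp_le[OF \<delta>2(2)[OF t0, of 0]]])
          simp
      have ieq: "integral {0..t} (\<lambda>r. heatop (t - r) (NL V' (z r)) - V' \<odot> z r) =
         integral {0..t} (\<lambda>r. heatop (t - r) (NL V' (z r))) - (z t - a)"
        using integral_diff[OF di(2) has_integral_integrable[OF zint[OF t0(1)]]] integral_unique[OF zint[OF t0(1)]] by simp
      have deq: "heatop t a' + integral {0..t} (\<lambda>r. heatop (t - r) (NL V' (z r))) - z t =
        (heatop t a' - a) + integral {0..t} (\<lambda>r. heatop (t - r) (NL V' (z r)) - V' \<odot> z r)"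
        unfolding ieq by simp
      show "norm (heatop t a' + integral {0..t} (\<lambda>r. heatop (t - r) (NL V' (z r))) - z t) \<le> R / 2"
        unfolding deq by (rule order_trans[OF norm_triangle_mono[OF i2 i1]]) simp
    next
      fix w assume "continuous_on {0..\<delta>} w" "\<And>t. t \<in> {0..\<delta>} \<Longrightarrow> norm (w t - z t) \<le> R"
        "\<And>t. t \<in> {0..\<delta>} \<Longrightarrow> w t = heatop t a' + integral {0..t} (\<lambda>r. heatop (t - r) (NL V' (w r)))"
      then show ?thesis by blast
    qed (use \<delta>0 R L Cm_ge_1 cz continuous_NL in auto)
    then obtain w where w: "continuous_on {0..\<delta>} w" "\<And>t. t \<in> {0..\<delta>} \<Longrightarrow> norm (w t - z t) \<le> R"
        "\<And>t. t \<in> {0..\<delta>} \<Longrightarrow> w t = heatop t a' + integral {0..t} (\<lambda>r. heatop (t - r) (NL V' (w r)))" by blast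
    have "reach \<delta> a' (w \<delta>)" by (rule reachI[OF V' _ w(1,3)]) (use \<delta>0 in auto)
    moreover have "norm (w \<delta> - E V \<odot> a) < e"
      using w(2)[of \<delta>] \<delta>0 R(3) by (simp add: z_def V'_def)
    ultimately show ?thesis by blast
  qed
  show "\<exists>\<tau>>0. \<tau> \<le> T \<and> (\<exists>\<eta>>0. \<forall>a'. norm (a' - a) < \<eta> \<longrightarrow> (\<exists>b'. reach \<tau> a' b' \<and> norm (b' - E V \<odot> a) < e))"
    using \<delta>0 \<delta>(1) near R(1) by (intro exI[of _ \<delta>] conjI exI[of _ "R / 8"]) auto
qed

section \<open>The set of attainable exponents\<close>

definition attainable :: "(int^'d) hl2 set" where
  "attainable = {f. \<forall>a. steer a (E f \<odot> a)}"

lemma attainable_add: "f \<in> attainable \<Longrightarrow> g \<in> attainable \<Longrightarrow> f + g \<in> attainable"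
  unfolding attainable_def
proof safe
  fix a assume f: "\<forall>a. steer a (E f \<odot> a)" and g: "\<forall>a. steer a (E g \<odot> a)"
  have "steer a (E f \<odot> (E g \<odot> a))" using f g steer_trans by blast
  then show "steer a (E (f + g) \<odot> a)" by (simp add: E_add mul_assoc)
qed

lemma attainable_0: "0 \<in> attainable"
  unfolding attainable_def using steer_small_control[OF subspace_0[OF U]] by auto

text \<open>A large control is cut into n equal pieces, each small enough for
  \<open>steer_small_control\<close>.\<close>

lemma U_subset_attainable: "U \<subseteq> attainable"
proof
  fix V assume V: "V \<in> U"
  obtain n :: nat where n: "4 * Cm * norm V < real n" using reals_Archimedean2 by blast
  then have n0: "0 < real n" using Cm_ge_1 by (meson le_less_trans mult_nonneg_nonneg norm_ge_zero order_trans zero_le_numeral zero_le_one)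
  define v where "v = (1 / real n) *\<^sub>R V"
  have "v \<in> U" unfolding v_def by (rule subspace_scale[OF U V])
  moreover have "Cm * norm v \<le> 1 / 4" using n n0 by (simp add: v_def field_simps)
  ultimately have v: "v \<in> attainable" unfolding attainable_def using steer_small_control by blast
  have "real m *\<^sub>R v \<in> attainable" for m
    by (induction m) (auto simp: attainable_0 scaleR_left_distrib intro: attainable_add v)
  from this[of n] show "V \<in> attainable" using n0 by (simp add: v_def)
qed

lemma norm_E_mul_diff_le:
  "norm (E f \<odot> a - E g \<odot> a) \<le> Cm * ((Cm * K1)\<^sup>2 * norm (f - g) * exp (Cm * (norm g + norm (f - g)))) * norm a"
proof -
  have "norm (E f \<odot> a - E g \<odot> a) \<le> Cm * norm (E f - E g) * norm a"
    unfolding mul.diff_left[symmetric] by (rule norm_mul_le)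
  also have "\<dots> \<le> Cm * ((Cm * K1)\<^sup>2 * norm (f - g) * exp (Cm * (norm g + norm (f - g)))) * norm a"
    using Cm_ge_1 norm_E_diff_le by (intro mult_right_mono mult_left_mono) auto
  finally show ?thesis .
qed

lemma tendsto_E_mul: "X \<longlonglongrightarrow> f \<Longrightarrow> (\<lambda>n. E (X n) \<odot> a) \<longlonglongrightarrow> E f \<odot> a"
proof (rule LIM_zero_cancel, rule Lim_null_comparison)
  assume X: "X \<longlonglongrightarrow> f"
  show "\<forall>\<^sub>F n in sequentially. norm (E (X n) \<odot> a - E f \<odot> a) \<le>
      Cm * ((Cm * K1)\<^sup>2 * norm (X n - f) * exp (Cm * (norm f + norm (X n - f)))) * norm a"
    by (intro always_eventually allI norm_E_mul_diff_le)
  have "(\<lambda>n. Cm * ((Cm * K1)\<^sup>2 * norm (X n - f) * exp (Cm * (norm f + norm (X n - f)))) * norm a) \<longlonglongrightarrow>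
      Cm * ((Cm * K1)\<^sup>2 * norm (f - f) * exp (Cm * (norm f + norm (f - f)))) * norm a"
    by (intro tendsto_intros X)
  then show "(\<lambda>n. Cm * ((Cm * K1)\<^sup>2 * norm (X n - f) * exp (Cm * (norm f + norm (X n - f)))) * norm a) \<longlonglongrightarrow> 0" by simp
qed

lemma closed_attainable: "closed attainable"
  unfolding closed_sequential_limits
proof (intro allI impI, elim conjE)
  fix X f assume X: "\<forall>n. X n \<in> attainable" "X \<longlonglongrightarrow> f"
  have "steer a (E f \<odot> a)" for a
  proof (rule steer_limit)
    fix e :: real assume "e > 0"
    then obtain n where "norm (E (X n) \<odot> a - E f \<odot> a) < e"
      using LIMSEQ_D[OF tendsto_E_mul[OF X(2), of a]] by blast
    then show "\<exists>c. steer a c \<and> norm (c - E f \<odot> a) < e" using X(1) unfolding attainable_def by blast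
  qed
  then show "f \<in> attainable" by (simp add: attainable_def)
qed

section \<open>Staying near a constant state\<close>

lemma heatop_cst: "0 \<le> t \<Longrightarrow> heatop t (cst c) = cst c"
proof (rule hl2_eqI)
  fix k :: "int^'d"
  assume t: "0 \<le> t"
  have "coef (cst c) k = 0 \<or> k = 0" by (auto simp: coef_fc cst_def fc_blk)
  then show "coef (heatop t (cst c)) k = coef (cst c) k" using t by auto
qed

text \<open>Around a stationary state the defect consists of the initial error alone. On a time span
  h that does not depend on e, the error therefore at most doubles.\<close>

lemma stay_short:
  obtains h where "h > 0" "\<And>t e a. 0 \<le> t \<Longrightarrow> t \<le> h \<Longrightarrow> 0 < e \<Longrightarrow> e \<le> 1 \<Longrightarrow> norm (a - cst c) \<le> e / 2 \<Longrightarrow>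
    \<exists>b. reach t a b \<and> norm (b - cst c) \<le> e"
proof -
  define V where "V = cst (\<kappa> * c ^ p)"
  have V: "V \<in> U" unfolding V_def by (rule cst_U)
  have stat: "NL V (cst c) = 0"
    unfolding NL_def V_def by (rule ev_inj) simp
  obtain L0 where L0: "L0 \<ge> 0" "\<And>V a b. norm a \<le> norm (cst c) + 1 \<Longrightarrow> norm b \<le> norm (cst c) + 1 \<Longrightarrow>
      norm (NL V a - NL V b) \<le> (Cm * norm V + L0) * norm (a - b)"
    using NL_Lipschitz[of "norm (cst c) + 1"] by blast
  define L where "L = Cm * norm V + L0"
  have L: "L \<ge> 0" using L0 Cm_ge_1 by (simp add: L_def)
  define h where "h = 1 / (2 * (L + 1))"
  have h: "h > 0" "L * h \<le> 1 / 2" using L by (auto simp: h_def field_simps)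
  have "\<exists>b. reach t a b \<and> norm (b - cst c) \<le> e"
    if t: "0 \<le> t" "t \<le> h" and e: "0 < e" "e \<le> 1" and a: "norm (a - cst c) \<le> e / 2" for t e a
  proof -
    have "\<exists>w. continuous_on {0..t} w \<and> (\<forall>r\<in>{0..t}. norm (w r - cst c) \<le> e \<and>
        w r = heatop r a + integral {0..r} (\<lambda>q. heatop (r - q) (NL V (w q))))"
    proof (rule shadowing[of t e L 1 heatop "\<lambda>_. cst c" "NL V" a])
      show "continuous_on ({0..t} \<times> UNIV) (\<lambda>(t, x::(int^'d) hl2). heatop t x)" by (rule continuous_heatop)
      show "linear (heatop r :: (int^'d) hl2 \<Rightarrow> _)" if "r \<in> {0..t}" for r
        using that by (intro bounded_linear.linear bounded_linear_heat_on) auto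
      show "norm (heatop r x) \<le> 1 * norm x" if "r \<in> {0..t}" for r and x :: "(int^'d) hl2"
        using that norm_heat_on_le[of r UNIV x] by simp
      show "norm (NL V x - NL V y) \<le> L * norm (x - y)"
        if "norm (x - cst c) \<le> e" "norm (y - cst c) \<le> e" for x y
        unfolding L_def
        using that e norm_triangle_ineq[of "x - cst c" "cst c"] norm_triangle_ineq[of "y - cst c" "cst c"]
        by (intro L0(2)) auto
      have "L * t \<le> L * h" using t L by (intro mult_left_mono)
      then show "1 * L * t \<le> 1 / 2" using h by simp
      show "norm (heatop r a + integral {0..r} (\<lambda>q. heatop (r - q) (NL V (cst c))) - cst c) \<le> e / 2" if "r \<in> {0..t}" for r
      proof -
        have r: "0 \<le> r" using that by simp
        have "integral {0..r} (\<lambda>q. heatop (r - q) (NL V (cst c))) = integral {0..r} (\<lambda>q. 0)"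
          by (rule Henstock_Kurzweil_Integration.integral_cong)
            (simp add: stat linear_0[OF bounded_linear.linear[OF bounded_linear_heat_on]])
        moreover have "heatop r a - cst c = heatop r (a - cst c)"
          using r by (simp add: linear_diff[OF bounded_linear.linear[OF bounded_linear_heat_on]] heatop_cst)
        ultimately show ?thesis using norm_heat_on_le[OF r, of UNIV "a - cst c"] a by simp
      qed
    next
      fix w assume "continuous_on {0..t} w" "\<And>r. r \<in> {0..t} \<Longrightarrow> norm (w r - cst c) \<le> e"
        "\<And>r. r \<in> {0..t} \<Longrightarrow> w r = heatop r a + integral {0..r} (\<lambda>q. heatop (r - q) (NL V (w q)))"
      then show ?thesis by blast
    qed (use t e L continuous_NL in auto)
    then obtain w where w: "continuous_on {0..t} w" "\<And>r. r \<in> {0..t} \<Longrightarrow> norm (w r - cst c) \<le> e"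
        "\<And>r. r \<in> {0..t} \<Longrightarrow> w r = heatop r a + integral {0..r} (\<lambda>q. heatop (r - q) (NL V (w q)))" by blast
    have "reach t a (w t)" by (rule reachI[OF V t(1) w(1,3)])
    then show ?thesis using w(2)[of t] t by auto
  qed
  then show ?thesis using that h(1) by blast
qed

text \<open>Every t up to T is cut into the same number n of equal steps of length at most h. The
  error doubles at most n times, so a single initial tolerance serves for all waiting times.\<close>

lemma stay:
  assumes T: "0 \<le> T" and e: "0 < e"
  obtains \<eta> where "\<eta> > 0" "\<And>t a. 0 \<le> t \<Longrightarrow> t \<le> T \<Longrightarrow> norm (a - cst c) < \<eta> \<Longrightarrow> \<exists>b. reach t a b \<and> norm (b - cst c) < e"
proof -
  obtain h where h: "h > 0" "\<And>t e a. 0 \<le> t \<Longrightarrow> t \<le> h \<Longrightarrow> 0 < e \<Longrightarrow> e \<le> 1 \<Longrightarrow> norm (a - cst c) \<le> e / 2 \<Longrightarrow>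
    \<exists>b. reach t a b \<and> norm (b - cst c) \<le> e"
    using stay_short[of c] by metis
  have steps: "\<exists>b. reach t a b \<and> norm (b - cst c) \<le> e"
    if "0 \<le> t" "t \<le> real n * h" "0 < e" "e \<le> 1" "norm (a - cst c) \<le> e / 2 ^ n" for n t e a
    using that
  proof (induction n arbitrary: t e a)
    case 0
    then show ?case using reach_0 by auto
  next
    case (Suc n)
    define t1 where "t1 = t * real n / real (Suc n)"
    define t2 where "t2 = t / real (Suc n)"
    have "t * real n + t = t * real (Suc n)" by (simp add: algebra_simps)
    then have t: "0 \<le> t1" "0 \<le> t2" "t1 + t2 = t"
      using Suc.prems unfolding t1_def t2_def add_divide_distrib[symmetric] by auto
    have t2: "t2 \<le> h" using Suc.prems(2) by (simp add: t2_def divide_le_eq mult.commute)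
    have "t1 = real n * t2" by (simp add: t1_def t2_def)
    then have t1: "t1 \<le> real n * h" using t2 by (simp add: mult_left_mono)
    obtain b where b: "reach t1 a b" "norm (b - cst c) \<le> e / 2"
      using Suc.IH[of t1 "e / 2" a] t t1 Suc.prems by auto
    obtain b' where b': "reach t2 b b'" "norm (b' - cst c) \<le> e"
      using h(2)[OF t(2) t2 Suc.prems(3,4) b(2)] by blast
    show ?case using reach_trans[OF b(1) b'(1)] b'(2) t(3) by auto
  qed
  obtain n :: nat where n: "T / h \<le> real n" using real_arch_simple by blast
  then have nT: "T \<le> real n * h" using h(1) by (simp add: divide_le_eq)
  define e' where "e' = min 1 (e / 2)"
  have e': "0 < e'" "e' \<le> 1" "e' < e" using e by (auto simp: e'_def)
  show ?thesis
  proof (rule that[of "e' / 2 ^ n"])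
    fix t a assume "0 \<le> t" "t \<le> T" "norm (a - cst c) < e' / 2 ^ n"
    then obtain b where "reach t a b" "norm (b - cst c) \<le> e'" using steps[of t n e' a] nT e' by auto
    then show "\<exists>b. reach t a b \<and> norm (b - cst c) < e" using e' by force
  qed (use e' in auto)
qed

text \<open>The surplus of time is spent near a constant, which the control \<open>\<kappa> c\<^sup>p\<close> makes stationary.\<close>

lemma steer_exact_time:
  assumes ac: "steer a (cst c)" and cb: "steer (cst c) b" and e: "0 < e" and T: "0 < T"
  obtains b' where "reach T a b'" "norm (b' - b) < e"
proof -
  \<comment> \<open>Tolerances are fixed backwards. The waiting time depends on \<tau>1, which is
    obtained last; therefore \<eta>2 has to be good for every waiting time up to T.\<close>
  obtain \<tau>3 \<eta>3 where 3: "\<tau>3 > 0" "\<tau>3 \<le> T / 2" "\<eta>3 > 0" "\<And>a'. norm (a' - cst c) < \<eta>3 \<Longrightarrow> \<exists>b'. reach \<tau>3 a' b' \<and> norm (b' - b) < e"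
    using cb e T unfolding steer_def by (metis half_gt_zero)
  obtain \<eta>2 where 2: "\<eta>2 > 0" "\<And>t a. 0 \<le> t \<Longrightarrow> t \<le> T \<Longrightarrow> norm (a - cst c) < \<eta>2 \<Longrightarrow> \<exists>b. reach t a b \<and> norm (b - cst c) < \<eta>3"
    using stay[of T \<eta>3 c] T 3(3) by auto
  obtain \<tau>1 \<eta>1 where 1: "\<tau>1 > 0" "\<tau>1 \<le> T / 2" "\<eta>1 > 0" "\<And>a'. norm (a' - a) < \<eta>1 \<Longrightarrow> \<exists>b'. reach \<tau>1 a' b' \<and> norm (b' - cst c) < \<eta>2"
    using ac 2(1) T unfolding steer_def by (metis half_gt_zero)
  obtain x where x: "reach \<tau>1 a x" "norm (x - cst c) < \<eta>2" using 1(3) 1(4)[of a] by auto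
  obtain y where y: "reach (T - \<tau>1 - \<tau>3) x y" "norm (y - cst c) < \<eta>3"
    using 2(2)[of "T - \<tau>1 - \<tau>3" x] 1 3 x by auto
  obtain b' where b': "reach \<tau>3 y b'" "norm (b' - b) < e" using 3(4)[OF y(2)] by blast
  have "reach (\<tau>1 + (T - \<tau>1 - \<tau>3) + \<tau>3) a b'" by (rule reach_trans[OF reach_trans[OF x(1) y(1)] b'(1)])
  then show ?thesis using that b'(2) by simp
qed

section \<open>The gradient move\<close>

lemma continuous_conj_heat: "continuous_on ({0..T} \<times> UNIV) (\<lambda>(t, x). conj_heat A \<phi> \<epsilon> t x)"
  unfolding conj_heat_def case_prod_beta'
  by (intro mul.continuous_on continuous_on_const continuous_heat_on_joint continuous_intros) auto

text \<open>In the coordinates \<open>w = exp (- \<phi> / \<epsilon>) \<psi>\<close> the free equation has the linear part \<open>conj_heat\<close>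
  and the nonlinearity below.\<close>

definition conj_NL :: "(int^'d) hl2 \<Rightarrow> real \<Rightarrow> (int^'d) hl2 \<Rightarrow> (int^'d) hl2" where
  "conj_NL \<phi> \<epsilon> w = - \<kappa> *\<^sub>R (E ((real p / \<epsilon>) *\<^sub>R \<phi>) \<odot> pw w (Suc p))"

lemma E_conj_NL: "E ((1 / \<epsilon>) *\<^sub>R \<phi>) \<odot> conj_NL \<phi> \<epsilon> w = NL 0 (E ((1 / \<epsilon>) *\<^sub>R \<phi>) \<odot> w)"
proof (rule ev_inj)
  fix x
  have "exp (ev \<phi> x / \<epsilon>) * exp (real p * ev \<phi> x / \<epsilon>) = exp (ev \<phi> x / \<epsilon>) ^ Suc p"
    by (simp flip: exp_of_nat_mult)
  then show "ev (E ((1 / \<epsilon>) *\<^sub>R \<phi>) \<odot> conj_NL \<phi> \<epsilon> w) x = ev (NL 0 (E ((1 / \<epsilon>) *\<^sub>R \<phi>) \<odot> w)) x"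
    by (simp add: conj_NL_def NL_def mul.zero_left power_mult_distrib mult_ac)
qed

lemma continuous_conj_NL: "continuous_on UNIV (conj_NL \<phi> \<epsilon>)"
  unfolding conj_NL_def[abs_def] by (intro continuous_intros mul.continuous_on continuous_pw)

text \<open>Multiplying the Duhamel formula by exp (\<phi> / \<epsilon>) undoes the conjugation and
  leaves the free equation, with control 0.\<close>

lemma reach_conj:
  assumes T: "0 \<le> T" and w: "continuous_on {0..T} w"
    and eq: "\<And>t. t \<in> {0..T} \<Longrightarrow> w t = conj_heat UNIV \<phi> \<epsilon> t w0 + integral {0..t} (\<lambda>r. conj_heat UNIV \<phi> \<epsilon> (t - r) (conj_NL \<phi> \<epsilon> (w r)))"
  shows "reach T (E ((1 / \<epsilon>) *\<^sub>R \<phi>) \<odot> w0) (E ((1 / \<epsilon>) *\<^sub>R \<phi>) \<odot> w T)"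
proof (rule reachI[OF subspace_0[OF U] T])
  let ?e = "E ((1 / \<epsilon>) *\<^sub>R \<phi>)"
  show "continuous_on {0..T} (\<lambda>t. ?e \<odot> w t)" by (intro mul.continuous_on continuous_on_const w)
  fix t assume t: "t \<in> {0..T}"
  have ec: "?e \<odot> conj_heat UNIV \<phi> \<epsilon> r x = heatop r (?e \<odot> x)" for r x
    unfolding conj_heat_def E_cancel ..
  have c: "continuous_on {0..T} (\<lambda>r. conj_NL \<phi> \<epsilon> (w r))" by (rule continuous_on_compose2[OF continuous_conj_NL w]) simp
  have "?e \<odot> integral {0..t} (\<lambda>r. conj_heat UNIV \<phi> \<epsilon> (t - r) (conj_NL \<phi> \<epsilon> (w r))) =
     integral {0..t} ((\<lambda>x. ?e \<odot> x) \<circ> (\<lambda>r. conj_heat UNIV \<phi> \<epsilon> (t - r) (conj_NL \<phi> \<epsilon> (w r))))"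
    by (rule integral_linear[symmetric, OF Duhamel_integrable(2)[OF continuous_conj_heat c t] mul.bounded_linear_right])
  also have "\<dots> = integral {0..t} (\<lambda>r. heatop (t - r) (NL 0 (?e \<odot> w r)))" by (simp add: o_def ec E_conj_NL)
  finally show "?e \<odot> w t = heatop t (?e \<odot> w0) + integral {0..t} (\<lambda>r. heatop (t - r) (NL 0 (?e \<odot> w r)))"
    by (subst eq[OF t]) (simp add: mul.add_right ec)
qed

text \<open>The bound \<open>K\<close> on exp (p \<phi> / \<epsilon>) for all \<epsilon> > 0 makes
  the constant independent of \<epsilon>. It expresses that \<phi> lies low enough.\<close>

lemma conj_NL_Lipschitz:
  assumes K: "\<And>\<epsilon>. 0 < \<epsilon> \<Longrightarrow> norm (E ((real p / \<epsilon>) *\<^sub>R \<phi>)) \<le> K"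
  shows "\<exists>L\<ge>0. \<forall>\<epsilon> a b. 0 < \<epsilon> \<longrightarrow> norm a \<le> R \<longrightarrow> norm b \<le> R \<longrightarrow>
     norm (conj_NL \<phi> \<epsilon> a) \<le> L \<and> norm (conj_NL \<phi> \<epsilon> a - conj_NL \<phi> \<epsilon> b) \<le> L * norm (a - b)"
proof -
  obtain L where L: "L \<ge> 0" "\<And>a b :: (int^'d) hl2. norm a \<le> R \<Longrightarrow> norm b \<le> R \<Longrightarrow>
      norm (pw a (Suc p)) \<le> L \<and> norm (pw a (Suc p) - pw b (Suc p)) \<le> L * norm (a - b)"
    using pw_Lipschitz[of R "Suc p"] by blast
  have K0: "K \<ge> 0" using order_trans[OF norm_ge_zero K[of 1]] by simp
  have le: "norm (\<kappa> *\<^sub>R (E ((real p / \<epsilon>) *\<^sub>R \<phi>) \<odot> x)) \<le> \<bar>\<kappa>\<bar> * Cm * K * B" if "0 < \<epsilon>" "norm x \<le> B" for \<epsilon> x B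
  proof -
    have "norm (E ((real p / \<epsilon>) *\<^sub>R \<phi>) \<odot> x) \<le> Cm * norm (E ((real p / \<epsilon>) *\<^sub>R \<phi>)) * norm x" by (rule norm_mul_le)
    also have "\<dots> \<le> Cm * K * B" using K[OF that(1)] K0 Cm_ge_1 that(2) by (intro mult_mono mult_left_mono) auto
    finally show ?thesis by (simp add: mult_left_mono mult.assoc)
  qed
  show ?thesis
  proof (intro exI[of _ "\<bar>\<kappa>\<bar> * Cm * K * L"] conjI allI impI)
    fix \<epsilon> a b assume \<epsilon>: "(0::real) < \<epsilon>" and ab: "norm (a :: (int^'d) hl2) \<le> R" "norm (b :: (int^'d) hl2) \<le> R"
    show "norm (conj_NL \<phi> \<epsilon> a) \<le> \<bar>\<kappa>\<bar> * Cm * K * L"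
      unfolding conj_NL_def using le[OF \<epsilon>] L(2)[OF ab] by simp
    have "conj_NL \<phi> \<epsilon> a - conj_NL \<phi> \<epsilon> b = - (\<kappa> *\<^sub>R (E ((real p / \<epsilon>) *\<^sub>R \<phi>) \<odot> (pw a (Suc p) - pw b (Suc p))))"
      unfolding conj_NL_def mul.diff_right scaleR_diff_right by simp
    also have "norm \<dots> \<le> \<bar>\<kappa>\<bar> * Cm * K * (L * norm (a - b))"
      unfolding norm_minus_cancel by (rule le[OF \<epsilon>]) (use L(2)[OF ab] in blast)
    finally show "norm (conj_NL \<phi> \<epsilon> a - conj_NL \<phi> \<epsilon> b) \<le> \<bar>\<kappa>\<bar> * Cm * K * L * norm (a - b)" by (simp add: mult.assoc)
  qed (use L K0 Cm_ge_1 in auto)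
qed

lemma conj_shadowing:
  assumes M: "M \<ge> 0" "\<And>t w. 0 \<le> t \<Longrightarrow> t \<le> T \<Longrightarrow> norm (conj_heat UNIV \<phi> \<epsilon> t w) \<le> M * norm w"
    and T: "0 \<le> T" and R: "0 \<le> R" and L: "0 \<le> L"
    and z: "continuous_on {0..T} z"
    and Lip: "\<And>a b. norm a \<le> B + R \<Longrightarrow> norm b \<le> B + R \<Longrightarrow> norm (conj_NL \<phi> \<epsilon> a - conj_NL \<phi> \<epsilon> b) \<le> L * norm (a - b)"
    and zB: "\<And>t. t \<in> {0..T} \<Longrightarrow> norm (z t) \<le> B"
    and small: "M * L * T \<le> 1 / 2"
    and defect: "\<And>t. t \<in> {0..T} \<Longrightarrow> norm (conj_heat UNIV \<phi> \<epsilon> t w0 + integral {0..t} (\<lambda>r. conj_heat UNIV \<phi> \<epsilon> (t - r) (conj_NL \<phi> \<epsilon> (z r))) - z t) \<le> R / 2"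
  shows "\<exists>w. continuous_on {0..T} w \<and> (\<forall>t\<in>{0..T}. norm (w t - z t) \<le> R \<and>
    w t = conj_heat UNIV \<phi> \<epsilon> t w0 + integral {0..t} (\<lambda>r. conj_heat UNIV \<phi> \<epsilon> (t - r) (conj_NL \<phi> \<epsilon> (w r))))"
proof (rule shadowing[of T R L M "conj_heat UNIV \<phi> \<epsilon>" z "conj_NL \<phi> \<epsilon>" w0])
  show "linear (conj_heat UNIV \<phi> \<epsilon> t)" if "t \<in> {0..T}" for t
    using that by (intro bounded_linear.linear bounded_linear_conj_heat) auto
  show "norm (conj_NL \<phi> \<epsilon> a - conj_NL \<phi> \<epsilon> b) \<le> L * norm (a - b)"
    if "t \<in> {0..T}" "norm (a - z t) \<le> R" "norm (b - z t) \<le> R" for t a b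
    using zB[OF that(1)] that(2,3) norm_triangle_ineq[of "a - z t" "z t"] norm_triangle_ineq[of "b - z t" "z t"]
    by (intro Lip) auto
  show "continuous_on ({0..T} \<times> UNIV) (\<lambda>(t, x). conj_heat UNIV \<phi> \<epsilon> t x)" by (rule continuous_conj_heat)
qed (use assms continuous_conj_NL in \<open>auto 0 3\<close>)

text \<open>Since \<open>M\<close> and \<open>L\<close> do not depend on \<epsilon>, the
  nonlinearity contributes only O(\<epsilon>^2) during the free leg, and in conjugated coordinates
  the flow stays close to \<open>conj_heat\<close>, whose limit is known. The outer legs are
  approximate steerings, so the free leg must tolerate a perturbed start.\<close>

lemma attainable_gradient:
  assumes \<phi>: "\<And>i. deriv_at i \<phi> (a i)" and att: "\<And>t. t *\<^sub>R \<phi> \<in> attainable"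
    and K: "\<And>\<epsilon>. 0 < \<epsilon> \<Longrightarrow> norm (E ((real p / \<epsilon>) *\<^sub>R \<phi>)) \<le> K"
  shows "(\<Sum>i\<in>UNIV. a i \<odot> a i) \<in> attainable"
  unfolding attainable_def
proof safe
  fix b
  define v where "v = E (\<Sum>i\<in>UNIV. a i \<odot> a i) \<odot> b"
  obtain M where M: "M \<ge> 0" "\<And>\<epsilon> t w. 0 < \<epsilon> \<Longrightarrow> 0 \<le> t \<Longrightarrow> t \<le> \<epsilon>\<^sup>2 \<Longrightarrow> norm (conj_heat UNIV \<phi> \<epsilon> t w) \<le> M * norm w"
    using norm_conj_heat_le[OF \<phi>, where A=UNIV] by blast
  define B where "B = M * norm b"
  obtain L where L: "L \<ge> 0" "\<And>\<epsilon> a. 0 < \<epsilon> \<Longrightarrow> norm a \<le> B + 2 \<Longrightarrow> norm (conj_NL \<phi> \<epsilon> a) \<le> L"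
     "\<And>\<epsilon> a b. 0 < \<epsilon> \<Longrightarrow> norm a \<le> B + 2 \<Longrightarrow> norm b \<le> B + 2 \<Longrightarrow> norm (conj_NL \<phi> \<epsilon> a - conj_NL \<phi> \<epsilon> b) \<le> L * norm (a - b)"
    using conj_NL_Lipschitz[OF K, where R="B + 2"] by blast
  have "steer b v"
    unfolding steer_def
  proof (intro allI impI)
    fix e T :: real assume e: "e > 0" and T: "T > 0"
    define R where "R = min 1 (e / 4)"
    have R: "0 < R" "R \<le> 1" "R \<le> e / 4" using e by (auto simp: R_def)
    have "\<forall>\<^sub>F \<epsilon> in at_right 0. dist (conj_heat UNIV \<phi> \<epsilon> (\<epsilon>\<^sup>2) b) v < e / 4"
      using tendstoD[OF conj_heat_tendsto[OF \<phi>, where A=UNIV], of "e / 4"] e unfolding v_def by simp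
    moreover have "\<forall>\<^sub>F \<epsilon> in at_right 0. \<epsilon>\<^sup>2 < T / 3"
    proof (rule order_tendstoD)
      show "((\<lambda>\<epsilon>::real. \<epsilon>\<^sup>2) \<longlongrightarrow> 0\<^sup>2) (at_right 0)" by (intro tendsto_intros)
    qed (use T in simp)
    moreover have "\<forall>\<^sub>F \<epsilon> in at_right 0. M * L * \<epsilon>\<^sup>2 < R / 2"
    proof (rule order_tendstoD)
      show "((\<lambda>\<epsilon>::real. M * L * \<epsilon>\<^sup>2) \<longlongrightarrow> M * L * 0\<^sup>2) (at_right 0)" by (intro tendsto_intros)
    qed (use R in simp)
    moreover have "\<forall>\<^sub>F \<epsilon>::real in at_right 0. 0 < \<epsilon>" by (simp add: eventually_at_filter)
    ultimately have "\<forall>\<^sub>F \<epsilon> in at_right 0. dist (conj_heat UNIV \<phi> \<epsilon> (\<epsilon>\<^sup>2) b) v < e / 4 \<and> \<epsilon>\<^sup>2 < T / 3 \<and>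
        M * L * \<epsilon>\<^sup>2 < R / 2 \<and> 0 < \<epsilon>"
      by eventually_elim auto
    then obtain \<epsilon> where \<epsilon>: "dist (conj_heat UNIV \<phi> \<epsilon> (\<epsilon>\<^sup>2) b) v < e / 4" "\<epsilon>\<^sup>2 < T / 3" "M * L * \<epsilon>\<^sup>2 < R / 2" "0 < \<epsilon>"
      by (metis (no_types, lifting) eventually_happens trivial_limit_at_right_real)
    have MLT: "M * L * \<epsilon>\<^sup>2 \<le> 1 / 2" using \<epsilon>(3) R(2) by linarith
    have Mt: "norm (conj_heat UNIV \<phi> \<epsilon> t w) \<le> M * norm w" if "0 \<le> t" "t \<le> \<epsilon>\<^sup>2" for t w
      using M(2)[OF \<epsilon>(4) that] .
    define z where "z t = conj_heat UNIV \<phi> \<epsilon> t b" for t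
    have zc: "continuous_on {0..\<epsilon>\<^sup>2} z"
    proof -
      have "continuous_on {0..\<epsilon>\<^sup>2} (\<lambda>t. (t, b))" by (intro continuous_intros)
      from continuous_on_compose2[OF continuous_conj_heat[of "\<epsilon>\<^sup>2" UNIV \<phi> \<epsilon>] this] show ?thesis by (auto simp: z_def[abs_def])
    qed
    have zB: "norm (z t) \<le> B" if "t \<in> {0..\<epsilon>\<^sup>2}" for t unfolding z_def B_def using that by (intro Mt) auto
    \<comment> \<open>First use of shadowing: an exact nonlinear solution from \<open>b\<close> near
      the linear flow \<open>z\<close>.\<close>
    obtain ws where ws: "continuous_on {0..\<epsilon>\<^sup>2} ws" "\<And>t. t \<in> {0..\<epsilon>\<^sup>2} \<Longrightarrow> norm (ws t - z t) \<le> R"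
      "\<And>t. t \<in> {0..\<epsilon>\<^sup>2} \<Longrightarrow> ws t = conj_heat UNIV \<phi> \<epsilon> t b + integral {0..t} (\<lambda>r. conj_heat UNIV \<phi> \<epsilon> (t - r) (conj_NL \<phi> \<epsilon> (ws r)))"
    proof -
      have "\<exists>w. continuous_on {0..\<epsilon>\<^sup>2} w \<and> (\<forall>t\<in>{0..\<epsilon>\<^sup>2}. norm (w t - z t) \<le> R \<and>
        w t = conj_heat UNIV \<phi> \<epsilon> t b + integral {0..t} (\<lambda>r. conj_heat UNIV \<phi> \<epsilon> (t - r) (conj_NL \<phi> \<epsilon> (w r))))"
      proof (rule conj_shadowing[OF M(1) Mt, where L=L and B=B])
        fix t assume t: "t \<in> {0..\<epsilon>\<^sup>2}"
        have c: "continuous_on {0..\<epsilon>\<^sup>2} (\<lambda>r. conj_NL \<phi> \<epsilon> (z r))" by (rule continuous_on_compose2[OF continuous_conj_NL zc]) simp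
        have "norm (integral {0..t} (\<lambda>r. conj_heat UNIV \<phi> \<epsilon> (t - r) (conj_NL \<phi> \<epsilon> (z r)))) \<le> (M * L) * (t - 0)"
        proof (rule integral_bound)
          show "continuous_on {0..t} (\<lambda>r. conj_heat UNIV \<phi> \<epsilon> (t - r) (conj_NL \<phi> \<epsilon> (z r)))"
            by (rule Duhamel_integrable(1)[OF continuous_conj_heat c t])
          fix r assume r: "r \<in> {0..t}"
          have "norm (conj_heat UNIV \<phi> \<epsilon> (t - r) (conj_NL \<phi> \<epsilon> (z r))) \<le> M * norm (conj_NL \<phi> \<epsilon> (z r))"
            using r t by (intro Mt) auto
          also have "norm (conj_NL \<phi> \<epsilon> (z r)) \<le> L" using zB[of r] r t by (intro L(2) \<epsilon>(4)) auto
          finally show "norm (conj_heat UNIV \<phi> \<epsilon> (t - r) (conj_NL \<phi> \<epsilon> (z r))) \<le> M * L" using M(1) by (simp add: mult_left_mono)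
        qed (use t in auto)
        also have "\<dots> \<le> M * L * \<epsilon>\<^sup>2" using t M(1) L(1) by (intro mult_left_mono) auto
        finally show "norm (conj_heat UNIV \<phi> \<epsilon> t b + integral {0..t} (\<lambda>r. conj_heat UNIV \<phi> \<epsilon> (t - r) (conj_NL \<phi> \<epsilon> (z r))) - z t) \<le> R / 2"
          using \<epsilon>(3) by (simp add: z_def)
      next
        fix x y :: "(int^'d) hl2" assume "norm x \<le> B + R" "norm y \<le> B + R"
        then show "norm (conj_NL \<phi> \<epsilon> x - conj_NL \<phi> \<epsilon> y) \<le> L * norm (x - y)" using R by (intro L(3) \<epsilon>(4)) auto
      qed (use R L(1) zc zB MLT in auto)
      then show ?thesis using that by blast
    qed
    define w1 where "w1 = ws (\<epsilon>\<^sup>2)"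
    have w1v: "norm (w1 - v) < e / 2"
    proof -
      have "norm (w1 - z (\<epsilon>\<^sup>2)) \<le> e / 4" using ws(2)[of "\<epsilon>\<^sup>2"] R(3) by (simp add: w1_def)
      moreover have "norm (z (\<epsilon>\<^sup>2) - v) < e / 4" using \<epsilon>(1) by (simp add: z_def dist_norm)
      ultimately show ?thesis using norm_triangle_ineq[of "w1 - z (\<epsilon>\<^sup>2)" "z (\<epsilon>\<^sup>2) - v"] by simp
    qed
    let ?e = "E ((1 / \<epsilon>) *\<^sub>R \<phi>)" and ?e' = "E (- ((1 / \<epsilon>) *\<^sub>R \<phi>))"
    \<comment> \<open>The last leg is steered from the exact endpoint of the reference solution. Its
      tolerance \<eta>3 depends on this point, hence on \<epsilon>, and is therefore chosen only
      now.\<close>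
    define y0 where "y0 = ?e \<odot> w1"
    have "steer y0 (?e' \<odot> y0)" using att[of "- (1 / \<epsilon>)"] unfolding attainable_def by simp
    then have "steer y0 w1" unfolding y0_def E_cancel .
    then obtain \<tau>3 \<eta>3 where 3: "\<tau>3 > 0" "\<tau>3 \<le> T / 3" "\<eta>3 > 0" "\<And>a'. norm (a' - y0) < \<eta>3 \<Longrightarrow> \<exists>b'. reach \<tau>3 a' b' \<and> norm (b' - w1) < e / 2"
      using e T unfolding steer_def by (metis half_gt_zero zero_less_divide_iff zero_less_numeral)
    define R2 where "R2 = min 1 (\<eta>3 / (2 * (Cm * norm ?e + 1)))"
    have ce: "0 < Cm * norm ?e + 1" using Cm_ge_1 by (simp add: add_nonneg_pos)
    have R2: "0 < R2" "R2 \<le> 1" "Cm * norm ?e * R2 < \<eta>3"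
    proof -
      show "0 < R2" "R2 \<le> 1" using 3(3) ce by (auto simp: R2_def)
      have "R2 \<le> \<eta>3 / (2 * (Cm * norm ?e + 1))" by (simp add: R2_def)
      then have "(2 * (Cm * norm ?e + 1)) * R2 \<le> \<eta>3" using ce by (simp only: pos_le_divide_eq mult_pos_pos zero_less_numeral mult.commute)
      moreover have "(2 * (Cm * norm ?e + 1)) * R2 = 2 * (Cm * norm ?e * R2) + 2 * R2" by (simp only: distrib_left distrib_right mult.assoc mult_1 mult_1_right)
      moreover have "0 \<le> Cm * norm ?e * R2" using \<open>0 < R2\<close> Cm_ge_1 by simp
      ultimately show "Cm * norm ?e * R2 < \<eta>3" using \<open>0 < R2\<close> by linarith
    qed
    \<comment> \<open>Passing to conjugated coordinates amplifies an initial error by at most Cm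
      times the norm of exp (- \<phi> / \<epsilon>), and the flow by at most M. For the fixed
      \<epsilon> both are finite, and \<eta>2 absorbs them.\<close>
    define \<eta>2 where "\<eta>2 = R2 / (2 * (M + 1) * (Cm * norm ?e' + 1))"
    have ce': "0 < Cm * norm ?e' + 1" using Cm_ge_1 by (simp add: add_nonneg_pos)
    have \<eta>2: "\<eta>2 > 0" using R2(1) ce' M(1) by (simp add: \<eta>2_def)
    have \<eta>2M: "M * (Cm * norm ?e' * \<eta>2) \<le> R2 / 2"
    proof -
      have "M * (Cm * norm ?e' * \<eta>2) \<le> (M + 1) * ((Cm * norm ?e' + 1) * \<eta>2)"
        using M(1) Cm_ge_1 \<eta>2 by (intro mult_mono) auto
      also have "\<dots> = R2 / 2"
      proof -
        have "m * (n * (r / (2 * m * n))) = r / 2" if "m \<noteq> 0" "n \<noteq> 0" for m n r :: real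
          using that by (simp add: field_simps)
        then show ?thesis unfolding \<eta>2_def using ce' M(1) by (metis add_nonneg_pos less_irrefl zero_less_one)
      qed
      finally show ?thesis .
    qed
    have flow: "\<exists>y. reach (\<epsilon>\<^sup>2) x y \<and> norm (y - y0) < \<eta>3" if x: "norm (x - ?e \<odot> b) < \<eta>2" for x
    proof -
      define w0 where "w0 = ?e' \<odot> x"
      have "w0 - b = ?e' \<odot> (x - ?e \<odot> b)" unfolding w0_def mul.diff_right E_cancel ..
      then have "norm (w0 - b) \<le> Cm * norm ?e' * norm (x - ?e \<odot> b)" using norm_mul_le by metis
      also have "\<dots> \<le> Cm * norm ?e' * \<eta>2" using x Cm_ge_1 by (intro mult_left_mono) auto
      finally have w0b: "M * norm (w0 - b) \<le> R2 / 2" using \<eta>2M mult_left_mono[OF _ M(1)] order_trans by blast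
      \<comment> \<open>Second use of shadowing, around the exact solution \<open>ws\<close>: the
        defect is now only the transported initial error, so this is continuous dependence on the
        initial value.\<close>
      have "\<exists>w. continuous_on {0..\<epsilon>\<^sup>2} w \<and> (\<forall>t\<in>{0..\<epsilon>\<^sup>2}. norm (w t - ws t) \<le> R2 \<and>
        w t = conj_heat UNIV \<phi> \<epsilon> t w0 + integral {0..t} (\<lambda>r. conj_heat UNIV \<phi> \<epsilon> (t - r) (conj_NL \<phi> \<epsilon> (w r))))"
      proof (rule conj_shadowing[OF M(1) Mt, where L=L and B="B + 1"])
        show "norm (ws t) \<le> B + 1" if "t \<in> {0..\<epsilon>\<^sup>2}" for t
          using ws(2)[OF that] zB[OF that] R(2) norm_triangle_ineq[of "ws t - z t" "z t"] by simp
        fix t assume t: "t \<in> {0..\<epsilon>\<^sup>2}"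
        then have "linear (conj_heat UNIV \<phi> \<epsilon> t)" by (intro bounded_linear.linear bounded_linear_conj_heat) auto
        from linear_diff[OF this, of w0 b]
        have "conj_heat UNIV \<phi> \<epsilon> t w0 + integral {0..t} (\<lambda>r. conj_heat UNIV \<phi> \<epsilon> (t - r) (conj_NL \<phi> \<epsilon> (ws r))) - ws t =
           conj_heat UNIV \<phi> \<epsilon> t (w0 - b)"
          by (subst ws(3)[OF t]) simp
        then show "norm (conj_heat UNIV \<phi> \<epsilon> t w0 + integral {0..t} (\<lambda>r. conj_heat UNIV \<phi> \<epsilon> (t - r) (conj_NL \<phi> \<epsilon> (ws r))) - ws t) \<le> R2 / 2"
          using order_trans[OF Mt[of t "w0 - b"] w0b] t by simp
      next
        fix x y :: "(int^'d) hl2" assume "norm x \<le> B + 1 + R2" "norm y \<le> B + 1 + R2"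
        then show "norm (conj_NL \<phi> \<epsilon> x - conj_NL \<phi> \<epsilon> y) \<le> L * norm (x - y)" using R2 by (intro L(3) \<epsilon>(4)) auto
      qed (use R2 L(1) ws(1) MLT in auto)
      then obtain w where w: "continuous_on {0..\<epsilon>\<^sup>2} w" "\<And>t. t \<in> {0..\<epsilon>\<^sup>2} \<Longrightarrow> norm (w t - ws t) \<le> R2"
        "\<And>t. t \<in> {0..\<epsilon>\<^sup>2} \<Longrightarrow> w t = conj_heat UNIV \<phi> \<epsilon> t w0 + integral {0..t} (\<lambda>r. conj_heat UNIV \<phi> \<epsilon> (t - r) (conj_NL \<phi> \<epsilon> (w r)))"
        by blast
      have "reach (\<epsilon>\<^sup>2) (?e \<odot> w0) (?e \<odot> w (\<epsilon>\<^sup>2))" by (rule reach_conj[OF _ w(1,3)]) auto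
      then have "reach (\<epsilon>\<^sup>2) x (?e \<odot> w (\<epsilon>\<^sup>2))" unfolding w0_def E_cancel .
      moreover have "norm (?e \<odot> w (\<epsilon>\<^sup>2) - y0) < \<eta>3"
      proof -
        have "norm (?e \<odot> w (\<epsilon>\<^sup>2) - y0) \<le> Cm * norm ?e * norm (w (\<epsilon>\<^sup>2) - w1)"
          unfolding y0_def mul.diff_right[symmetric] by (rule norm_mul_le)
        also have "\<dots> \<le> Cm * norm ?e * R2" using w(2)[of "\<epsilon>\<^sup>2"] Cm_ge_1 by (intro mult_left_mono) (auto simp: w1_def)
        finally show ?thesis using R2(3) by linarith
      qed
      ultimately show ?thesis by blast
    qed
    have "steer b (?e \<odot> b)" using att[of "1 / \<epsilon>"] unfolding attainable_def by simp
    then obtain \<tau>1 \<eta>1 where 1: "\<tau>1 > 0" "\<tau>1 \<le> T / 3" "\<eta>1 > 0" "\<And>a'. norm (a' - b) < \<eta>1 \<Longrightarrow> \<exists>b'. reach \<tau>1 a' b' \<and> norm (b' - ?e \<odot> b) < \<eta>2"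
      using \<eta>2 T unfolding steer_def by (metis zero_less_divide_iff zero_less_numeral)
    have "\<exists>c. reach (\<tau>1 + \<epsilon>\<^sup>2 + \<tau>3) a' c \<and> norm (c - v) < e" if a': "norm (a' - b) < \<eta>1" for a'
    proof -
      obtain x where x: "reach \<tau>1 a' x" "norm (x - ?e \<odot> b) < \<eta>2" using 1(4)[OF a'] by blast
      obtain y where y: "reach (\<epsilon>\<^sup>2) x y" "norm (y - y0) < \<eta>3" using flow[OF x(2)] by blast
      obtain c where c: "reach \<tau>3 y c" "norm (c - w1) < e / 2" using 3(4)[OF y(2)] by blast
      have "norm (c - v) < e" using norm_add_less[OF c(2) w1v] by simp
      then show ?thesis using reach_trans[OF reach_trans[OF x(1) y(1)] c(1)] by blast
    qed
    then show "\<exists>\<tau>>0. \<tau> \<le> T \<and> (\<exists>\<eta>>0. \<forall>a'. norm (a' - b) < \<eta> \<longrightarrow> (\<exists>b'. reach \<tau> a' b' \<and> norm (b' - v) < e))"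
      using 1 3 \<epsilon> by (intro exI[of _ "\<tau>1 + \<epsilon>\<^sup>2 + \<tau>3"] conjI exI[of _ \<eta>1]) (auto simp: add_pos_pos)
  qed
  then show "steer b (E (\<Sum>i\<in>UNIV. a i \<odot> a i) \<odot> b)" by (simp add: v_def)
qed

end

section \<open>Saturation of the frequencies\<close>

definition int_dot :: "int^'d::finite \<Rightarrow> int^'d \<Rightarrow> int" where
  "int_dot k l = (\<Sum>i\<in>UNIV. k $ i * l $ i)"

lemma int_dot_axis [simp]: "int_dot k (axis i c) = k $ i * c" "int_dot (axis i c) k = c * k $ i"
  by (simp_all add: int_dot_def axis_def if_distrib[of "\<lambda>x. _ * x"] if_distrib[of "\<lambda>x. x * _"] cong: if_cong)

lemma int_dot_uminus [simp]: "int_dot k (- l) = - int_dot k l"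
  by (simp add: int_dot_def sum_negf)

text \<open>Adding \<open>\<plusminus> e\<^sub>i\<close> is possible as long as the \<open>i\<close>-th coordinate of the starting point is not 0. So
  all sign vectors are reached first, with steps of length 2 over 0, and from there the coordinates are
  changed one by one.\<close>

lemma frequencies_saturated:
  fixes F :: "(int^'d::{finite,linorder}) set"
  assumes base: "control_freqs \<subseteq> F" and neg: "\<And>k. k \<in> F \<Longrightarrow> - k \<in> F"
    and add: "\<And>k l. k \<in> F \<Longrightarrow> l \<in> F \<Longrightarrow> int_dot k l \<noteq> 0 \<Longrightarrow> k + l \<in> F"
  shows "k \<in> F"
proof -
  have one: "(\<chi> i. 1) \<in> F" and ax: "i \<noteq> Max UNIV \<Longrightarrow> axis i 1 \<in> F" for i
    using base by (auto simp: control_freqs_def)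
  \<comment> \<open>Removing from (1,...,1) the unit vectors that are given, one at a time, leaves
    the missing last one. Each removal is allowed because the coordinate concerned is still
    1.\<close>
  have "(\<chi> j. if j \<in> A then 0 else 1) \<in> F" if "Max UNIV \<notin> A" for A
    using finite[of A] that
  proof (induction A rule: finite_induct)
    case (insert i A)
    have "(\<chi> j. if j \<in> A then 0 else 1) + - axis i 1 \<in> F"
      by (rule add) (use insert ax neg in auto)
    also have "(\<chi> j. if j \<in> A then 0 else 1) + - axis i 1 = (\<chi> j. if j \<in> insert i A then 0 else (1::int))"
      using insert by (auto simp: vec_eq_iff axis_def)
    finally show ?case .
  qed (use one in simp)
  from this[of "UNIV - {Max UNIV}"] have "(\<chi> j. if j \<in> UNIV - {Max UNIV} then 0 else 1) \<in> F" by simp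
  also have "(\<chi> j. if j \<in> UNIV - {Max UNIV} then 0 else 1) = axis (Max UNIV) (1::int)"
    by (auto simp: vec_eq_iff axis_def)
  finally have ax: "axis i 1 \<in> F" for i using ax by (cases "i = Max UNIV") auto
  have ax2: "- axis i 2 \<in> F" for i
  proof -
    have "axis i 1 + axis i 1 \<in> F" by (rule add) (use ax in auto)
    also have "axis i 1 + axis i 1 = axis i (2::int)" by (simp add: vec_eq_iff axis_def)
    finally show ?thesis by (rule neg)
  qed
  have sign: "(\<chi> j. if j \<in> A then - 1 else 1) \<in> F" for A
    using finite[of A]
  proof (induction A rule: finite_induct)
    case (insert i A)
    have "(\<chi> j. if j \<in> A then - 1 else 1) + - axis i 2 \<in> F"
      by (rule add) (use insert ax2 in auto)
    also have "(\<chi> j. if j \<in> A then - 1 else 1) + - axis i 2 = (\<chi> j. if j \<in> insert i A then - 1 else (1::int))"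
      using insert by (auto simp: vec_eq_iff axis_def)
    finally show ?case .
  qed (use one in simp)
  \<comment> \<open>\<open>A\<close> is the set of coordinates that may already be arbitrary; the
    others are still signs.\<close>
  have "\<forall>k. (\<forall>i. i \<notin> A \<longrightarrow> k $ i = 1 \<or> k $ i = - 1) \<longrightarrow> k \<in> F" for A
    using finite[of A]
  proof (induction A rule: finite_induct)
    case empty
    show ?case
    proof (intro allI impI)
      fix k :: "int^'d::{finite,linorder}" assume k: "\<forall>i. i \<notin> {} \<longrightarrow> k $ i = 1 \<or> k $ i = - 1"
      have "k = (\<chi> j. if j \<in> {i. k $ i = - 1} then - 1 else 1)"
        using k by (auto simp: vec_eq_iff)
      then show "k \<in> F" using sign by metis
    qed
  next
    case (insert i A)
    show ?case
    proof (intro allI impI)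
      fix k :: "int^'d::{finite,linorder}" assume k: "\<forall>j. j \<notin> insert i A \<longrightarrow> k $ j = 1 \<or> k $ j = - 1"
      define u where "u n = (\<chi> j. if j = i then n else k $ j)" for n
      have u_step: "u (n + 1) \<in> F" if "u n \<in> F" "n \<noteq> 0" for n
      proof -
        have "u n + axis i 1 \<in> F" by (rule add) (use that ax in \<open>auto simp: u_def\<close>)
        also have "u n + axis i 1 = u (n + 1)" by (auto simp: vec_eq_iff axis_def u_def)
        finally show ?thesis .
      qed
      have u_back: "u (n - 1) \<in> F" if "u n \<in> F" "n \<noteq> 0" for n
      proof -
        have "u n + - axis i 1 \<in> F" by (rule add) (use that ax neg in \<open>auto simp: u_def\<close>)
        also have "u n + - axis i 1 = u (n - 1)" by (auto simp: vec_eq_iff axis_def u_def)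
        finally show ?thesis .
      qed
      have "u 1 \<in> F" "u (- 1) \<in> F"
        using insert.IH k by (auto simp: u_def)
      have pos: "u n \<in> F" if "1 \<le> n" for n
        using that by (induction n rule: int_ge_induct) (use \<open>u 1 \<in> F\<close> u_step in auto)
      have ng: "u n \<in> F" if "n \<le> - 1" for n
        using that by (induction n rule: int_le_induct) (use \<open>u (- 1) \<in> F\<close> u_back in auto)
      \<comment> \<open>The value 0 is entered from 1 but cannot be left in this direction; that is
        why the negative values were started from - 1 separately.\<close>
      have "u 0 \<in> F" using u_back[of 1] \<open>u 1 \<in> F\<close> by simp
      moreover have "k $ i = 0 \<or> 1 \<le> k $ i \<or> k $ i \<le> - 1" by linarith
      ultimately have "u (k $ i) \<in> F" using pos[of "k $ i"] ng[of "k $ i"] by (elim disjE) simp_all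
      also have "u (k $ i) = k" by (auto simp: vec_eq_iff u_def)
      finally show "k \<in> F" .
    qed
  qed
  from this[of UNIV] show ?thesis by simp
qed

section \<open>From frequencies to all functions\<close>

context controlled begin

text \<open>Subtracting a large constant from \<open>\<phi>\<close> does not change the gradient, and it makes the nonlinear term
  harmless.\<close>

lemma attainable_gradient_shift:
  assumes \<phi>: "\<And>i. deriv_at i \<phi> (a i)" and att: "\<And>t. t *\<^sub>R \<phi> \<in> attainable"
  shows "(\<Sum>i\<in>UNIV. a i \<odot> a i) \<in> attainable"
proof -
  \<comment> \<open>The shift cancels exactly the exponential in \<open>norm_E_le\<close>: both
    sides scale with p / \<epsilon>, so the bound is the same for all \<epsilon>.\<close>
  define m where "m = Cm * norm \<phi>"
  define \<phi>' where "\<phi>' = \<phi> + cst (- m)"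
  show ?thesis
  proof (rule attainable_gradient[of \<phi>' a K1])
    show "deriv_at i \<phi>' (a i)" for i
      using deriv_at_add[OF \<phi>[of i] deriv_at_cst[of i "- m"]] by (simp add: \<phi>'_def)
    show "t *\<^sub>R \<phi>' \<in> attainable" for t
    proof -
      have "t *\<^sub>R \<phi>' = t *\<^sub>R \<phi> + cst (- (t * m))" by (rule ev_inj) (simp add: \<phi>'_def algebra_simps)
      then show ?thesis using attainable_add[OF att] cst_U U_subset_attainable by auto
    qed
    fix \<epsilon> :: real assume \<epsilon>: "0 < \<epsilon>"
    have "E ((real p / \<epsilon>) *\<^sub>R \<phi>') = exp (- (real p / \<epsilon> * m)) *\<^sub>R E ((real p / \<epsilon>) *\<^sub>R \<phi>)"
      by (rule ev_inj) (simp add: \<phi>'_def algebra_simps flip: exp_add)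
    then have "norm (E ((real p / \<epsilon>) *\<^sub>R \<phi>')) = exp (- (real p / \<epsilon> * m)) * norm (E ((real p / \<epsilon>) *\<^sub>R \<phi>))" by simp
    also have "\<dots> \<le> exp (- (real p / \<epsilon> * m)) * (K1 * exp (Cm * norm ((real p / \<epsilon>) *\<^sub>R \<phi>)))"
      by (intro mult_left_mono norm_E_le) simp
    also have "\<dots> = K1"
    proof -
      have "Cm * norm ((real p / \<epsilon>) *\<^sub>R \<phi>) = real p / \<epsilon> * m" using \<epsilon> by (simp add: m_def)
      then show ?thesis by (simp add: exp_minus)
    qed
    finally show "norm (E ((real p / \<epsilon>) *\<^sub>R \<phi>')) \<le> K1" .
  qed
qed

lemma blk_scaleR: "blk (r *\<^sub>R z) k = r *\<^sub>R blk z k" and blk_uminus_freq: "blk z (- k) = blk (cnj z) k"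
  and blk_0 [simp]: "blk 0 k = 0"
  by (rule ev_inj; simp add: ev_blk algebra_simps)+

text \<open>A squared gradient of two modes contains the frequencies 2k, 2l, k + l and k - l. Adding
  the same quantity for a second phase, a quarter period away, turns the pure squares into constants
  by Re^2 + Im^2 = 1 and combines the mixed terms to Re P Re Q - Im P Im Q = Re (P Q). Only k + l
  survives, with a coefficient proportional to k.l.\<close>

lemma attainable_blk_add:
  assumes k: "\<And>z. blk z k \<in> attainable" and l: "\<And>z. blk z l \<in> attainable" and kl: "int_dot k l \<noteq> 0"
  shows "blk w (k + l) \<in> attainable"
proof (cases "w = 0")
  case True
  then show ?thesis by (simp add: attainable_0)
next
  case False
  define n where "n = real_of_int (int_dot k l)"
  have n: "n \<noteq> 0" using kl by (simp add: n_def)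
  \<comment> \<open>The amplitude \<rho> and the unit phase \<open>z\<close> below solve 2 \<rho>^2
    n z = w; the sign of n goes into \<open>z\<close>, so that the root is taken of a nonnegative
    number.\<close>
  define \<rho> where "\<rho> = sqrt (cmod w / (2 * \<bar>n\<bar>))"
  have \<rho>: "\<rho>\<^sup>2 = cmod w / (2 * \<bar>n\<bar>)" by (simp add: \<rho>_def)
  define z where "z = of_real (sgn n) * w / cmod w"
  have z: "cmod z = 1" using False n by (simp add: z_def norm_mult norm_divide sgn_real_def)
  have zw: "2 * \<rho>\<^sup>2 * n * z = w"
    using False n by (auto simp: \<rho> z_def sgn_real_def field_simps)
  \<comment> \<open>\<open>a i\<close> and \<open>b i\<close> are the i-th derivatives of the two
    phases, whose block coefficients are - i z, - i and z, - 1.\<close>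
  define a where "a i = \<rho> *\<^sub>R (real_of_int (k $ i) *\<^sub>R blk z k + real_of_int (l $ i) *\<^sub>R blk 1 l)" for i
  define b where "b i = \<rho> *\<^sub>R (real_of_int (k $ i) *\<^sub>R blk (\<i> * z) k - real_of_int (l $ i) *\<^sub>R blk \<i> l)" for i
  have att: "t *\<^sub>R (\<rho> *\<^sub>R (blk x k + blk y l)) \<in> attainable" for t x y
    using attainable_add[OF k[of "(t * \<rho>) *\<^sub>R x"] l[of "(t * \<rho>) *\<^sub>R y"]]
    by (simp add: blk_scaleR scaleR_add_right)
  have "(\<Sum>i\<in>UNIV. a i \<odot> a i) \<in> attainable"
  proof (rule attainable_gradient_shift[OF _ att[of _ "- \<i> * z" "- \<i>"]])
    fix i
    have "a i = \<rho> *\<^sub>R (blk (\<i> * of_int (k $ i) * (- \<i> * z)) k + blk (\<i> * of_int (l $ i) * (- \<i>)) l)"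
      by (rule ev_inj) (simp add: a_def ev_blk algebra_simps)
    then show "deriv_at i (\<rho> *\<^sub>R (blk (- \<i> * z) k + blk (- \<i>) l)) (a i)"
      by (simp only: deriv_at_scaleR deriv_at_add deriv_at_blk)
  qed
  moreover have "(\<Sum>i\<in>UNIV. b i \<odot> b i) \<in> attainable"
  proof (rule attainable_gradient_shift[OF _ att[of _ z "- 1"]])
    fix i
    have "b i = \<rho> *\<^sub>R (blk (\<i> * of_int (k $ i) * z) k + blk (\<i> * of_int (l $ i) * (- 1)) l)"
      by (rule ev_inj) (simp add: b_def ev_blk algebra_simps)
    then show "deriv_at i (\<rho> *\<^sub>R (blk z k + blk (- 1) l)) (b i)"
      by (simp only: deriv_at_scaleR deriv_at_add deriv_at_blk)
  qed
  moreover define c where "c = \<rho>\<^sup>2 * (\<Sum>i\<in>UNIV. (real_of_int (k $ i))\<^sup>2 + (real_of_int (l $ i))\<^sup>2)"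
  have "cst (- c) \<in> attainable" using cst_U U_subset_attainable by blast
  ultimately have "(\<Sum>i\<in>UNIV. a i \<odot> a i) + (\<Sum>i\<in>UNIV. b i \<odot> b i) + cst (- c) \<in> attainable"
    by (intro attainable_add)
  also have "(\<Sum>i\<in>UNIV. a i \<odot> a i) + (\<Sum>i\<in>UNIV. b i \<odot> b i) + cst (- c) = blk w (k + l)"
  proof (rule ev_inj)
    fix x
    define P where "P = z * cis (freq_dot k x)"
    define Q where "Q = cis (freq_dot l x)"
    have PQ: "(Re P)\<^sup>2 + (Im P)\<^sup>2 = 1" "(Re Q)\<^sup>2 + (Im Q)\<^sup>2 = 1"
      using z by (simp_all only: cmod_power2[symmetric] P_def Q_def norm_mult norm_cis mult_1_right power_one)
    have "ev (a i \<odot> a i + b i \<odot> b i) x = \<rho>\<^sup>2 * ((real_of_int (k $ i))\<^sup>2 + (real_of_int (l $ i))\<^sup>2) +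
        2 * \<rho>\<^sup>2 * (real_of_int (k $ i) * real_of_int (l $ i)) * Re (P * Q)" for i
    proof -
      have ea: "ev (a i) x = \<rho> * (k $ i * Re P + l $ i * Re Q)"
        by (simp add: a_def ev_blk P_def Q_def)
      have eb: "ev (b i) x = \<rho> * (l $ i * Im Q - k $ i * Im P)"
        by (simp add: b_def ev_blk P_def Q_def algebra_simps)
      have "ev (a i \<odot> a i + b i \<odot> b i) x = \<rho>\<^sup>2 * ((real_of_int (k $ i))\<^sup>2 * ((Re P)\<^sup>2 + (Im P)\<^sup>2) +
         (real_of_int (l $ i))\<^sup>2 * ((Re Q)\<^sup>2 + (Im Q)\<^sup>2) + 2 * (k $ i * l $ i) * (Re P * Re Q - Im P * Im Q))"
        by (simp add: ea eb power2_eq_square algebra_simps)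
      then show ?thesis unfolding PQ by (simp add: algebra_simps)
    qed
    then have "(\<Sum>i\<in>UNIV. ev (a i \<odot> a i + b i \<odot> b i) x) = c + 2 * \<rho>\<^sup>2 * n * Re (P * Q)"
      by (simp only: sum.distrib sum_distrib_left[symmetric] sum_distrib_right[symmetric] c_def n_def int_dot_def of_int_sum of_int_mult)
    also have "2 * \<rho>\<^sup>2 * n * Re (P * Q) = Re (w * cis (freq_dot (k + l) x))"
      unfolding zw[symmetric] by (simp add: P_def Q_def cis_mult[symmetric] algebra_simps)
    finally show "ev ((\<Sum>i\<in>UNIV. a i \<odot> a i) + (\<Sum>i\<in>UNIV. b i \<odot> b i) + cst (- c)) x = ev (blk w (k + l)) x"
      by (simp add: sum.distrib ev_blk)
  qed
  finally show ?thesis .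
qed

text \<open>Only sums and limits of attainable exponents are known to be attainable, not negatives
  or multiples. The induction therefore carries all real multiples of f along.\<close>

lemma attainable_UNIV:
  assumes "\<And>k z. blk z k \<in> attainable"
  shows "f \<in> attainable"
proof -
  have "\<forall>t. t *\<^sub>R f \<in> attainable"
  proof (induction f rule: blk_induct)
    case (blk z k)
    show ?case using assms by (simp flip: blk_scaleR)
  next
    case closed
    have "{f. \<forall>t::real. t *\<^sub>R f \<in> attainable} = (\<Inter>t. (\<lambda>f. t *\<^sub>R f) -` attainable)" by auto
    then show ?case
      by (simp add: closed_INT continuous_closed_vimage closed_attainable continuous_intros)
  qed (auto simp: attainable_0 scaleR_add_right intro: attainable_add)
  from this[rule_format, of 1] show ?thesis by simp
qed

end

section \<open>From trajectories to mild solutions\<close>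

definition simple_fun_on :: "real \<Rightarrow> (real \<Rightarrow> 'a) \<Rightarrow> bool" where
  "simple_fun_on t S \<longleftrightarrow> finite (S ` {0<..<t}) \<and> (\<forall>a. {r \<in> {0<..<t}. S r = a} \<in> sets borel)"

text \<open>Any map applied to two simple functions is a finite combination of indicators of
  intersections of level sets. This yields measurability of distances and of controls.\<close>

lemma simple_fun_on_measurable:
  fixes \<phi> :: "'a \<Rightarrow> 'b \<Rightarrow> 'c::{second_countable_topology, real_normed_vector}"
  assumes "simple_fun_on t S" "simple_fun_on t R"
  shows "(\<lambda>r. indicator {0<..<t} r *\<^sub>R \<phi> (S r) (R r)) \<in> borel_measurable borel"
proof -
  have eq: "(\<lambda>r. indicator {0<..<t} r *\<^sub>R \<phi> (S r) (R r)) = (\<lambda>r. \<Sum>a\<in>S ` {0<..<t}. \<Sum>b\<in>R ` {0<..<t}.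
    indicator ({r \<in> {0<..<t}. S r = a} \<inter> {r \<in> {0<..<t}. R r = b}) r *\<^sub>R \<phi> a b)"
  proof
    fix r
    show "indicator {0<..<t} r *\<^sub>R \<phi> (S r) (R r) = (\<Sum>a\<in>S ` {0<..<t}. \<Sum>b\<in>R ` {0<..<t}.
      indicator ({r \<in> {0<..<t}. S r = a} \<inter> {r \<in> {0<..<t}. R r = b}) r *\<^sub>R \<phi> a b)"
    proof (cases "r \<in> {0<..<t}")
      case True
      have "(\<Sum>b\<in>R ` {0<..<t}. indicator ({r \<in> {0<..<t}. S r = a} \<inter> {r \<in> {0<..<t}. R r = b}) r *\<^sub>R \<phi> a b) =
         (if a = S r then \<phi> a (R r) else 0)" for a
      proof -
        have "(\<Sum>b\<in>R ` {0<..<t}. indicator ({r \<in> {0<..<t}. S r = a} \<inter> {r \<in> {0<..<t}. R r = b}) r *\<^sub>R \<phi> a b) =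
          (\<Sum>b\<in>R ` {0<..<t}. if b = R r then (if a = S r then \<phi> a b else 0) else 0)"
          using True by (intro sum.cong) (auto simp: indicator_def)
        then show ?thesis using assms(2) True by (simp add: simple_fun_on_def)
      qed
      then show ?thesis using assms(1) True by (simp add: simple_fun_on_def)
    qed (simp add: indicator_def del: greaterThanLessThan_iff)
  qed
  have [measurable]: "{r \<in> {0<..<t}. S r = a} \<in> sets borel" "{r \<in> {0<..<t}. R r = b} \<in> sets borel" for a b
    using assms by (auto simp: simple_fun_on_def)
  show ?thesis unfolding eq by measurable
qed

lemma has_integral_simple_fun_on:
  fixes S :: "real \<Rightarrow> 'a::real_normed_vector"
  assumes "simple_fun_on t S" "0 \<le> t"
  shows "((\<lambda>r. if r \<in> {0<..<t} then S r else 0) has_integral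
    (\<Sum>a\<in>S ` {0<..<t}. measure lborel {r \<in> {0<..<t}. S r = a} *\<^sub>R a)) {0..t}"
proof -
  have fin: "finite (S ` {0<..<t})" and m: "{r \<in> {0<..<t}. S r = a} \<in> sets borel" for a
    using assms by (auto simp: simple_fun_on_def)
  have "((\<lambda>r. indicator {r \<in> {0<..<t}. S r = a} r *\<^sub>R a) has_integral measure lborel {r \<in> {0<..<t}. S r = a} *\<^sub>R a) {0..t}" for a
  proof (rule has_integral_scaleR_left)
    have "emeasure lborel {r \<in> {0<..<t}. S r = a} \<le> emeasure lborel {0<..<t}"
      by (rule emeasure_mono) auto
    then have "emeasure lborel {r \<in> {0<..<t}. S r = a} < \<infinity>"
      using assms(2) by (simp add: le_less_trans)
    from has_integral_measure_lborel[OF m this]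
    have "((\<lambda>r. if r \<in> {r \<in> {0<..<t}. S r = a} then 1 else 0) has_integral measure lborel {r \<in> {0<..<t}. S r = a}) {0..t}"
      by (subst has_integral_restrict) auto
    then show "(indicator {r \<in> {0<..<t}. S r = a} has_integral measure lborel {r \<in> {0<..<t}. S r = a}) {0..t}"
      by (simp add: indicator_def[abs_def] of_bool_def)
  qed
  then have "((\<lambda>r. \<Sum>a\<in>S ` {0<..<t}. indicator {r \<in> {0<..<t}. S r = a} r *\<^sub>R a) has_integral
    (\<Sum>a\<in>S ` {0<..<t}. measure lborel {r \<in> {0<..<t}. S r = a} *\<^sub>R a)) {0..t}"
    by (intro has_integral_sum fin)
  moreover have "(\<Sum>a\<in>S ` {0<..<t}. indicator {r \<in> {0<..<t}. S r = a} r *\<^sub>R a) = (if r \<in> {0<..<t} then S r else 0)" for r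
  proof (cases "r \<in> {0<..<t}")
    case True
    then have "(\<Sum>a\<in>S ` {0<..<t}. indicator {r \<in> {0<..<t}. S r = a} r *\<^sub>R a) = (\<Sum>a\<in>S ` {0<..<t}. if a = S r then a else 0)"
      by (intro sum.cong) (auto simp: indicator_def)
    then show ?thesis using True fin by simp
  qed (simp add: indicator_def del: greaterThanLessThan_iff)
  ultimately show ?thesis by simp
qed

context sobolev begin

text \<open>Uniform approximation by simple functions controls both integrals at once: on an
  interval of length t, the integral of the error is at most e n times t. So the gauge integral is
  also the limit of the integrals of the simple functions.\<close>

lemma has_Hs_integralI:
  fixes S :: "nat \<Rightarrow> real \<Rightarrow> (int^'d) hl2"
  assumes S: "\<And>n. simple_fun_on t (S n)" and t: "0 \<le> t"
    and conv: "\<And>n r. r \<in> {0<..<t} \<Longrightarrow> norm (G r - S n r) \<le> e n" and e: "e \<longlonglongrightarrow> 0" "\<And>n. 0 \<le> e n"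
    and F: "\<And>r. r \<in> {0<..<t} \<Longrightarrow> F r = ev (G r)"
    and G: "(G has_integral g) {0..t}"
  shows "has_Hs_integral s t F (ev g)"
  unfolding has_Hs_integral_def
proof (intro conjI exI[of _ "\<lambda>n r. ev (S n r)"] allI)
  have ev_minus: "(ev a - ev b) = ev (a - b)" for a b by (auto simp: fun_eq_iff)
  show "\<forall>r\<in>{0<..<t}. F r \<in> Hs s" "ev g \<in> Hs s" using F ev_in_Hs by auto
  have evi: "ev a = ev b \<longleftrightarrow> a = b" for a b using ev_inj by (metis)
  fix n
  have fin: "finite (S n ` {0<..<t})" and m: "{r \<in> {0<..<t}. S n r = a} \<in> sets borel" for a
    using S[of n] by (auto simp: simple_fun_on_def)
  have im: "(\<lambda>r. ev (S n r)) ` {0<..<t} = ev ` S n ` {0<..<t}" by auto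
  show "Hs_simple s t (\<lambda>r. ev (S n r))"
    unfolding Hs_simple_def
  proof (intro conjI allI)
    show "finite ((\<lambda>r. ev (S n r)) ` {0<..<t})" unfolding im using fin by simp
    show "(\<lambda>r. ev (S n r)) ` {0<..<t} \<subseteq> Hs s" using ev_in_Hs by auto
    fix f
    show "{r \<in> {0<..<t}. ev (S n r) = f} \<in> sets lborel"
    proof (cases "f \<in> range ev")
      case True
      then obtain a where "f = ev a" by auto
      then show ?thesis using m[of a] evi by simp
    next
      case False
      then have "{r \<in> {0<..<t}. ev (S n r) = f} = {}" by auto
      then show ?thesis by (simp only: sets.empty_sets)
    qed
  qed
  have norm_eq: "Hs_norm s (F r - ev (S n r)) = norm (G r - S n r)" if "r \<in> {0<..<t}" for r n
    using F[OF that] by (simp add: ev_minus Hs_norm_ev)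
  \<comment> \<open>The distance of the integrand to \<open>S n\<close> is the pointwise limit in m
    of the distances between the simple functions \<open>S m\<close> and \<open>S n\<close>.\<close>
  show "set_borel_measurable lborel {0<..<t} (\<lambda>r. Hs_norm s (F r - ev (S n r)))"
    unfolding set_borel_measurable_def
  proof (rule borel_measurable_LIMSEQ_real)
    fix r
    show "(\<lambda>m. indicator {0<..<t} r *\<^sub>R norm (S m r - S n r)) \<longlonglongrightarrow> indicator {0<..<t} r *\<^sub>R Hs_norm s (F r - ev (S n r))"
    proof (cases "r \<in> {0<..<t}")
      case True
      have "(\<lambda>m. S m r - G r) \<longlonglongrightarrow> 0"
        by (rule Lim_null_comparison[OF _ e(1)]) (use conv[OF True] in \<open>auto simp: norm_minus_commute\<close>)
      then have "(\<lambda>m. S m r) \<longlonglongrightarrow> G r" by (rule LIM_zero_cancel)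
      then show ?thesis unfolding norm_eq[OF True] by (intro tendsto_intros)
    qed simp
  next
    show "(\<lambda>r. indicator {0<..<t} r *\<^sub>R norm (S m r - S n r)) \<in> borel_measurable lborel" for m
      using simple_fun_on_measurable[OF S[of m] S[of n], of "\<lambda>a b. norm (a - b)"] by simp
  qed
  have nn_le: "(\<integral>\<^sup>+r\<in>{0<..<t}. ennreal (Hs_norm s (F r - ev (S n r))) \<partial>lborel) \<le> ennreal (e n * t)" for n
  proof -
    have "(\<integral>\<^sup>+r\<in>{0<..<t}. ennreal (Hs_norm s (F r - ev (S n r))) \<partial>lborel) \<le> (\<integral>\<^sup>+r\<in>{0<..<t}. ennreal (e n) \<partial>lborel)"
      by (rule nn_integral_mono) (auto simp: norm_eq indicator_def intro!: ennreal_leI conv)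
    also have "\<dots> = ennreal (e n) * ennreal t" using t by (simp add: nn_integral_cmult_indicator)
    finally show ?thesis using e(2) t by (simp add: ennreal_mult)
  qed
  have et: "(\<lambda>n. e n * t) \<longlonglongrightarrow> 0" using tendsto_mult[OF e(1) tendsto_const[of t]] by simp
  have et': "(\<lambda>n. ennreal (e n * t)) \<longlonglongrightarrow> 0"
    using tendsto_ennrealI[OF et] by simp
  show "(\<lambda>n. \<integral>\<^sup>+r\<in>{0<..<t}. ennreal (Hs_norm s (F r - ev (S n r))) \<partial>lborel) \<longlonglongrightarrow> 0"
    by (rule tendsto_sandwich[OF always_eventually always_eventually tendsto_const et']) (simp_all add: nn_le)
  define I where "I n = (\<Sum>a\<in>S n ` {0<..<t}. measure lborel {r \<in> {0<..<t}. S n r = a} *\<^sub>R a)" for n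
  have "simple_Hs_integral t (\<lambda>r. ev (S n r)) = ev (I n)" for n
  proof
    fix x
    have "simple_Hs_integral t (\<lambda>r. ev (S n r)) x =
      (\<Sum>f\<in>ev ` S n ` {0<..<t}. measure lborel {r \<in> {0<..<t}. ev (S n r) = f} * f x)"
      unfolding simple_Hs_integral_def by (simp add: image_image)
    also have "\<dots> = (\<Sum>a\<in>S n ` {0<..<t}. measure lborel {r \<in> {0<..<t}. ev (S n r) = ev a} * ev a x)"
      by (rule sum.reindex_cong[of ev]) (auto simp: inj_on_def evi)
    also have "\<dots> = ev (I n) x" by (simp add: I_def evi)
    finally show "simple_Hs_integral t (\<lambda>r. ev (S n r)) x = ev (I n) x" .
  qed
  then have "Hs_norm s (simple_Hs_integral t (\<lambda>r. ev (S n r)) - ev g) = norm (I n - g)" for n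
    by (simp add: ev_minus Hs_norm_ev)
  moreover have I_le: "norm (I n - g) \<le> e n * t" for n
  proof -
    have "((\<lambda>r. (if r \<in> {0<..<t} then S n r else 0) - G r) has_integral (I n - g)) (cbox 0 t)"
      using has_integral_diff[OF has_integral_simple_fun_on[OF S t] G] by (simp add: I_def)
    from has_integral_bound_spike_finite[OF e(2) _ this, of "{0, t}" n]
    show ?thesis using conv t by (force simp: norm_minus_commute)
  qed
  ultimately show "(\<lambda>n. Hs_norm s (simple_Hs_integral t (\<lambda>r. ev (S n r)) - ev g)) \<longlonglongrightarrow> 0"
    by (intro tendsto_sandwich[OF always_eventually always_eventually tendsto_const et]) simp_all
qed

lemma heat_ev: "0 \<le> t \<Longrightarrow> heat t (ev a) = ev (heatop t a)"
  by (auto simp: fun_eq_iff heat_def ev_def evc_def fourier_coeff_ev fc_def freq_norm_sq_def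
      intro!: arg_cong[of _ _ Re] infsum_cong)

end

context controlled begin

text \<open>For each of the finitely many control values the integrand is uniformly continuous in
  time, and a common modulus exists.\<close>

lemma ex_simple_approx:
  assumes u: "simple_control u" and \<psi>: "continuous_on {0..T} \<psi>" and t: "t \<in> {0..T}" and e: "0 < e"
  shows "\<exists>S. simple_fun_on t S \<and> (\<forall>r\<in>{0<..<t}. norm (heatop (t - r) (NL (u r) (\<psi> r)) - S r) \<le> e)"
proof (cases "t = 0")
  case True
  then show ?thesis by (auto simp: simple_fun_on_def)
next
  case False
  then have t0: "t > 0" using t by simp
  define h where "h c r = heatop (t - r) (NL c (\<psi> r))" for c r
  have fu: "finite (range u)" and mu: "{r. u r = c} \<in> sets borel" for c using u by (auto simp: simple_control_def)
  have "\<exists>d>0. \<forall>r\<in>{0..t}. \<forall>q\<in>{0..t}. dist q r < d \<longrightarrow> dist (h c q) (h c r) < e" for c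
  proof -
    have c: "continuous_on {0..T} (\<lambda>r. NL c (\<psi> r))" by (rule continuous_on_compose2[OF continuous_NL \<psi>]) simp
    have "uniformly_continuous_on {0..t} (h c)"
      unfolding h_def by (intro compact_uniformly_continuous Duhamel_integrable(1)[OF continuous_heatop c t] compact_Icc)
    then show ?thesis using e unfolding uniformly_continuous_on_def by meson
  qed
  then obtain d where d: "\<And>c. d c > 0" "\<And>c r q. r \<in> {0..t} \<Longrightarrow> q \<in> {0..t} \<Longrightarrow> dist q r < d c \<Longrightarrow> dist (h c q) (h c r) < e"
    by metis
  obtain \<delta> where \<delta>: "\<delta> > 0" "\<And>c. c \<in> range u \<Longrightarrow> \<delta> \<le> d c"
  proof -
    have ne: "finite (d ` range u)" "d ` range u \<noteq> {}" using fu by auto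
    show ?thesis
    proof (rule that[of "Min (d ` range u)"])
      show "0 < Min (d ` range u)" using ne d(1) by (subst Min_gr_iff) auto
      show "Min (d ` range u) \<le> d c" if "c \<in> range u" for c using ne that by (intro Min_le) auto
    qed
  qed
  obtain N :: nat where N: "t / \<delta> < real N" using reals_Archimedean2 by blast
  then have N0: "real N > 0" using t0 \<delta>(1) by (meson divide_pos_pos less_trans)
  define j where "j r = \<lfloor>real N * r / t\<rfloor>" for r
  define \<rho> where "\<rho> r = real_of_int (j r) * t / real N" for r
  \<comment> \<open>Only the continuous dependence on time is frozen at the left grid point; the
    control is kept at r itself, since it may jump. The value depends on the pair of control value
    and cell index alone, of which there are finitely many.\<close>
  define S where "S r = h (u r) (\<rho> r)" for r
  have \<rho>: "\<rho> r \<in> {0..t}" "dist (\<rho> r) r < \<delta>" "0 \<le> j r" "j r \<le> int N" if r: "r \<in> {0<..<t}" for r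
  proof -
    have j: "real_of_int (j r) \<le> real N * r / t" "real N * r / t < real_of_int (j r) + 1" unfolding j_def by linarith+
    have "0 \<le> real N * r / t" using r N0 t0 by simp
    then show j0: "0 \<le> j r" by (simp add: j_def)
    have tN: "0 < t / real N" using t0 N0 by simp
    have e1: "real N * r / t * (t / real N) = r" using t0 N0 by simp
    have r1: "\<rho> r \<le> r" using mult_right_mono[OF j(1), of "t / real N"] tN e1 by (simp add: \<rho>_def)
    have r2: "r < \<rho> r + t / real N"
      using mult_strict_right_mono[OF j(2) tN] e1 by (simp add: \<rho>_def algebra_simps)
    have "t / real N < \<delta>" using N \<delta>(1) N0 by (simp add: field_simps)
    then show "dist (\<rho> r) r < \<delta>" using r1 r2 by (simp add: dist_real_def)
    show "\<rho> r \<in> {0..t}" using r1 r j0 t0 N0 by (auto simp: \<rho>_def)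
    have "real N * r / t \<le> real N" using r N0 t0 by (simp add: divide_le_eq)
    then show "j r \<le> int N" using j(1) by linarith
  qed
  have "simple_fun_on t S"
    unfolding simple_fun_on_def
  proof (intro conjI allI)
    define P where "P = range u \<times> {0..int N}"
    have P: "finite P" using fu by (simp add: P_def)
    define H where "H p = h (fst p) (real_of_int (snd p) * t / real N)" for p
    have S_eq: "S r = H (u r, j r)" for r by (simp add: S_def H_def \<rho>_def)
    have "S ` {0<..<t} \<subseteq> H ` P" using \<rho> by (auto simp: S_eq P_def)
    then show "finite (S ` {0<..<t})" using P finite_subset by blast
    fix a
    have "{r \<in> {0<..<t}. S r = a} = (\<Union>p\<in>{p\<in>P. H p = a}. {0<..<t} \<inter> ({r. u r = fst p} \<inter> {r. j r = snd p}))"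
      using \<rho> by (auto simp: S_eq P_def)
    moreover have "{r. j r = k} \<in> sets borel" for k
    proof -
      have "(\<lambda>r. \<lfloor>real N * r / t\<rfloor>) \<in> measurable borel (count_space UNIV)" by measurable
      from measurable_sets[OF this, of "{k}"] show ?thesis by (simp add: j_def vimage_def)
    qed
    ultimately show "{r \<in> {0<..<t}. S r = a} \<in> sets borel"
      using P mu by (auto intro!: sets.finite_UN sets.Int)
  qed
  moreover have "norm (heatop (t - r) (NL (u r) (\<psi> r)) - S r) \<le> e" if r: "r \<in> {0<..<t}" for r
    using d(2)[of "\<rho> r" r "u r"] \<rho>[OF r] \<delta>(2)[of "u r"] r by (simp add: S_def h_def dist_norm abs_minus_commute less_imp_le)
  ultimately show ?thesis by blast
qed

lemma mild_solution_ev: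
  fixes Q :: "real^'d \<Rightarrow> (real^'q::finite) \<times> real \<times> real"
  assumes tr: "trajectory u T \<psi>" and T: "0 \<le> T" and v: "\<And>r x. v r \<bullet> fst (Q x) = ev (u r) x"
  shows "mild_solution s \<kappa> p Q (ev (\<psi> 0)) (\<lambda>t. (v t, 0, 0)) T (\<lambda>t. ev (\<psi> t))"
  unfolding mild_solution_def
proof (intro conjI ballI)
  have u: "simple_control u" and \<psi>: "continuous_on {0..T} \<psi>"
    and int: "\<And>t. t \<in> {0..T} \<Longrightarrow> ((\<lambda>r. heatop (t - r) (NL (u r) (\<psi> r))) has_integral (\<psi> t - heatop t (\<psi> 0))) {0..t}"
    using tr by (auto simp: trajectory_def)
  fix t assume t: "t \<in> {0..T}"
  show "ev (\<psi> t) \<in> Hs s" by (rule ev_in_Hs)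
  have "(\<psi> \<longlongrightarrow> \<psi> t) (at t within {0..T})" using \<psi> t by (simp add: continuous_on)
  then have "((\<lambda>r. norm (\<psi> r - \<psi> t)) \<longlongrightarrow> 0) (at t within {0..T})" by (intro tendsto_norm_zero LIM_zero)
  moreover have "Hs_norm s (ev (\<psi> r) - ev (\<psi> t)) = norm (\<psi> r - \<psi> t)" for r
  proof -
    have "ev (\<psi> r) - ev (\<psi> t) = ev (\<psi> r - \<psi> t)" by (simp add: fun_eq_iff)
    then show ?thesis by (simp add: Hs_norm_ev)
  qed
  ultimately show "((\<lambda>r. Hs_norm s (ev (\<psi> r) - ev (\<psi> t))) \<longlongrightarrow> 0) (at t within {0..T})" by simp
  have F: "heat (t - r) (\<lambda>x. ((v r, 0, 0) \<bullet> Q x) * ev (\<psi> r) x - \<kappa> * ev (\<psi> r) x ^ (p + 1)) =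
     ev (heatop (t - r) (NL (u r) (\<psi> r)))" if "r \<in> {0<..<t}" for r
  proof -
    have "(\<lambda>x. ((v r, 0, 0) \<bullet> Q x) * ev (\<psi> r) x - \<kappa> * ev (\<psi> r) x ^ (p + 1)) = ev (NL (u r) (\<psi> r))"
      using v by (auto simp: fun_eq_iff NL_def inner_prod_def)
    then show ?thesis using that by (simp add: heat_ev)
  qed
  have "\<forall>n. \<exists>S. simple_fun_on t S \<and> (\<forall>r\<in>{0<..<t}. norm (heatop (t - r) (NL (u r) (\<psi> r)) - S r) \<le> inverse (real (Suc n)))"
    using ex_simple_approx[OF u \<psi> t] by simp
  then obtain S where S: "\<And>n. simple_fun_on t (S n)"
    "\<And>n r. r \<in> {0<..<t} \<Longrightarrow> norm (heatop (t - r) (NL (u r) (\<psi> r)) - S n r) \<le> inverse (real (Suc n))"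
    by metis
  have "has_Hs_integral s t (\<lambda>r. heat (t - r) (\<lambda>x. ((v r, 0, 0) \<bullet> Q x) * ev (\<psi> r) x - \<kappa> * ev (\<psi> r) x ^ (p + 1)))
     (ev (\<psi> t - heatop t (\<psi> 0)))"
    by (rule has_Hs_integralI[OF S(1) _ S(2) LIMSEQ_inverse_real_of_nat _ F int[OF t]]) (use t in auto)
  moreover have "\<forall>x. ev (\<psi> t) x = heat t (ev (\<psi> 0)) x + ev (\<psi> t - heatop t (\<psi> 0)) x"
    using t by (simp add: heat_ev)
  ultimately show "\<exists>g. has_Hs_integral s t (\<lambda>r. heat (t - r) (\<lambda>x. ((v r, 0, 0) \<bullet> Q x) * ev (\<psi> r) x - \<kappa> * ev (\<psi> r) x ^ (p + 1))) g \<and>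
     (\<forall>x. ev (\<psi> t) x = heat t (ev (\<psi> 0)) x + g x)"
    by blast
qed

lemma L2_control_simple:
  fixes f :: "(int^'d) hl2 \<Rightarrow> real^'q::finite"
  assumes u: "simple_control u"
  shows "L2_control T (\<lambda>r. f (u r))"
proof -
  have su: "simple_fun_on T u"
    unfolding simple_fun_on_def
  proof (intro conjI allI)
    show "finite (u ` {0<..<T})" using u by (auto simp: simple_control_def intro: finite_subset[of _ "range u"])
    fix a
    have "{r \<in> {0<..<T}. u r = a} = {0<..<T} \<inter> {r. u r = a}" by auto
    then show "{r \<in> {0<..<T}. u r = a} \<in> sets borel" using u by (auto simp: simple_control_def)
  qed
  have m: "(\<lambda>r. indicator {0<..<T} r *\<^sub>R (norm (f (u r)))\<^sup>2) \<in> borel_measurable lborel"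
    using simple_fun_on_measurable[OF su su, of "\<lambda>a b. (norm (f a))\<^sup>2"] by simp
  obtain B where B: "\<And>r. (norm (f (u r)))\<^sup>2 \<le> B"
  proof -
    have "finite ((\<lambda>a. (norm (f a))\<^sup>2) ` range u)" using u by (auto simp: simple_control_def)
    then show ?thesis using that[of "Max ((\<lambda>a. (norm (f a))\<^sup>2) ` range u)"] by (auto intro: Max_ge)
  qed
  have "integrable lborel (\<lambda>r. indicator {0<..<T} r *\<^sub>R (norm (f (u r)))\<^sup>2)"
  proof (rule Bochner_Integration.integrable_bound[OF _ m])
    show "integrable lborel (\<lambda>r. indicator {0<..<T} r *\<^sub>R B)"
      by (cases "0 \<le> T") auto
    show "AE r in lborel. norm (indicator {0<..<T} r *\<^sub>R (norm (f (u r)))\<^sup>2) \<le> norm (indicator {0<..<T} r *\<^sub>R B)"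
      using B by (intro AE_I2) (auto simp: indicator_def intro: order_trans[OF _ abs_ge_self])
  qed
  then show ?thesis
    unfolding L2_control_def set_borel_measurable_def set_integrable_def
    using simple_fun_on_measurable[OF su su, of "\<lambda>a b. f a"] by simp
qed

end

section \<open>Approximation in L2 by exponential multipliers\<close>

context sobolev begin

text \<open>The ideal multiplier |b| / |a| is regularised by d in numerator and denominator, so that
  its logarithm is continuous and can be approximated uniformly. The products converge pointwise to
  b, at common zeros because both functions vanish there. They are also bounded, as |a| / (|a| + d)
  is at most 1; dominated convergence then gives L2.\<close>

lemma ex_L2_approx:
  assumes sg: "\<And>x. sgn (ev a x) = sgn (ev b x)" and \<epsilon>: "0 < \<epsilon>"
  shows "\<exists>f. L2_torus_norm (\<lambda>x. ev (E f \<odot> a) x - ev b x) < \<epsilon>"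
proof -
  define d where "d n = inverse (real (Suc n))" for n
  have d: "0 < d n" "d n \<le> 1" for n by (auto simp: d_def inverse_le_1_iff)
  have d0: "d \<longlonglongrightarrow> 0" unfolding d_def by (rule LIMSEQ_inverse_real_of_nat)
  define r where "r n x = (\<bar>ev b x\<bar> + d n) / (\<bar>ev a x\<bar> + d n)" for n x
  have r: "0 < r n x" for n x using d(1)[of n] by (auto simp: r_def intro!: divide_pos_pos add_nonneg_pos)
  have nz: "\<bar>ev a x\<bar> + d n \<noteq> 0" "\<bar>ev b x\<bar> + d n \<noteq> 0" for n x using d(1)[of n] by (auto simp: add_nonneg_eq_0_iff)
  have "\<exists>f. \<forall>x. \<bar>ln (r n x) - ev f x\<bar> < d n" for n
  proof -
    have "continuous_on UNIV (\<lambda>x. ln (r n x))"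
      unfolding r_def using r[of n] nz d(1)[of n] by (intro continuous_intros continuous_ev) (auto simp: r_def)
    moreover have "torus_periodic (\<lambda>x. ln (r n x))"
      using torus_periodic_ev[of a] torus_periodic_ev[of b] by (simp add: torus_periodic_def r_def)
    ultimately show ?thesis using ex_ev_uniform_approx[OF _ _ d(1)[of n]] by metis
  qed
  then obtain f where f: "\<And>n x. \<bar>ln (r n x) - ev (f n) x\<bar> < d n" by metis
  define h where "h n x = ev (E (f n) \<odot> a) x - ev b x" for n x
  have h_eq: "h n x = r n x * ev a x * exp (ev (f n) x - ln (r n x)) - ev b x" for n x
    using r[of n x] by (simp add: h_def exp_diff)
  obtain B where B: "\<And>x. \<bar>ev b x\<bar> \<le> B" using abs_ev_le by blast
  have B0: "B \<ge> 0" using B[of undefined] by linarith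
  have bound: "\<bar>h n x\<bar> \<le> (B + 1) * exp 1 + B" for n x
  proof -
    have "\<bar>r n x * ev a x\<bar> \<le> B + 1"
    proof -
      have "\<bar>r n x * ev a x\<bar> = r n x * \<bar>ev a x\<bar>" using r[of n x] by (simp add: abs_mult)
      also have "\<dots> = (\<bar>ev b x\<bar> + d n) * (\<bar>ev a x\<bar> / (\<bar>ev a x\<bar> + d n))" by (simp add: r_def)
      also have "\<dots> \<le> (B + 1) * 1"
        using B[of x] d[of n] B0 by (intro mult_mono add_mono) (auto simp: divide_le_eq add_nonneg_pos)
      finally show ?thesis by simp
    qed
    moreover have "exp (ev (f n) x - ln (r n x)) \<le> exp 1" using f[of n x] d(2)[of n] by simp
    ultimately have "\<bar>r n x * ev a x * exp (ev (f n) x - ln (r n x))\<bar> \<le> (B + 1) * exp 1"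
      using B0 unfolding abs_mult[of "r n x * ev a x"] by (intro mult_mono) auto
    then show ?thesis using B[of x] unfolding h_eq by linarith
  qed
  have pt: "(\<lambda>n. h n x) \<longlonglongrightarrow> 0" for x
  proof -
    have ra: "(\<lambda>n. r n x * ev a x) \<longlonglongrightarrow> ev b x"
    proof (cases "ev a x = 0")
      case True
      then have "ev b x = 0" using sg[of x] by (simp add: sgn_0_0)
      then show ?thesis using True by simp
    next
      case False
      have "(\<lambda>n. r n x * ev a x) \<longlonglongrightarrow> (\<bar>ev b x\<bar> + 0) / (\<bar>ev a x\<bar> + 0) * ev a x"
        unfolding r_def using False by (intro tendsto_intros d0) auto
      also have "(\<bar>ev b x\<bar> + 0) / (\<bar>ev a x\<bar> + 0) * ev a x = \<bar>ev b x\<bar> * sgn (ev a x)"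
        using False by (simp add: sgn_if)
      also have "\<dots> = ev b x" by (simp add: sg abs_mult_sgn)
      finally show ?thesis .
    qed
    have "(\<lambda>n. ev (f n) x - ln (r n x)) \<longlonglongrightarrow> 0"
      by (rule Lim_null_comparison[OF _ d0]) (use f in \<open>auto simp: abs_minus_commute less_imp_le\<close>)
    from tendsto_diff[OF tendsto_mult[OF ra tendsto_exp[OF this]] tendsto_const, of "ev b x"]
    show ?thesis by (simp add: h_eq)
  qed
  have hc: "continuous_on UNIV (h n)" for n unfolding h_def by (intro continuous_intros continuous_ev)
  have si: "set_integrable lborel torus_cell (\<lambda>x. (h n x)\<^sup>2)" for n
    by (rule set_integrable_torus) (intro continuous_intros hc)
  let ?C = "((B + 1) * exp 1 + B)\<^sup>2"
  have "(\<lambda>n. LINT x|lborel. indicator torus_cell x *\<^sub>R (h n x)\<^sup>2) \<longlonglongrightarrow> (LINT x::real^'d|lborel. (0::real))"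
  proof (rule integral_dominated_convergence)
    show "(\<lambda>x. indicator torus_cell x *\<^sub>R (h n x)\<^sup>2) \<in> borel_measurable lborel" for n
      using si[of n] unfolding set_integrable_def by (rule borel_measurable_integrable)
    have "set_integrable lborel torus_cell (\<lambda>x::real^'d. ?C)"
      by (rule set_integrable_torus) (rule continuous_on_const)
    then show "integrable lborel (\<lambda>x. indicator torus_cell (x::real^'d) * ?C)" by (simp add: set_integrable_def)
    show "AE x in lborel. (\<lambda>n. indicator torus_cell x *\<^sub>R (h n x)\<^sup>2) \<longlonglongrightarrow> 0"
    proof (rule AE_I2)
      fix x
      have "(\<lambda>n. indicator torus_cell x *\<^sub>R (h n x)\<^sup>2) \<longlonglongrightarrow> indicator torus_cell x *\<^sub>R 0\<^sup>2"
        by (intro tendsto_intros pt)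
      then show "(\<lambda>n. indicator torus_cell x *\<^sub>R (h n x)\<^sup>2) \<longlonglongrightarrow> 0" by simp
    qed
    show "AE x in lborel. norm (indicator torus_cell x *\<^sub>R (h n x)\<^sup>2) \<le> indicator torus_cell x * ?C" for n
      using bound by (intro AE_I2) (auto simp: indicator_def abs_le_square_iff[symmetric] intro: order_trans[OF _ abs_ge_self])
  qed simp
  then have "(\<lambda>n. L2_torus_norm (h n)) \<longlonglongrightarrow> sqrt 0"
    unfolding L2_torus_norm_def set_lebesgue_integral_def by (intro tendsto_intros) simp
  then have "\<forall>\<^sub>F n in sequentially. L2_torus_norm (h n) < \<epsilon>" using \<epsilon> by (intro order_tendstoD) auto
  then obtain n where "L2_torus_norm (h n) < \<epsilon>" by (auto simp: eventually_sequentially)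
  then show ?thesis unfolding h_def[abs_def] by blast
qed

text \<open>The inequality (f + g)^2 \<le> 2 f^2 + 2 g^2 loses a factor 2 in general but is sharp
  for two halves of \<epsilon>, so it replaces Minkowski's inequality here.\<close>

lemma L2_torus_norm_add_lt:
  fixes f g :: "real^'d \<Rightarrow> real"
  assumes "continuous_on UNIV f" "continuous_on UNIV g" "L2_torus_norm f < \<epsilon> / 2" "L2_torus_norm g < \<epsilon> / 2"
  shows "L2_torus_norm (\<lambda>x. f x + g x) < \<epsilon>"
proof -
  have i: "set_integrable lborel torus_cell (\<lambda>x. (h x)\<^sup>2)" if "continuous_on UNIV h" for h :: "real^'d \<Rightarrow> real"
    by (rule set_integrable_torus) (intro continuous_intros that)
  have n0: "0 \<le> (LINT x:torus_cell|lborel. (h x)\<^sup>2)" for h :: "real^'d \<Rightarrow> real"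
    unfolding set_lebesgue_integral_def by (rule integral_nonneg_AE) auto
  have lt: "(LINT x:torus_cell|lborel. (h x)\<^sup>2) < (\<epsilon> / 2)\<^sup>2" if "L2_torus_norm h < \<epsilon> / 2" for h :: "real^'d \<Rightarrow> real"
  proof -
    have "(L2_torus_norm h)\<^sup>2 < (\<epsilon> / 2)\<^sup>2" using that n0[of h] by (intro power_strict_mono) (auto simp: L2_torus_norm_def)
    then show ?thesis using n0[of h] by (simp add: L2_torus_norm_def)
  qed
  have "0 \<le> L2_torus_norm f" using n0[of f] by (simp add: L2_torus_norm_def)
  then have \<epsilon>: "0 < \<epsilon>" using assms(3) by linarith
  have "(LINT x:torus_cell|lborel. (f x + g x)\<^sup>2) \<le> (LINT x:torus_cell|lborel. 2 * (f x)\<^sup>2 + 2 * (g x)\<^sup>2)"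
  proof (rule set_integral_mono)
    show "(f x + g x)\<^sup>2 \<le> 2 * (f x)\<^sup>2 + 2 * (g x)\<^sup>2" for x
      using zero_le_power2[of "f x - g x"] by (simp add: power2_eq_square algebra_simps)
    show "set_integrable lborel torus_cell (\<lambda>x. (f x + g x)\<^sup>2)"
      by (rule i) (intro continuous_intros assms)
    show "set_integrable lborel torus_cell (\<lambda>x. 2 * (f x)\<^sup>2 + 2 * (g x)\<^sup>2)"
      by (rule set_integrable_torus) (intro continuous_intros assms)
  qed
  also have "\<dots> = (LINT x:torus_cell|lborel. 2 * (f x)\<^sup>2) + (LINT x:torus_cell|lborel. 2 * (g x)\<^sup>2)"
    by (rule set_integral_add(2)) (rule set_integrable_torus, intro continuous_intros assms)+
  also have "\<dots> = 2 * (LINT x:torus_cell|lborel. (f x)\<^sup>2) + 2 * (LINT x:torus_cell|lborel. (g x)\<^sup>2)"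
    by (simp only: set_integral_mult_right)
  also have "\<dots> < \<epsilon>\<^sup>2" using lt[OF assms(3)] lt[OF assms(4)] by (simp add: power_divide)
  finally show ?thesis unfolding L2_torus_norm_def using \<epsilon> by (intro real_less_lsqrt) auto
qed

end

section \<open>Reachable states come from mild solutions\<close>

context controlled begin

lemma reach_imp_mild_solution:
  fixes Q :: "real^'d \<Rightarrow> (real^'q::finite) \<times> real \<times> real"
  assumes U: "\<And>V. V \<in> U \<Longrightarrow> ev V \<in> span_of_family (\<lambda>j x. fst (Q x) $ j)" and r: "reach T a b"
  shows "\<exists>v. L2_control T v \<and> (\<exists>\<psi>. mild_solution s \<kappa> p Q (ev a) (\<lambda>t. (v t, 0, 0)) T \<psi> \<and> \<psi> T = ev b)"
proof -
  obtain u \<psi> where T: "0 \<le> T" and tr: "trajectory u T \<psi>" and \<psi>: "\<psi> 0 = a" "\<psi> T = b"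
    using r by (auto simp: reach_def)
  have u: "simple_control u" using tr by (simp add: trajectory_def)
  \<comment> \<open>Picks coefficients for each potential. As the control potential is simple, the
    chosen coefficients again form a simple function of time, hence an L2 control.\<close>
  define f where "f V = (SOME c::real^'q. \<forall>x. c \<bullet> fst (Q x) = ev V x)" for V
  have f: "f V \<bullet> fst (Q x) = ev V x" if V: "V \<in> U" for V x
  proof -
    obtain c where "ev V = (\<lambda>x. \<Sum>j\<in>UNIV. c j * fst (Q x) $ j)" using U[OF V] by (auto simp: span_of_family_def)
    then have "\<forall>x. (\<chi> j. c j) \<bullet> fst (Q x) = ev V x" by (simp add: inner_vec_def)
    then show ?thesis unfolding f_def by (rule someI2) simp
  qed
  have "mild_solution s \<kappa> p Q (ev (\<psi> 0)) (\<lambda>t. (f (u t), 0, 0)) T (\<lambda>t. ev (\<psi> t))"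
    by (rule mild_solution_ev[OF tr T]) (rule f, use u in \<open>auto simp: simple_control_def\<close>)
  then show ?thesis using \<psi> L2_control_simple[OF u] by blast
qed

end

section \<open>Assembly of the two statements\<close>

lemma span_of_family_add:
  assumes "f \<in> span_of_family F" "g \<in> span_of_family F"
  shows "(\<lambda>x. f x + g x) \<in> span_of_family F"
proof -
  obtain c where c: "f = (\<lambda>x. \<Sum>j\<in>UNIV. c j * F j x)"
    using assms(1) unfolding span_of_family_def mem_Collect_eq by (elim exE)
  obtain d where d: "g = (\<lambda>x. \<Sum>j\<in>UNIV. d j * F j x)"
    using assms(2) unfolding span_of_family_def mem_Collect_eq by (elim exE)
  have "(\<lambda>x. f x + g x) = (\<lambda>x. \<Sum>j\<in>UNIV. (c j + d j) * F j x)"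
    unfolding c d by (simp only: sum.distrib distrib_right)
  then show ?thesis unfolding span_of_family_def mem_Collect_eq by (rule exI[of _ "\<lambda>j. c j + d j"])
qed

lemma span_of_family_scale:
  assumes "f \<in> span_of_family F"
  shows "(\<lambda>x. r * f x) \<in> span_of_family F"
proof -
  obtain c where c: "f = (\<lambda>x. \<Sum>j\<in>UNIV. c j * F j x)"
    using assms unfolding span_of_family_def mem_Collect_eq by (elim exE)
  have "(\<lambda>x. r * f x) = (\<lambda>x. \<Sum>j\<in>UNIV. (r * c j) * F j x)"
    unfolding c by (simp only: sum_distrib_left mult.assoc)
  then show ?thesis unfolding span_of_family_def mem_Collect_eq by (rule exI[of _ "\<lambda>j. r * c j"])
qed

theorem theoremA:
  fixes Q :: "real^('d::{finite,linorder}) \<Rightarrow> (real^'q::finite) \<times> real \<times> real"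
    and s p :: nat and \<kappa> :: real
  assumes q: "CARD('q) \<ge> 2 * CARD('d) + 1"
    and Q_per: "torus_periodic Q"
    and Q_bdd: "bounded (range Q)"
    and Q_meas: "Q \<in> borel_measurable lebesgue"
    and s: "s \<ge> 1" "real s > real CARD('d) / 2"
    and Q_smooth: "\<And>j. C_infinity (\<lambda>x. fst (Q x) $ j)"
    and Q_span: "{\<lambda>x. 1} \<union> (\<Union>k\<in>control_freqs. {\<lambda>x. cos (freq_dot k x), \<lambda>x. sin (freq_dot k x)})
                   \<subseteq> span_of_family (\<lambda>j x. fst (Q x) $ j)"
  shows "(\<forall>\<psi>0\<in>Hs s. \<forall>\<psi>1\<in>Hs s. (\<forall>x. sgn (\<psi>0 x) = sgn (\<psi>1 x)) \<longrightarrow>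
            (\<forall>\<epsilon>>0. \<forall>T>0. \<exists>\<tau>\<in>{0..T}. \<exists>v. L2_control \<tau> v \<and>
               (\<exists>\<psi>. mild_solution s \<kappa> p Q \<psi>0 (\<lambda>t. (v t, 0, 0)) \<tau> \<psi> \<and>
                    L2_torus_norm (\<psi> \<tau> - \<psi>1) < \<epsilon>)))
       \<and> (\<forall>\<psi>0\<in>Hs s. \<forall>\<psi>1\<in>Hs s.
            (\<forall>x. \<psi>0 x > 0 \<and> \<psi>1 x > 0) \<or> (\<forall>x. \<psi>0 x < 0 \<and> \<psi>1 x < 0) \<longrightarrow>
            (\<forall>\<epsilon>>0. \<forall>T>0. \<exists>v. L2_control T v \<and>
               (\<exists>\<psi>. mild_solution s \<kappa> p Q \<psi>0 (\<lambda>t. (v t, 0, 0)) T \<psi> \<and>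
                    Hs_norm s (\<psi> T - \<psi>1) < \<epsilon>)))"
proof -
  define W :: "int^'d::{finite,linorder} \<Rightarrow> real" where "W = (\<lambda>k. sqrt ((1 + freq_norm_sq k) ^ s))"
  interpret sobolev s W by (rule sobolev.intro[OF s(2) W_def])
  define SP where "SP = span_of_family (\<lambda>j x. fst (Q x) $ j)"
  define U where "U = {V. ev V \<in> SP}"
  note SP_add = span_of_family_add[of _ "\<lambda>j x. fst (Q x) $ j", folded SP_def]
    and SP_scale = span_of_family_scale[of _ "\<lambda>j x. fst (Q x) $ j", folded SP_def]
  have SP1: "(\<lambda>x. 1) \<in> SP" and SPc: "k \<in> control_freqs \<Longrightarrow> (\<lambda>x. cos (freq_dot k x)) \<in> SP"
    and SPs: "k \<in> control_freqs \<Longrightarrow> (\<lambda>x. sin (freq_dot k x)) \<in> SP" for k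
    using Q_span by (auto simp: SP_def)
  have cst_U: "cst c \<in> U" for c
    using SP_scale[OF SP1, of c] by (simp add: U_def ev_cst[abs_def])
  interpret controlled s W \<kappa> p U
  proof unfold_locales
    show "subspace U"
    proof (rule subspaceI)
      show "0 \<in> U" using SP_scale[OF SP1, of 0] by (simp add: U_def ev_zero_fun)
      show "x + y \<in> U" if "x \<in> U" "y \<in> U" for x y
        using SP_add that by (simp add: U_def ev_add_fun)
      show "c *\<^sub>R x \<in> U" if "x \<in> U" for c x
        using SP_scale that by (simp add: U_def ev_scaleR_fun)
    qed
  qed (rule cst_U)
  have blk_U: "blk z k \<in> U" if k: "k \<in> control_freqs" for z k
  proof -
    have "ev (blk z k) = (\<lambda>x. Re z * cos (freq_dot k x) + (- Im z) * sin (freq_dot k x))"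
      by (auto simp: fun_eq_iff ev_blk)
    moreover have "(\<lambda>x. Re z * cos (freq_dot k x) + (- Im z) * sin (freq_dot k x)) \<in> SP"
      by (rule SP_add[OF SP_scale[OF SPc[OF k]] SP_scale[OF SPs[OF k]]])
    ultimately show ?thesis unfolding U_def mem_Collect_eq by (simp only:)
  qed
  \<comment> \<open>Closure under negation holds because a block at - k is the block at k with the
    conjugate coefficient.\<close>
  have "k \<in> {k. \<forall>z. blk z k \<in> attainable}" for k
  proof (rule frequencies_saturated)
    show "control_freqs \<subseteq> {k. \<forall>z. blk z k \<in> attainable}" using blk_U U_subset_attainable by blast
  qed (use attainable_blk_add in \<open>auto simp: blk_uminus_freq\<close>)
  then have steer: "steer a (mul (E f) a)" for a f
    using attainable_UNIV[of f] by (simp add: attainable_def)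
  have U_SP: "ev V \<in> span_of_family (\<lambda>j x. fst (Q x) $ j)" if "V \<in> U" for V using that by (simp add: U_def SP_def)
  have mild: "\<exists>v. L2_control T v \<and> (\<exists>\<psi>. mild_solution s \<kappa> p Q (ev a) (\<lambda>t. (v t, 0, 0)) T \<psi> \<and> \<psi> T = ev b)"
    if "reach T a b" for T a b
    by (rule reach_imp_mild_solution[OF _ that]) (rule U_SP)
  show ?thesis
  proof (intro conjI ballI impI allI)
    fix \<psi>0 \<psi>1 :: "real^'d::{finite,linorder} \<Rightarrow> real" and \<epsilon> T :: real
    assume "\<psi>0 \<in> Hs s" "\<psi>1 \<in> Hs s" and sg: "\<forall>x. sgn (\<psi>0 x) = sgn (\<psi>1 x)" and \<epsilon>: "0 < \<epsilon>" and T: "0 < T"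
    obtain a where a: "\<psi>0 = ev a" using Hs_imp_ev[OF \<open>\<psi>0 \<in> Hs s\<close>] by blast
    obtain b where b: "\<psi>1 = ev b" using Hs_imp_ev[OF \<open>\<psi>1 \<in> Hs s\<close>] by blast
    note ab = a b
    obtain f where f: "L2_torus_norm (\<lambda>x. ev (mul (E f) a) x - ev b x) < \<epsilon> / 2"
      using ex_L2_approx[of a b "\<epsilon> / 2"] sg \<epsilon> ab by auto
    \<comment> \<open>Dominates the constant between the L2 and the Sobolev norm: Z for passing to
      the supremum norm and the root of the volume for L2. The summand 1 keeps it positive.\<close>
    define C where "C = sqrt ((2*pi)^CARD('d)) * (Z + 1)"
    have C: "C > 0" using Z_nonneg by (simp add: C_def add_nonneg_pos)
    obtain \<tau> b' where \<tau>: "0 < \<tau>" "\<tau> \<le> T" "reach \<tau> a b'" "norm (b' - mul (E f) a) < \<epsilon> / (2 * C)"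
      using steer[of a f] \<epsilon> C T unfolding steer_def
      by (metis diff_self norm_zero divide_pos_pos mult_pos_pos zero_less_numeral)
    have "L2_torus_norm (\<lambda>x. ev (b' - mul (E f) a) x) \<le> sqrt ((2*pi)^CARD('d)) * (Z * norm (b' - mul (E f) a))"
      by (rule L2_torus_norm_le[OF continuous_ev abs_ev_le])
    also have "\<dots> \<le> C * norm (b' - mul (E f) a)" unfolding C_def by (simp add: mult.assoc mult_left_mono mult_right_mono)
    also have "\<dots> < \<epsilon> / 2" using \<tau>(4) C by (simp add: field_simps)
    finally have "L2_torus_norm (\<lambda>x. ev (b' - mul (E f) a) x) < \<epsilon> / 2" .
    from L2_torus_norm_add_lt[OF _ _ this f]
    have "L2_torus_norm (\<lambda>x. ev (b' - mul (E f) a) x + (ev (mul (E f) a) x - ev b x)) < \<epsilon>"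
      by (simp only: continuous_ev continuous_on_diff)
    moreover have "(\<lambda>x. ev (b' - mul (E f) a) x + (ev (mul (E f) a) x - ev b x)) = ev b' - \<psi>1" by (auto simp: ab)
    ultimately have "L2_torus_norm (ev b' - \<psi>1) < \<epsilon>" by simp
    obtain v \<psi> where v: "L2_control \<tau> v" "mild_solution s \<kappa> p Q \<psi>0 (\<lambda>t. (v t, 0, 0)) \<tau> \<psi>" "\<psi> \<tau> = ev b'"
      using mild[OF \<tau>(3)] unfolding a by blast
    have "L2_torus_norm (\<psi> \<tau> - \<psi>1) < \<epsilon>" unfolding v(3) by fact
    with v(1,2) show "\<exists>\<tau>\<in>{0..T}. \<exists>v. L2_control \<tau> v \<and> (\<exists>\<psi>. mild_solution s \<kappa> p Q \<psi>0 (\<lambda>t. (v t, 0, 0)) \<tau> \<psi> \<and> L2_torus_norm (\<psi> \<tau> - \<psi>1) < \<epsilon>)"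
      using \<tau>(1,2) by (intro bexI[of _ \<tau>] exI conjI) auto
  next
    fix \<psi>0 \<psi>1 :: "real^'d::{finite,linorder} \<Rightarrow> real" and \<epsilon> T :: real
    assume "\<psi>0 \<in> Hs s" "\<psi>1 \<in> Hs s" and pos: "(\<forall>x. 0 < \<psi>0 x \<and> 0 < \<psi>1 x) \<or> (\<forall>x. \<psi>0 x < 0 \<and> \<psi>1 x < 0)"
      and \<epsilon>: "0 < \<epsilon>" and T: "0 < T"
    obtain a where a: "\<psi>0 = ev a" using Hs_imp_ev[OF \<open>\<psi>0 \<in> Hs s\<close>] by blast
    obtain b where b: "\<psi>1 = ev b" using Hs_imp_ev[OF \<open>\<psi>1 \<in> Hs s\<close>] by blast
    note ab = a b
    \<comment> \<open>The common sign of both states, 1 or - 1. Multiplying with it gives positive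
      functions, which have logarithms, and the constant used as the waiting state is \<sigma>
      itself: dividing a by \<sigma> a leaves 1 / \<sigma> = \<sigma>.\<close>
    obtain \<sigma> :: real where \<sigma>: "\<sigma> * \<sigma> = 1" "\<And>x. 0 < ev (\<sigma> *\<^sub>R a) x" "\<And>x. 0 < ev (\<sigma> *\<^sub>R b) x"
      using pos
    proof
      assume "\<forall>x. 0 < \<psi>0 x \<and> 0 < \<psi>1 x"
      then show ?thesis using that[of 1] by (simp add: ab)
    next
      assume "\<forall>x. \<psi>0 x < 0 \<and> \<psi>1 x < 0"
      then show ?thesis using that[of "- 1"] by (simp add: ab)
    qed
    obtain f where f: "\<And>x. ev f x = ln (ev (\<sigma> *\<^sub>R a) x)" using ex_log[OF \<sigma>(2)] by metis
    obtain g where g: "\<And>x. ev g x = ln (ev (\<sigma> *\<^sub>R b) x)" using ex_log[OF \<sigma>(3)] by metis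
    have "mul (E (- f)) a = cst \<sigma>"
    proof (rule ev_inj)
      fix x
      have nz: "\<sigma> * ev a x \<noteq> 0" using \<sigma>(2)[of x] unfolding ev_scaleR by (rule less_imp_neq[symmetric])
      have "ev (mul (E (- f)) a) x = ev a x / (\<sigma> * ev a x)" using \<sigma>(2)[of x] by (simp add: f exp_minus divide_inverse mult.commute)
      also have "\<dots> = \<sigma>" using nz \<sigma>(1) by (simp add: divide_eq_eq mult.assoc[symmetric])
      finally show "ev (mul (E (- f)) a) x = ev (cst \<sigma>) x" by simp
    qed
    then have s1: "steer a (cst \<sigma>)" using steer[of a "- f"] by simp
    have "mul (E g) (cst \<sigma>) = b"
    proof (rule ev_inj)
      fix x
      have "ev (mul (E g) (cst \<sigma>)) x = (\<sigma> * \<sigma>) * ev b x" using \<sigma>(3)[of x] by (simp add: g mult_ac)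
      then show "ev (mul (E g) (cst \<sigma>)) x = ev b x" by (simp only: \<sigma>(1) mult_1)
    qed
    then have s2: "steer (cst \<sigma>) b" using steer[of "cst \<sigma>" g] by simp
    obtain b' where b': "reach T a b'" "norm (b' - b) < \<epsilon>" using steer_exact_time[OF s1 s2 \<epsilon> T] by metis
    have "ev b' - \<psi>1 = ev (b' - b)" by (auto simp: ab)
    then have "Hs_norm s (ev b' - \<psi>1) < \<epsilon>" using b'(2) by (simp add: Hs_norm_ev)
    obtain v \<psi> where v: "L2_control T v" "mild_solution s \<kappa> p Q \<psi>0 (\<lambda>t. (v t, 0, 0)) T \<psi>" "\<psi> T = ev b'"
      using mild[OF b'(1)] unfolding a by blast
    have "Hs_norm s (\<psi> T - \<psi>1) < \<epsilon>" unfolding v(3) by fact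
    with v(1,2) show "\<exists>v. L2_control T v \<and> (\<exists>\<psi>. mild_solution s \<kappa> p Q \<psi>0 (\<lambda>t. (v t, 0, 0)) T \<psi> \<and> Hs_norm s (\<psi> T - \<psi>1) < \<epsilon>)"
      by blast
  qed
qed

end
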